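(* The square of functors formed by $\mathsf{bpt}:\mathbf{BiFrm_{fin}}^{op}\to\mathbf{BiTop}$, $Sk:\mathbf{BiTop}\to\mathbf{BiTop}$ and $\mathsf A:\mathbf{BiFrm_{fin}}^{op}\to\mathbf{BiFrm_{fin}}^{op}$ commutes up to natural isomorphism: $Sk\circ\mathsf{bpt}\cong\mathsf{bpt}\circ\mathsf A$.
   Context: A biframe is a triple $\mathcal L=(L^+,L^-,L)$ of frames with injective frame maps $e_L^{\pm}:L^{\pm}\to L$ such that every element of $L$ (the main component) is a join of elements $e_L^+(x^+)\wedge e_L^-(x^-)$; we identify $x^{\pm}$ with $e_L^{\pm}(x^{\pm})$. A biframe map $(f^+,f^-):\mathcal L\to\mathcal M$ is a pair of frame maps $f^{\pm}:L^{\pm}\to M^{\pm}$ for which there is a (necessarily unique) frame map $f:L\to M$ with $f\circ e_L^{\pm}=e_M^{\pm}\circ f^{\pm}$. A relation $R$ on a frame is treated as a set of inequalities: the quotient by $R$ is the universal frame quotient $q$ with $q(a)\le q(b)$ for $(a,b)\in R$; the congruence generated by $R$ is the kernel of $q$. $\mathsf{fin}(L)\subseteq L$ is the set of finite joins of elements $x^+\wedge x^-$; a congruence on $L$ is finitary if generated by some $R\subseteq\mathsf{fin}(L)\times\mathsf{fin}(L)$. With $L^+\oplus L^-$ the frame coproduct and $C_L$ the kernel of the canonical surjection $L^+\oplus L^-\to L$, $\mathcal L$ is finitary if $C_L$ is a finitary congruence on $L^+\oplus L^-$ (the main component of $(L^+,L^-,L^+\oplus L^-)$). $\mathbf{BiFrm_{fin}}$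 is the category of finitary biframes and biframe maps. $\mathsf A(L)$ is the frame of congruences on $L$ ordered by inclusion; $\nabla(a)=\{(x,y):x\vee a=y\vee a\}$, $\Delta(a)=\{(x,y):x\wedge a=y\wedge a\}$. The assembly $\mathsf A(\mathcal L)$ is the (finitary, when $\mathcal L$ is) biframe whose positive, negative and main components are the subframes of $\mathsf A(L)$ generated respectively by $\{\nabla(a^+):a^+\in L^+\}\cup\{\Delta(a^-):a^-\in L^-\}$, by $\{\nabla(a^-):a^-\in L^-\}\cup\{\Delta(a^+):a^+\in L^+\}$, and by $\{\nabla(x):x\in L\}\cup\{\Delta(s):s\in\mathsf{fin}(L)\}$. For a biframe map $f:\mathcal L\to\mathcal M$, $\mathsf A(f):\mathsf A(\mathcal L)\to\mathsf A(\mathcal M)$ is the biframe map with $\nabla(x^{\pm})\mapsto\nabla(f^{\pm}(x^{\pm}))$ and $\Delta(x^{\pm})\mapsto\Delta(f^{\pm}(x^{\pm}))$. A bispace is a set $X$ with two topologies $\Omega^+(X),\Omega^-(X)$; $\mathbf{BiTop}$ is the category of bispaces and bicontinuous maps (continuous for both topologies). $Sk(X)$ (Skula bispace) has the same points as $X$; its positive topology is generated by the positive opens and the negative closed sets of $X$, its negative topology by the negative opens and the positive closed sets of $X$; $Sk$ leaves the underlying functions of morphisms unchanged. $\mathsf{bpt}(\mathcal L)$ is the bispace of biframe maps $\mathcal L\to(2,2,2)$ with positive opens $\{f:f^+(a^+)=1\}$ ($a^+\in L^+$) and negative opens $\{f:f^-(a^-)=1\}$ ($a^-\in L^-$); on morphisms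 it acts by precomposition. *)

theory Defs
  imports "HOL-Analysis.Abstract_Topology" "HOL-Algebra.Complete_Lattice"
begin

section \<open>Frames\<close>

text \<open>
  Frames are carrier-based (\<open>gorder\<close> of HOL-Algebra), because the components of an assembly
  are subsets of the set of congruences of another frame.  All arrows are extensional functions
  on the carrier, so that equality of arrows is equality of HOL functions.
\<close>

locale frame = complete_lattice L for L (structure) +
  assumes meet_sup_distrib:
    "\<lbrakk>a \<in> carrier L; B \<subseteq> carrier L\<rbrakk> \<Longrightarrow> a \<sqinter> (\<Squnion>B) = \<Squnion>((\<lambda>b. a \<sqinter> b) ` B)"

definition frame_map :: "'a gorder \<Rightarrow> 'b gorder \<Rightarrow> ('a \<Rightarrow> 'b) \<Rightarrow> bool" where
  "frame_map L M f \<longleftrightarrow>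
     f \<in> carrier L \<rightarrow>\<^sub>E carrier M \<and>
     f \<top>\<^bsub>L\<^esub> = \<top>\<^bsub>M\<^esub> \<and>
     (\<forall>a\<in>carrier L. \<forall>b\<in>carrier L. f (a \<sqinter>\<^bsub>L\<^esub> b) = f a \<sqinter>\<^bsub>M\<^esub> f b) \<and>
     (\<forall>S. S \<subseteq> carrier L \<longrightarrow> f (\<Squnion>\<^bsub>L\<^esub> S) = \<Squnion>\<^bsub>M\<^esub> (f ` S))"

definition subframe :: "'a set \<Rightarrow> 'a gorder \<Rightarrow> bool" where
  "subframe S L \<longleftrightarrow>
     S \<subseteq> carrier L \<and> \<top>\<^bsub>L\<^esub> \<in> S \<and>
     (\<forall>a\<in>S. \<forall>b\<in>S. a \<sqinter>\<^bsub>L\<^esub> b \<in> S) \<and>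
     (\<forall>T. T \<subseteq> S \<longrightarrow> \<Squnion>\<^bsub>L\<^esub> T \<in> S)"

definition generated_subframe :: "'a gorder \<Rightarrow> 'a set \<Rightarrow> 'a gorder" where
  "generated_subframe L G = L\<lparr>carrier := \<Inter>{S. subframe S L \<and> G \<subseteq> S}\<rparr>"

definition two_frame :: "bool gorder" where
  "two_frame = \<lparr>carrier = UNIV, eq = (=), le = (\<le>)\<rparr>"

subsection \<open>Frame congruences\<close>

definition frame_congruence :: "'a gorder \<Rightarrow> ('a \<times> 'a) set \<Rightarrow> bool" where
  "frame_congruence L \<theta> \<longleftrightarrow>
     equiv (carrier L) \<theta> \<and>
     (\<forall>a b c d. (a, b) \<in> \<theta> \<and> (c, d) \<in> \<theta> \<longrightarrow> (a \<sqinter>\<^bsub>L\<^esub> c, b \<sqinter>\<^bsub>L\<^esub> d) \<in> \<theta>) \<and>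
     (\<forall>S. S \<subseteq> \<theta> \<longrightarrow> (\<Squnion>\<^bsub>L\<^esub> (fst ` S), \<Squnion>\<^bsub>L\<^esub> (snd ` S)) \<in> \<theta>)"

text \<open>
  For the quotient map \<open>q\<close> of a congruence \<open>\<theta>\<close>, the inequality \<open>q a \<le> q b\<close> says
  \<open>q (a \<sqinter> b) = q a\<close>, i.e. \<open>(a \<sqinter> b, a) \<in> \<theta>\<close>.  Congruences are the kernels of frame maps, so the
  kernel of the universal quotient with \<open>q a \<le> q b\<close> for all \<open>(a, b) \<in> R\<close> is the following
  intersection.
\<close>

definition generated_congruence :: "'a gorder \<Rightarrow> ('a \<times> 'a) set \<Rightarrow> ('a \<times> 'a) set" where
  "generated_congruence L R =
     \<Inter>{\<theta>. frame_congruence L \<theta> \<and> (\<forall>(a, b)\<in>R. (a \<sqinter>\<^bsub>L\<^esub> b, a) \<in> \<theta>)}"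

definition congruence_frame :: "'a gorder \<Rightarrow> ('a \<times> 'a) set gorder" where
  "congruence_frame L = \<lparr>carrier = {\<theta>. frame_congruence L \<theta>}, eq = (=), le = (\<subseteq>)\<rparr>"

definition nabla :: "'a gorder \<Rightarrow> 'a \<Rightarrow> ('a \<times> 'a) set" where
  "nabla L a = {(x, y). x \<in> carrier L \<and> y \<in> carrier L \<and> x \<squnion>\<^bsub>L\<^esub> a = y \<squnion>\<^bsub>L\<^esub> a}"

definition delta :: "'a gorder \<Rightarrow> 'a \<Rightarrow> ('a \<times> 'a) set" where
  "delta L a = {(x, y). x \<in> carrier L \<and> y \<in> carrier L \<and> x \<sqinter>\<^bsub>L\<^esub> a = y \<sqinter>\<^bsub>L\<^esub> a}"

subsection \<open>Binary coproducts\<close>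

text \<open>
  The frame coproduct in its standard presentation by C-ideals: down-sets of the product that are
  closed under joins in each coordinate separately (with an empty \<open>S\<close> allowed, so that all pairs
  with a bottom coordinate belong to every C-ideal).
\<close>

definition c_ideal :: "'a gorder \<Rightarrow> 'b gorder \<Rightarrow> ('a \<times> 'b) set \<Rightarrow> bool" where
  "c_ideal A B D \<longleftrightarrow>
     D \<subseteq> carrier A \<times> carrier B \<and>
     (\<forall>(a, b)\<in>D. \<forall>a'\<in>carrier A. \<forall>b'\<in>carrier B.
        a' \<sqsubseteq>\<^bsub>A\<^esub> a \<and> b' \<sqsubseteq>\<^bsub>B\<^esub> b \<longrightarrow> (a', b') \<in> D) \<and>
     (\<forall>S. \<forall>b\<in>carrier B. S \<subseteq> carrier A \<and> S \<times> {b} \<subseteq> D \<longrightarrow> (\<Squnion>\<^bsub>A\<^esub> S, b) \<in> D) \<and>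
     (\<forall>a\<in>carrier A. \<forall>S. S \<subseteq> carrier B \<and> {a} \<times> S \<subseteq> D \<longrightarrow> (a, \<Squnion>\<^bsub>B\<^esub> S) \<in> D)"

definition frame_coproduct :: "'a gorder \<Rightarrow> 'b gorder \<Rightarrow> ('a \<times> 'b) set gorder" where
  "frame_coproduct A B = \<lparr>carrier = {D. c_ideal A B D}, eq = (=), le = (\<subseteq>)\<rparr>"

definition coproduct_inl :: "'a gorder \<Rightarrow> 'b gorder \<Rightarrow> 'a \<Rightarrow> ('a \<times> 'b) set" where
  "coproduct_inl A B = (\<lambda>x\<in>carrier A.
     {(a, b). a \<in> carrier A \<and> b \<in> carrier B \<and> (a \<sqsubseteq>\<^bsub>A\<^esub> x \<or> b = \<bottom>\<^bsub>B\<^esub>)})"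

definition coproduct_inr :: "'a gorder \<Rightarrow> 'b gorder \<Rightarrow> 'b \<Rightarrow> ('a \<times> 'b) set" where
  "coproduct_inr A B = (\<lambda>y\<in>carrier B.
     {(a, b). a \<in> carrier A \<and> b \<in> carrier B \<and> (b \<sqsubseteq>\<^bsub>B\<^esub> y \<or> a = \<bottom>\<^bsub>A\<^esub>)})"

text \<open>
  The frame map out of the coproduct induced by \<open>f\<close> and \<open>g\<close>: a C-ideal \<open>D\<close> is the join of the
  elements \<open>inl a \<sqinter> inr b\<close> with \<open>(a, b) \<in> D\<close>.
\<close>

definition copairing ::
  "'a gorder \<Rightarrow> 'b gorder \<Rightarrow> 'c gorder \<Rightarrow> ('a \<Rightarrow> 'c) \<Rightarrow> ('b \<Rightarrow> 'c) \<Rightarrow> ('a \<times> 'b) set \<Rightarrow> 'c" where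
  "copairing A B L f g = (\<lambda>D\<in>carrier (frame_coproduct A B).
     \<Squnion>\<^bsub>L\<^esub> ((\<lambda>(a, b). f a \<sqinter>\<^bsub>L\<^esub> g b) ` D))"


section \<open>Biframes\<close>

record ('p, 'n, 'm) biframe =
  pos :: "'p gorder"
  neg :: "'n gorder"
  main :: "'m gorder"
  epos :: "'p \<Rightarrow> 'm"
  eneg :: "'n \<Rightarrow> 'm"

definition meet_pn :: "('p, 'n, 'm) biframe \<Rightarrow> 'p \<times> 'n \<Rightarrow> 'm" where
  "meet_pn L = (\<lambda>(x, y). epos L x \<sqinter>\<^bsub>main L\<^esub> eneg L y)"

definition biframe :: "('p, 'n, 'm) biframe \<Rightarrow> bool" where
  "biframe L \<longleftrightarrow>
     frame (pos L) \<and> frame (neg L) \<and> frame (main L) \<and>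
     frame_map (pos L) (main L) (epos L) \<and> inj_on (epos L) (carrier (pos L)) \<and>
     frame_map (neg L) (main L) (eneg L) \<and> inj_on (eneg L) (carrier (neg L)) \<and>
     (\<forall>a\<in>carrier (main L). \<exists>P \<subseteq> carrier (pos L) \<times> carrier (neg L).
        a = \<Squnion>\<^bsub>main L\<^esub> (meet_pn L ` P))"

definition biframe_map ::
  "('p, 'n, 'm) biframe \<Rightarrow> ('q, 'o, 'k) biframe \<Rightarrow> ('p \<Rightarrow> 'q) \<times> ('n \<Rightarrow> 'o) \<Rightarrow> bool" where
  "biframe_map L M f \<longleftrightarrow>
     frame_map (pos L) (pos M) (fst f) \<and>
     frame_map (neg L) (neg M) (snd f) \<and>
     (\<exists>h. frame_map (main L) (main M) h \<and>
        (\<forall>x\<in>carrier (pos L). h (epos L x) = epos M (fst f x)) \<and>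
        (\<forall>y\<in>carrier (neg L). h (eneg L y) = eneg M (snd f y)))"

definition biframe_id :: "('p, 'n, 'm) biframe \<Rightarrow> ('p \<Rightarrow> 'p) \<times> ('n \<Rightarrow> 'n)" where
  "biframe_id L = ((\<lambda>x\<in>carrier (pos L). x), (\<lambda>y\<in>carrier (neg L). y))"

definition biframe_comp ::
  "('p, 'n, 'm) biframe \<Rightarrow> ('q \<Rightarrow> 'r) \<times> ('o \<Rightarrow> 's) \<Rightarrow> ('p \<Rightarrow> 'q) \<times> ('n \<Rightarrow> 'o)
     \<Rightarrow> ('p \<Rightarrow> 'r) \<times> ('n \<Rightarrow> 's)" where
  "biframe_comp L g f =
     (compose (carrier (pos L)) (fst g) (fst f), compose (carrier (neg L)) (snd g) (snd f))"

definition two_biframe :: "(bool, bool, bool) biframe" where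
  "two_biframe = \<lparr>pos = two_frame, neg = two_frame, main = two_frame, epos = id, eneg = id\<rparr>"

subsection \<open>Finitary biframes\<close>

definition fin_part :: "('p, 'n, 'm) biframe \<Rightarrow> 'm set" where
  "fin_part L = {\<Squnion>\<^bsub>main L\<^esub> (meet_pn L ` F) |F.
     finite F \<and> F \<subseteq> carrier (pos L) \<times> carrier (neg L)}"

definition finitary_congruence :: "('p, 'n, 'm) biframe \<Rightarrow> ('m \<times> 'm) set \<Rightarrow> bool" where
  "finitary_congruence L \<theta> \<longleftrightarrow>
     (\<exists>R \<subseteq> fin_part L \<times> fin_part L. \<theta> = generated_congruence (main L) R)"

definition coproduct_biframe :: "'p gorder \<Rightarrow> 'n gorder \<Rightarrow> ('p, 'n, ('p \<times> 'n) set) biframe" where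
  "coproduct_biframe A B =
     \<lparr>pos = A, neg = B, main = frame_coproduct A B,
      epos = coproduct_inl A B, eneg = coproduct_inr A B\<rparr>"

definition canonical_kernel ::
  "('p, 'n, 'm) biframe \<Rightarrow> (('p \<times> 'n) set \<times> ('p \<times> 'n) set) set" where
  "canonical_kernel L =
     (let K = frame_coproduct (pos L) (neg L);
          q = copairing (pos L) (neg L) (main L) (epos L) (eneg L)
      in {(D, D'). D \<in> carrier K \<and> D' \<in> carrier K \<and> q D = q D'})"

definition finitary_biframe :: "('p, 'n, 'm) biframe \<Rightarrow> bool" where
  "finitary_biframe L \<longleftrightarrow>
     biframe L \<and> finitary_congruence (coproduct_biframe (pos L) (neg L)) (canonical_kernel L)"

subsection \<open>The assembly\<close>

definition nabla_pos :: "('p, 'n, 'm) biframe \<Rightarrow> 'p \<Rightarrow> ('m \<times> 'm) set" where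
  "nabla_pos L x = nabla (main L) (epos L x)"

definition nabla_neg :: "('p, 'n, 'm) biframe \<Rightarrow> 'n \<Rightarrow> ('m \<times> 'm) set" where
  "nabla_neg L y = nabla (main L) (eneg L y)"

definition delta_pos :: "('p, 'n, 'm) biframe \<Rightarrow> 'p \<Rightarrow> ('m \<times> 'm) set" where
  "delta_pos L x = delta (main L) (epos L x)"

definition delta_neg :: "('p, 'n, 'm) biframe \<Rightarrow> 'n \<Rightarrow> ('m \<times> 'm) set" where
  "delta_neg L y = delta (main L) (eneg L y)"

definition assembly_pos :: "('p, 'n, 'm) biframe \<Rightarrow> ('m \<times> 'm) set gorder" where
  "assembly_pos L = generated_subframe (congruence_frame (main L))
     (nabla_pos L ` carrier (pos L) \<union> delta_neg L ` carrier (neg L))"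

definition assembly_neg :: "('p, 'n, 'm) biframe \<Rightarrow> ('m \<times> 'm) set gorder" where
  "assembly_neg L = generated_subframe (congruence_frame (main L))
     (nabla_neg L ` carrier (neg L) \<union> delta_pos L ` carrier (pos L))"

definition assembly_main :: "('p, 'n, 'm) biframe \<Rightarrow> ('m \<times> 'm) set gorder" where
  "assembly_main L = generated_subframe (congruence_frame (main L))
     (nabla (main L) ` carrier (main L) \<union> delta (main L) ` fin_part L)"

definition assembly ::
  "('p, 'n, 'm) biframe \<Rightarrow> (('m \<times> 'm) set, ('m \<times> 'm) set, ('m \<times> 'm) set) biframe" where
  "assembly L =
     \<lparr>pos = assembly_pos L, neg = assembly_neg L, main = assembly_main L,
      epos = (\<lambda>\<theta>\<in>carrier (assembly_pos L). \<theta>),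
      eneg = (\<lambda>\<theta>\<in>carrier (assembly_neg L). \<theta>)\<rparr>"

definition assembly_map ::
  "('p, 'n, 'm) biframe \<Rightarrow> ('q, 'o, 'k) biframe \<Rightarrow> ('p \<Rightarrow> 'q) \<times> ('n \<Rightarrow> 'o) \<Rightarrow>
     (('m \<times> 'm) set \<Rightarrow> ('k \<times> 'k) set) \<times> (('m \<times> 'm) set \<Rightarrow> ('k \<times> 'k) set)" where
  "assembly_map L M f = (THE g. biframe_map (assembly L) (assembly M) g \<and>
     (\<forall>x\<in>carrier (pos L). fst g (nabla_pos L x) = nabla_pos M (fst f x)) \<and>
     (\<forall>y\<in>carrier (neg L). snd g (nabla_neg L y) = nabla_neg M (snd f y)) \<and>
     (\<forall>x\<in>carrier (pos L). snd g (delta_pos L x) = delta_pos M (fst f x)) \<and>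
     (\<forall>y\<in>carrier (neg L). fst g (delta_neg L y) = delta_neg M (snd f y)))"


section \<open>Bispaces\<close>

record 'x bispace =
  pos_top :: "'x topology"
  neg_top :: "'x topology"

definition points :: "'x bispace \<Rightarrow> 'x set" where
  "points X = topspace (pos_top X)"

definition bispace :: "'x bispace \<Rightarrow> bool" where
  "bispace X \<longleftrightarrow> topspace (pos_top X) = topspace (neg_top X)"

definition bicontinuous_map :: "'x bispace \<Rightarrow> 'y bispace \<Rightarrow> ('x \<Rightarrow> 'y) \<Rightarrow> bool" where
  "bicontinuous_map X Y f \<longleftrightarrow>
     continuous_map (pos_top X) (pos_top Y) f \<and> continuous_map (neg_top X) (neg_top Y) f"

definition bihomeomorphism :: "'x bispace \<Rightarrow> 'y bispace \<Rightarrow> ('x \<Rightarrow> 'y) \<Rightarrow> bool" where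
  "bihomeomorphism X Y f \<longleftrightarrow>
     bicontinuous_map X Y f \<and>
     (\<exists>g. bicontinuous_map Y X g \<and>
        (\<forall>x\<in>points X. g (f x) = x) \<and> (\<forall>y\<in>points Y. f (g y) = y))"

definition skula :: "'x bispace \<Rightarrow> 'x bispace" where
  "skula X =
     \<lparr>pos_top = topology_generated_by ({U. openin (pos_top X) U} \<union> {C. closedin (neg_top X) C}),
      neg_top = topology_generated_by ({U. openin (neg_top X) U} \<union> {C. closedin (pos_top X) C})\<rparr>"

definition bpoints :: "('p, 'n, 'm) biframe \<Rightarrow> (('p \<Rightarrow> bool) \<times> ('n \<Rightarrow> bool)) set" where
  "bpoints L = {f. biframe_map L two_biframe f}"

definition bpt :: "('p, 'n, 'm) biframe \<Rightarrow> (('p \<Rightarrow> bool) \<times> ('n \<Rightarrow> bool)) bispace" where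
  "bpt L =
     \<lparr>pos_top = topology (\<lambda>U. \<exists>a\<in>carrier (pos L). U = {f \<in> bpoints L. fst f a = True}),
      neg_top = topology (\<lambda>U. \<exists>a\<in>carrier (neg L). U = {f \<in> bpoints L. snd f a = True})\<rparr>"


text \<open>The two families of opens are topologies, so \<^const>\<open>topology\<close> is applied properly.\<close>

lemma istopology_frame_maps:
  assumes "frame A" and maps: "\<And>f. f \<in> P \<Longrightarrow> frame_map A two_frame (\<pi> f)"
  shows "istopology (\<lambda>U. \<exists>a\<in>carrier A. U = {f \<in> P. \<pi> f a = True})"
proof -
  interpret frame A by fact
  interpret two: complete_lattice two_frame
    unfolding two_frame_def
    by unfold_locales
      (auto simp: least_def greatest_def Upper_def Lower_def elem_def set_eq_def)
  have meet2: "x \<sqinter>\<^bsub>two_frame\<^esub> y = (x \<and> y)" for x y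
  proof -
    have "greatest two_frame (x \<and> y) (Lower two_frame {x, y})"
      by (auto simp: two_frame_def greatest_def Lower_def)
    then show ?thesis
      by (metis two.greatest_unique two.inf_of_two_exists meet_def inf_def someI_ex)
  qed
  have sup2: "\<Squnion>\<^bsub>two_frame\<^esub> S = (True \<in> S)" for S
  proof -
    have "least two_frame (True \<in> S) (Upper two_frame S)"
      by (auto simp: two_frame_def least_def Upper_def)
    then show ?thesis
      by (metis two.least_unique sup_def someI_ex)
  qed
  have meetP: "\<pi> f (a \<sqinter>\<^bsub>A\<^esub> b) = (\<pi> f a \<and> \<pi> f b)"
    if "f \<in> P" "a \<in> carrier A" "b \<in> carrier A" for f a b
    using maps[OF that(1)] that meet2 by (simp add: frame_map_def)
  have supP: "\<pi> f (\<Squnion>\<^bsub>A\<^esub> S) = (\<exists>a\<in>S. \<pi> f a)" if "f \<in> P" "S \<subseteq> carrier A" for f S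
  proof -
    have "\<pi> f (\<Squnion>\<^bsub>A\<^esub> S) = (True \<in> \<pi> f ` S)"
      using maps[OF that(1)] that(2) unfolding frame_map_def sup2 by blast
    then show ?thesis by auto
  qed
  show ?thesis
    unfolding istopology_def
  proof (intro conjI allI impI)
    fix U V
    assume "\<exists>a\<in>carrier A. U = {f \<in> P. \<pi> f a = True}" "\<exists>a\<in>carrier A. V = {f \<in> P. \<pi> f a = True}"
    then obtain a b where "a \<in> carrier A" "b \<in> carrier A"
      "U = {f \<in> P. \<pi> f a}" "V = {f \<in> P. \<pi> f b}" by auto
    then show "\<exists>a\<in>carrier A. U \<inter> V = {f \<in> P. \<pi> f a = True}"
      by (intro bexI[of _ "a \<sqinter>\<^bsub>A\<^esub> b"]) (auto simp: meetP)
  next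
    fix \<K>
    assume *: "\<forall>K\<in>\<K>. \<exists>a\<in>carrier A. K = {f \<in> P. \<pi> f a = True}"
    define S where "S = {a \<in> carrier A. {f \<in> P. \<pi> f a} \<in> \<K>}"
    have S: "S \<subseteq> carrier A" by (auto simp: S_def)
    have "\<Union>\<K> = {f \<in> P. \<pi> f (\<Squnion>\<^bsub>A\<^esub> S) = True}"
    proof (intro equalityI subsetI)
      fix f assume "f \<in> \<Union>\<K>"
      then obtain K where K: "K \<in> \<K>" "f \<in> K" by blast
      then obtain a where a: "a \<in> carrier A" "K = {f \<in> P. \<pi> f a}" using * by auto
      then have "a \<in> S" using K by (simp add: S_def)
      then show "f \<in> {f \<in> P. \<pi> f (\<Squnion>\<^bsub>A\<^esub> S) = True}" using a K supP[OF _ S] by auto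
    next
      fix f assume "f \<in> {f \<in> P. \<pi> f (\<Squnion>\<^bsub>A\<^esub> S) = True}"
      then obtain a where "f \<in> P" "a \<in> S" "\<pi> f a" using supP[OF _ S] by auto
      then show "f \<in> \<Union>\<K>" by (intro UnionI[of "{f \<in> P. \<pi> f a}"]) (auto simp: S_def)
    qed
    then show "\<exists>a\<in>carrier A. \<Union>\<K> = {f \<in> P. \<pi> f a = True}"
      using S sup_closed by blast
  qed
qed

lemma
  assumes "biframe L"
  shows openin_pos_top_bpt:
      "openin (pos_top (bpt L)) U \<longleftrightarrow> (\<exists>a\<in>carrier (pos L). U = {f \<in> bpoints L. fst f a = True})"
    and openin_neg_top_bpt:
      "openin (neg_top (bpt L)) U \<longleftrightarrow> (\<exists>a\<in>carrier (neg L). U = {f \<in> bpoints L. snd f a = True})"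
proof -
  have f: "frame (pos L)" "frame (neg L)"
    using assms by (auto simp: biframe_def)
  have m: "frame_map (pos L) two_frame (fst f)" "frame_map (neg L) two_frame (snd f)"
    if "f \<in> bpoints L" for f
    using that by (auto simp: bpoints_def biframe_map_def two_biframe_def)
  show "openin (pos_top (bpt L)) U \<longleftrightarrow> (\<exists>a\<in>carrier (pos L). U = {f \<in> bpoints L. fst f a = True})"
    using topology_inverse'[OF istopology_frame_maps[OF f(1), of "bpoints L" fst]] m
    by (simp add: bpt_def)
  show "openin (neg_top (bpt L)) U \<longleftrightarrow> (\<exists>a\<in>carrier (neg L). U = {f \<in> bpoints L. snd f a = True})"
    using topology_inverse'[OF istopology_frame_maps[OF f(2), of "bpoints L" snd]] m
    by (simp add: bpt_def)
qed


section \<open>Categories and functors\<close>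

record ('o, 'a) cat =
  Obj :: "'o set"
  Hom :: "'o \<Rightarrow> 'o \<Rightarrow> 'a set"
  Ident :: "'o \<Rightarrow> 'a"
  Comp :: "'o \<Rightarrow> 'o \<Rightarrow> 'o \<Rightarrow> 'a \<Rightarrow> 'a \<Rightarrow> 'a"

text \<open>\<open>Comp C X Y Z g f\<close> is the composite \<open>g \<circ> f\<close> of \<open>f : X \<rightarrow> Y\<close> and \<open>g : Y \<rightarrow> Z\<close>.\<close>

locale category =
  fixes C :: "('o, 'a) cat"
  assumes ident_in_hom: "X \<in> Obj C \<Longrightarrow> Ident C X \<in> Hom C X X"
    and comp_in_hom:
      "\<lbrakk>X \<in> Obj C; Y \<in> Obj C; Z \<in> Obj C; f \<in> Hom C X Y; g \<in> Hom C Y Z\<rbrakk>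
         \<Longrightarrow> Comp C X Y Z g f \<in> Hom C X Z"
    and comp_ident_left:
      "\<lbrakk>X \<in> Obj C; Y \<in> Obj C; f \<in> Hom C X Y\<rbrakk> \<Longrightarrow> Comp C X Y Y (Ident C Y) f = f"
    and comp_ident_right:
      "\<lbrakk>X \<in> Obj C; Y \<in> Obj C; f \<in> Hom C X Y\<rbrakk> \<Longrightarrow> Comp C X X Y f (Ident C X) = f"
    and comp_assoc:
      "\<lbrakk>W \<in> Obj C; X \<in> Obj C; Y \<in> Obj C; Z \<in> Obj C;
        f \<in> Hom C W X; g \<in> Hom C X Y; h \<in> Hom C Y Z\<rbrakk>
         \<Longrightarrow> Comp C W X Z (Comp C X Y Z h g) f = Comp C W Y Z h (Comp C W X Y g f)"

definition op_cat :: "('o, 'a) cat \<Rightarrow> ('o, 'a) cat" where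
  "op_cat C = \<lparr>Obj = Obj C, Hom = (\<lambda>X Y. Hom C Y X), Ident = Ident C,
     Comp = (\<lambda>X Y Z g f. Comp C Z Y X f g)\<rparr>"

record ('o, 'a, 'u, 'b) fctr =
  on_obj :: "'o \<Rightarrow> 'u"
  on_arr :: "'o \<Rightarrow> 'o \<Rightarrow> 'a \<Rightarrow> 'b"

locale is_functor = source: category C + target: category D
  for C :: "('o, 'a) cat" and D :: "('u, 'b) cat" +
  fixes F :: "('o, 'a, 'u, 'b) fctr"
  assumes on_obj_in_Obj: "X \<in> Obj C \<Longrightarrow> on_obj F X \<in> Obj D"
    and on_arr_in_Hom:
      "\<lbrakk>X \<in> Obj C; Y \<in> Obj C; f \<in> Hom C X Y\<rbrakk>
         \<Longrightarrow> on_arr F X Y f \<in> Hom D (on_obj F X) (on_obj F Y)"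
    and on_arr_ident: "X \<in> Obj C \<Longrightarrow> on_arr F X X (Ident C X) = Ident D (on_obj F X)"
    and on_arr_comp:
      "\<lbrakk>X \<in> Obj C; Y \<in> Obj C; Z \<in> Obj C; f \<in> Hom C X Y; g \<in> Hom C Y Z\<rbrakk>
         \<Longrightarrow> on_arr F X Z (Comp C X Y Z g f) =
             Comp D (on_obj F X) (on_obj F Y) (on_obj F Z) (on_arr F Y Z g) (on_arr F X Y f)"

definition op_functor :: "('o, 'a, 'u, 'b) fctr \<Rightarrow> ('o, 'a, 'u, 'b) fctr" where
  "op_functor F = \<lparr>on_obj = on_obj F, on_arr = (\<lambda>X Y. on_arr F Y X)\<rparr>"

definition comp_functor ::
  "('u, 'b, 'v, 'c) fctr \<Rightarrow> ('o, 'a, 'u, 'b) fctr \<Rightarrow> ('o, 'a, 'v, 'c) fctr"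
  (infixr \<open>\<circ>\<^sub>F\<close> 75) where
  "G \<circ>\<^sub>F F = \<lparr>on_obj = (\<lambda>X. on_obj G (on_obj F X)),
     on_arr = (\<lambda>X Y f. on_arr G (on_obj F X) (on_obj F Y) (on_arr F X Y f))\<rparr>"

text \<open>
  The objects of the next two categories are all finitary biframes (bispaces) whose carriers are
  arbitrary subsets of fixed types; the types play the role of the universe of sets, and every
  statement about these categories is polymorphic in them.
\<close>

type_synonym ('p, 'n) biframe_arrow = "('p \<Rightarrow> 'p) \<times> ('n \<Rightarrow> 'n)"

definition BiFrm_fin :: "(('p, 'n, 'm) biframe, ('p, 'n) biframe_arrow) cat" where
  "BiFrm_fin = \<lparr>Obj = {L. finitary_biframe L}, Hom = (\<lambda>L M. {f. biframe_map L M f}),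
     Ident = biframe_id, Comp = (\<lambda>L M N g f. biframe_comp L g f)\<rparr>"

definition BiTop :: "('x bispace, 'x \<Rightarrow> 'x) cat" where
  "BiTop = \<lparr>Obj = {X. bispace X},
     Hom = (\<lambda>X Y. {f. bicontinuous_map X Y f \<and> f \<in> extensional (points X)}),
     Ident = (\<lambda>X. \<lambda>x\<in>points X. x), Comp = (\<lambda>X Y Z g f. compose (points X) g f)\<rparr>"

text \<open>
  Naturally isomorphic functors into bispaces may use different types of points, that is, different
  instances of \<^const>\<open>BiTop\<close>; the components are therefore functions between two types.
\<close>

definition BiTop_natural_iso ::
  "('o, 'a) cat \<Rightarrow> ('o, 'a, 'x bispace, 'x \<Rightarrow> 'x) fctr \<Rightarrow> ('o, 'a, 'y bispace, 'y \<Rightarrow> 'y) fctr \<Rightarrow>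
     ('o \<Rightarrow> 'x \<Rightarrow> 'y) \<Rightarrow> bool" where
  "BiTop_natural_iso C F G \<eta> \<longleftrightarrow>
     is_functor C BiTop F \<and> is_functor C BiTop G \<and>
     (\<forall>X\<in>Obj C. bihomeomorphism (on_obj F X) (on_obj G X) (\<eta> X)) \<and>
     (\<forall>X\<in>Obj C. \<forall>Y\<in>Obj C. \<forall>f\<in>Hom C X Y. \<forall>x\<in>points (on_obj F X).
        \<eta> Y (on_arr F X Y f x) = on_arr G X Y f (\<eta> X x))"

definition assembly_functor ::
  "(('p, 'n, 'm) biframe, ('p, 'n) biframe_arrow,
    (('m \<times> 'm) set, ('m \<times> 'm) set, ('m \<times> 'm) set) biframe,
    (('m \<times> 'm) set, ('m \<times> 'm) set) biframe_arrow) fctr" where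
  "assembly_functor = \<lparr>on_obj = assembly, on_arr = assembly_map\<rparr>"

definition skula_functor :: "('x bispace, 'x \<Rightarrow> 'x, 'x bispace, 'x \<Rightarrow> 'x) fctr" where
  "skula_functor = \<lparr>on_obj = skula, on_arr = (\<lambda>X Y f. f)\<rparr>"

text \<open>
  An arrow from \<open>L\<close> to \<open>M\<close> in the opposite category is a biframe map \<open>h : M \<rightarrow> L\<close>, which sends a
  point \<open>f\<close> of \<open>L\<close> to the point \<open>f \<circ> h\<close> of \<open>M\<close>.
\<close>

definition bpt_functor ::
  "(('p, 'n, 'm) biframe, ('p, 'n) biframe_arrow, (('p \<Rightarrow> bool) \<times> ('n \<Rightarrow> bool)) bispace,
    ('p \<Rightarrow> bool) \<times> ('n \<Rightarrow> bool) \<Rightarrow> ('p \<Rightarrow> bool) \<times> ('n \<Rightarrow> bool)) fctr" where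
  "bpt_functor =
     \<lparr>on_obj = bpt, on_arr = (\<lambda>L M h. \<lambda>f\<in>bpoints L. biframe_comp M f h)\<rparr>"

end

(*
  The congruences theta on L whose image under a frame map g : L -> M generates an open congruence
  nabla(m) form a subframe of A(L), and theta |-> m is a frame map on it.  This subframe contains all
  nabla(x), and it contains delta(s) as soon as g(s) is complemented.  Hence the main component of the
  assembly is universal among the frame maps out of L that make all x+ and x- complemented.

  This universal property gives everything.  Applied to nabla composed with a biframe map, it
  gives A(f).  Applied to the frame 2, in which everything is complemented, it shows that a point of L
  extends uniquely to a point of A(L); the value at delta(x) is then the negation of the value at
  nabla(x), so the generators of A(L) become exactly the opens and the closed sets that generate the
  Skula topologies.  For the finitariness of A(L), let Q be the quotient of the coproduct of the two
  components of A(L) by all inequalities between finite elements that hold in A(L).  As L is finitary,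
  nabla induces a frame map L -> Q; the elements x+ and x- are complemented in Q because this is
  expressed by such inequalities; so the map extends to A(L) -> Q, which inverts Q -> A(L).
*)

theory Submission
  imports Defs
begin

section \<open>Frames\<close>

text \<open>Sending a congruence \<theta> on L to the congruence on M generated by its image under g
  is what A(g) ought to be, and the subframe of the overview is the inverse image under this map of
  the copy \<nabla>(M) of M inside A(M). The relation \<open>represents\<close> spares the
  construction of that map. Generation is left adjoint to inverse image along g, so it respects
  joins for formal reasons; binary meets are the one step with content. They are handled by the
  self-map x |-> (x \<squnion> a) \<sqinter> b, which also makes A(L) distributive. \<Delta> turns
  finite joins into finite meets, but an infinite join only into an infinite intersection, which a
  subframe may miss; this is why the main component is generated with \<Delta>(s) for finite s. The
  complement of \<nabla>(x+), an element of the positive component, lies in the negative component,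
  and vice versa. This crossing makes both laws of complementation inequalities between finite
  elements of the coproduct of the components, and it is what pairs positive opens with negative
  closed sets in the Skula topologies.\<close>

context frame
begin

lemma sup_eqI:
  assumes "S \<subseteq> carrier L" "s \<in> carrier L" "\<And>x. x \<in> S \<Longrightarrow> x \<sqsubseteq> s"
    and "\<And>z. z \<in> carrier L \<Longrightarrow> (\<And>x. x \<in> S \<Longrightarrow> x \<sqsubseteq> z) \<Longrightarrow> s \<sqsubseteq> z"
  shows "\<Squnion>S = s"
proof (rule le_antisym)
  show "\<Squnion>S \<sqsubseteq> s" using assms(1-3) by (rule sup_least)
  show "s \<sqsubseteq> \<Squnion>S" using assms(1) by (intro assms(4) sup_closed sup_upper)
qed (use assms(1,2) in auto)

lemma meet_eqI:
  assumes "a \<in> carrier L" "b \<in> carrier L" "m \<in> carrier L" "m \<sqsubseteq> a" "m \<sqsubseteq> b"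
    and "\<And>z. z \<in> carrier L \<Longrightarrow> z \<sqsubseteq> a \<Longrightarrow> z \<sqsubseteq> b \<Longrightarrow> z \<sqsubseteq> m"
  shows "a \<sqinter> b = m"
proof (rule le_antisym)
  show "a \<sqinter> b \<sqsubseteq> m" using assms(1,2) by (intro assms(6) meet_closed meet_left meet_right)
  show "m \<sqsubseteq> a \<sqinter> b" using assms by (intro meet_le)
qed (use assms(1-3) in auto)

lemma top_eqI: "\<lbrakk>t \<in> carrier L; \<And>x. x \<in> carrier L \<Longrightarrow> x \<sqsubseteq> t\<rbrakk> \<Longrightarrow> \<top> = t"
  by (metis le_antisym top_closed top_higher)

lemma bottom_eqI: "\<lbrakk>t \<in> carrier L; \<And>x. x \<in> carrier L \<Longrightarrow> t \<sqsubseteq> x\<rbrakk> \<Longrightarrow> \<bottom> = t"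
  by (metis le_antisym bottom_closed bottom_lower)

lemma meet_absorb:
  "\<lbrakk>a \<in> carrier L; b \<in> carrier L\<rbrakk> \<Longrightarrow> a \<sqinter> b = a \<longleftrightarrow> a \<sqsubseteq> b"
  by (simp add: le_iff_join eq_commute)

lemma meet_mono:
  "\<lbrakk>a \<sqsubseteq> a'; b \<sqsubseteq> b'; a \<in> carrier L; a' \<in> carrier L; b \<in> carrier L; b' \<in> carrier L\<rbrakk>
    \<Longrightarrow> a \<sqinter> b \<sqsubseteq> a' \<sqinter> b'"
  by (meson le_trans meet_closed meet_le meet_left meet_right)

lemma le_meet_iff:
  assumes "a \<in> carrier L" "b \<in> carrier L" "c \<in> carrier L"
  shows "c \<sqsubseteq> a \<sqinter> b \<longleftrightarrow> c \<sqsubseteq> a \<and> c \<sqsubseteq> b"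
  using assms le_trans[of c "a \<sqinter> b"] by (auto intro: meet_le meet_left meet_right)

lemma meet_idem: "a \<in> carrier L \<Longrightarrow> a \<sqinter> a = a"
  by (simp add: meet_absorb)

lemma meet_left_comm:
  "\<lbrakk>a \<in> carrier L; b \<in> carrier L; c \<in> carrier L\<rbrakk> \<Longrightarrow> a \<sqinter> (b \<sqinter> c) = b \<sqinter> (a \<sqinter> c)"
  by (metis meet_assoc meet_comm)

lemma meet_top_left: "a \<in> carrier L \<Longrightarrow> \<top> \<sqinter> a = a"
  by (metis meet_absorb meet_comm top_closed top_higher)

lemma meet_top_right: "a \<in> carrier L \<Longrightarrow> a \<sqinter> \<top> = a"
  by (metis meet_comm meet_top_left)

lemma meet_bottom_left: "a \<in> carrier L \<Longrightarrow> \<bottom> \<sqinter> a = \<bottom>"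
  by (metis meet_absorb bottom_closed bottom_lower)

lemma join_bottom_left: "a \<in> carrier L \<Longrightarrow> \<bottom> \<squnion> a = a"
  by (metis bottom_closed bottom_lower le_iff_meet)

lemma join_bottom_right: "a \<in> carrier L \<Longrightarrow> a \<squnion> \<bottom> = a"
  by (metis join_comm join_bottom_left)

lemma sup_empty_eq: "\<Squnion>{} = \<bottom>"
  by (rule sup_eqI) auto

lemma meet_join_distrib:
  assumes "a \<in> carrier L" "b \<in> carrier L" "c \<in> carrier L"
  shows "a \<sqinter> (b \<squnion> c) = (a \<sqinter> b) \<squnion> (a \<sqinter> c)"
  using meet_sup_distrib[of a "{b, c}"] assms by (simp add: join_def)

lemma join_meet_distrib:
  assumes "a \<in> carrier L" "b \<in> carrier L" "c \<in> carrier L"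
  shows "(a \<sqinter> b) \<squnion> c = (a \<squnion> c) \<sqinter> (b \<squnion> c)"
proof -
  have "(a \<squnion> c) \<sqinter> (b \<squnion> c) = ((a \<squnion> c) \<sqinter> b) \<squnion> ((a \<squnion> c) \<sqinter> c)"
    using assms by (simp add: meet_join_distrib)
  also have "(a \<squnion> c) \<sqinter> c = c"
    using assms by (metis join_closed join_right meet_absorb meet_comm)
  also have "(a \<squnion> c) \<sqinter> b = (a \<sqinter> b) \<squnion> (b \<sqinter> c)"
    using assms by (metis join_closed meet_comm meet_join_distrib)
  also have "(a \<sqinter> b) \<squnion> (b \<sqinter> c) \<squnion> c = (a \<sqinter> b) \<squnion> c"
    using assms by (metis join_assoc le_iff_meet meet_closed meet_right)
  finally show ?thesis by simp
qed

text \<open>Joining with \<open>a\<close> sends the empty join to \<open>a\<close> instead of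
  \<bottom>, so \<open>S\<close> has to be nonempty. The preimage lemma for congruences asks for
  nonempty joins to match this.\<close>

lemma sup_join_distrib:
  assumes "S \<subseteq> carrier L" "S \<noteq> {}" "a \<in> carrier L"
  shows "\<Squnion>S \<squnion> a = \<Squnion>((\<lambda>x. x \<squnion> a) ` S)"
proof (rule sup_eqI[symmetric])
  fix z assume z: "z \<in> carrier L" "\<And>x. x \<in> (\<lambda>x. x \<squnion> a) ` S \<Longrightarrow> x \<sqsubseteq> z"
  then have *: "x \<squnion> a \<sqsubseteq> z" if "x \<in> S" for x using that by blast
  have "x \<sqsubseteq> z" if "x \<in> S" for x
    using *[OF that] that assms z(1) by (meson join_closed join_left le_trans subsetD)
  moreover obtain x where "x \<in> S" using assms(2) by blast
  then have "a \<sqsubseteq> z"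
    using * assms z(1) by (meson join_closed join_right le_trans subsetD)
  ultimately show "\<Squnion>S \<squnion> a \<sqsubseteq> z"
    using assms z(1) by (simp add: join_le sup_least)
next
  fix x assume "x \<in> (\<lambda>x. x \<squnion> a) ` S"
  then obtain y where "y \<in> S" "x = y \<squnion> a" by blast
  moreover have "y \<sqsubseteq> \<Squnion>S \<squnion> a"
    using assms \<open>y \<in> S\<close> by (meson join_closed join_left le_trans subsetD sup_closed sup_upper)
  ultimately show "x \<sqsubseteq> \<Squnion>S \<squnion> a"
    using assms by (auto intro!: join_le join_right)
qed (use assms in auto)

lemma sup_meet_distrib:
  assumes "S \<subseteq> carrier L" "a \<in> carrier L"
  shows "\<Squnion>S \<sqinter> a = \<Squnion>((\<lambda>x. x \<sqinter> a) ` S)"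
  using meet_sup_distrib[OF assms(2,1)] by (simp add: meet_comm)

lemma meet_sup_sup:
  assumes "S \<subseteq> carrier L" "T \<subseteq> carrier L"
  shows "\<Squnion>S \<sqinter> \<Squnion>T = \<Squnion>((\<lambda>(x, y). x \<sqinter> y) ` (S \<times> T))"
proof (rule sup_eqI[symmetric])
  fix z assume z: "z \<in> carrier L" "\<And>x. x \<in> (\<lambda>(x, y). x \<sqinter> y) ` (S \<times> T) \<Longrightarrow> x \<sqsubseteq> z"
  show "\<Squnion>S \<sqinter> \<Squnion>T \<sqsubseteq> z"
    unfolding sup_meet_distrib[OF assms(1) sup_closed[OF assms(2)]]
  proof (rule sup_least)
    fix w assume "w \<in> (\<lambda>x. x \<sqinter> \<Squnion>T) ` S"
    then obtain x where x: "x \<in> S" "w = x \<sqinter> \<Squnion>T" by blast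
    have "x \<in> carrier L" using x assms by blast
    then show "w \<sqsubseteq> z"
      unfolding x(2) meet_sup_distrib[OF \<open>x \<in> carrier L\<close> assms(2)]
      using assms z(1) x by (intro sup_least) (auto intro!: z(2))
  qed (use assms z(1) in auto)
next
  fix w assume "w \<in> (\<lambda>(x, y). x \<sqinter> y) ` (S \<times> T)"
  then obtain x y where "x \<in> S" "y \<in> T" "w = x \<sqinter> y" by auto
  then show "w \<sqsubseteq> \<Squnion>S \<sqinter> \<Squnion>T"
    using assms by (auto intro!: meet_mono sup_upper)
next
  show "(\<lambda>(x, y). x \<sqinter> y) ` (S \<times> T) \<subseteq> carrier L"
    using assms by (auto intro!: meet_closed)
qed (use assms in auto)

end

lemma subframeD:
  assumes "subframe S L"
  shows subframe_subset: "S \<subseteq> carrier L"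
    and subframe_top: "\<top>\<^bsub>L\<^esub> \<in> S"
    and subframe_meet: "\<And>a b. \<lbrakk>a \<in> S; b \<in> S\<rbrakk> \<Longrightarrow> a \<sqinter>\<^bsub>L\<^esub> b \<in> S"
    and subframe_sup: "\<And>T. T \<subseteq> S \<Longrightarrow> \<Squnion>\<^bsub>L\<^esub> T \<in> S"
  using assms unfolding subframe_def by auto

lemma subframe_join:
  assumes "subframe S L" "a \<in> S" "b \<in> S"
  shows "a \<squnion>\<^bsub>L\<^esub> b \<in> S"
  using subframe_sup[OF assms(1), of "{a, b}"] assms by (simp add: join_def)

text \<open>The operations \<open>s\<close> and \<open>m\<close> are explicit because \<Squnion> and
  \<sqinter> are defined by choice; the conclusion identifies them with the formulas once and for
  all. Infima arise as joins of lower bounds. Of the distributive law only one inequality is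
  assumed, since the other holds in every lattice.\<close>

lemma frameI:
  fixes L :: "'a gorder"
  assumes A: "carrier L = A" and eq: "eq L = (=)"
    and le_refl: "\<And>a. a \<in> A \<Longrightarrow> a \<sqsubseteq>\<^bsub>L\<^esub> a"
    and antisym: "\<And>a b. \<lbrakk>a \<in> A; b \<in> A; a \<sqsubseteq>\<^bsub>L\<^esub> b; b \<sqsubseteq>\<^bsub>L\<^esub> a\<rbrakk> \<Longrightarrow> a = b"
    and trans: "\<And>a b c. \<lbrakk>a \<in> A; b \<in> A; c \<in> A; a \<sqsubseteq>\<^bsub>L\<^esub> b; b \<sqsubseteq>\<^bsub>L\<^esub> c\<rbrakk> \<Longrightarrow> a \<sqsubseteq>\<^bsub>L\<^esub> c"
    and sup: "\<And>S. S \<subseteq> A \<Longrightarrow> s S \<in> A"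
      "\<And>S x. \<lbrakk>S \<subseteq> A; x \<in> S\<rbrakk> \<Longrightarrow> x \<sqsubseteq>\<^bsub>L\<^esub> s S"
      "\<And>S z. \<lbrakk>S \<subseteq> A; z \<in> A; \<And>x. x \<in> S \<Longrightarrow> x \<sqsubseteq>\<^bsub>L\<^esub> z\<rbrakk> \<Longrightarrow> s S \<sqsubseteq>\<^bsub>L\<^esub> z"
    and meet: "\<And>a b. \<lbrakk>a \<in> A; b \<in> A\<rbrakk> \<Longrightarrow> m a b \<in> A"
      "\<And>a b. \<lbrakk>a \<in> A; b \<in> A\<rbrakk> \<Longrightarrow> m a b \<sqsubseteq>\<^bsub>L\<^esub> a"
      "\<And>a b. \<lbrakk>a \<in> A; b \<in> A\<rbrakk> \<Longrightarrow> m a b \<sqsubseteq>\<^bsub>L\<^esub> b"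
      "\<And>a b z. \<lbrakk>a \<in> A; b \<in> A; z \<in> A; z \<sqsubseteq>\<^bsub>L\<^esub> a; z \<sqsubseteq>\<^bsub>L\<^esub> b\<rbrakk> \<Longrightarrow> z \<sqsubseteq>\<^bsub>L\<^esub> m a b"
    and distrib: "\<And>a S. \<lbrakk>a \<in> A; S \<subseteq> A\<rbrakk> \<Longrightarrow> m a (s S) \<sqsubseteq>\<^bsub>L\<^esub> s (m a ` S)"
  shows "frame L \<and> (\<forall>S\<subseteq>A. \<Squnion>\<^bsub>L\<^esub> S = s S) \<and>
    (\<forall>a\<in>A. \<forall>b\<in>A. a \<sqinter>\<^bsub>L\<^esub> b = m a b)"
proof (unfold A[symmetric], intro conjI allI impI ballI)
  note le_refl = le_refl[folded A] and antisym = antisym[folded A] and trans = trans[folded A]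
    and sup = sup[folded A] and meet = meet[folded A] and distrib = distrib[folded A]
  interpret L: partial_order L
  proof (unfold_locales, unfold eq)
    fix x y z assume "x \<in> carrier L" "y \<in> carrier L" "z \<in> carrier L" "x \<sqsubseteq>\<^bsub>L\<^esub> y" "y \<sqsubseteq>\<^bsub>L\<^esub> z"
    then show "x \<sqsubseteq>\<^bsub>L\<^esub> z" by (rule trans)
  next
    fix x y assume "x \<in> carrier L" "y \<in> carrier L" "x \<sqsubseteq>\<^bsub>L\<^esub> y" "y \<sqsubseteq>\<^bsub>L\<^esub> x"
    then show "x = y" by (rule antisym)
  qed (simp_all add: le_refl)
  have lub: "least L (s S) (Upper L S)" if "S \<subseteq> carrier L" for S
  proof -
    have "s S \<sqsubseteq>\<^bsub>L\<^esub> z" if "z \<in> Upper L S" for z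
      using that \<open>S \<subseteq> carrier L\<close> by (intro sup(3)) (auto simp: Upper_def)
    moreover have "s S \<in> Upper L S"
      using sup(1,2)[OF that] that by (simp add: Upper_def)
    ultimately show ?thesis by (simp add: least_def)
  qed
  have glb: "greatest L (s (Lower L S)) (Lower L S)" if "S \<subseteq> carrier L" for S
  proof -
    have "x \<in> S \<Longrightarrow> s (Lower L S) \<sqsubseteq>\<^bsub>L\<^esub> x" for x
      using that by (intro sup(3)) (auto simp: Lower_def)
    then have "s (Lower L S) \<in> Lower L S"
      using sup(1)[of "Lower L S"] that by (simp add: Lower_def)
    moreover have "z \<sqsubseteq>\<^bsub>L\<^esub> s (Lower L S)" if "z \<in> Lower L S" for z
      using that by (intro sup(2)) auto
    ultimately show ?thesis by (simp add: greatest_def)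
  qed
  interpret L: complete_lattice L
    by unfold_locales (use lub glb in blast)+
  show sup_eq: "\<Squnion>\<^bsub>L\<^esub> S = s S" if "S \<subseteq> carrier L" for S
    by (meson L.least_unique L.sup_lub lub that)
  show meet_eq: "a \<sqinter>\<^bsub>L\<^esub> b = m a b" if "a \<in> carrier L" "b \<in> carrier L" for a b
    by (meson L.le_antisym L.meet_closed L.meet_le L.meet_left L.meet_right meet that)
  show "frame L"
  proof unfold_locales
    fix a B assume *: "a \<in> carrier L" "B \<subseteq> carrier L"
    have mB: "m a ` B \<subseteq> carrier L" using * by (auto intro!: meet(1))
    have "s (m a ` B) \<sqsubseteq>\<^bsub>L\<^esub> m a (s B)"
    proof (rule sup(3)[OF mB meet(1)[OF *(1) sup(1)[OF *(2)]]])
      fix x assume "x \<in> m a ` B"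
      then obtain b where b: "b \<in> B" "x = m a b" by blast
      then have bc: "b \<in> carrier L" using * by blast
      have "m a b \<sqsubseteq>\<^bsub>L\<^esub> s B"
        by (rule trans[OF meet(1) bc sup(1) meet(3) sup(2)]) (use * b bc in simp_all)
      then show "x \<sqsubseteq>\<^bsub>L\<^esub> m a (s B)"
        unfolding b(2)
        by (rule meet(4)[OF *(1) sup(1)[OF *(2)] meet(1)[OF *(1) bc] meet(2)[OF *(1) bc]])
    qed
    then have "m a (s B) = s (m a ` B)"
      by (rule antisym[OF meet(1)[OF *(1) sup(1)[OF *(2)]] sup(1)[OF mB] distrib[OF *]])
    moreover have "(\<lambda>b. a \<sqinter>\<^bsub>L\<^esub> b) ` B = m a ` B"
      using * by (intro image_cong refl meet_eq) auto
    ultimately show "a \<sqinter>\<^bsub>L\<^esub> \<Squnion>\<^bsub>L\<^esub> B = \<Squnion>\<^bsub>L\<^esub> ((\<lambda>b. a \<sqinter>\<^bsub>L\<^esub> b) ` B)"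
      by (simp only: sup_eq[OF *(2)] sup_eq[OF mB] meet_eq[OF *(1) sup(1)[OF *(2)]])
  qed
qed

section \<open>The two-element frame\<close>

lemma two_frame:
  shows frame_two: "frame two_frame"
    and two_sup: "\<Squnion>\<^bsub>two_frame\<^esub> S = (True \<in> S)"
    and two_meet: "a \<sqinter>\<^bsub>two_frame\<^esub> b = (a \<and> b)"
    and carrier_two: "carrier two_frame = UNIV"
    and le_two: "a \<sqsubseteq>\<^bsub>two_frame\<^esub> b \<longleftrightarrow> (a \<longrightarrow> b)"
proof -
  have I: "frame two_frame \<and> (\<forall>S\<subseteq>carrier two_frame. \<Squnion>\<^bsub>two_frame\<^esub> S = (True \<in> S)) \<and>
    (\<forall>a\<in>carrier two_frame. \<forall>b\<in>carrier two_frame. a \<sqinter>\<^bsub>two_frame\<^esub> b = (a \<and> b))"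
    by (rule frameI[OF refl]) (auto simp: two_frame_def)
  show "carrier two_frame = UNIV" "a \<sqsubseteq>\<^bsub>two_frame\<^esub> b \<longleftrightarrow> (a \<longrightarrow> b)"
    by (auto simp: two_frame_def)
  show "frame two_frame"
    using I by (simp add: two_frame_def)
  show "\<Squnion>\<^bsub>two_frame\<^esub> S = (True \<in> S)"
    using I by (simp add: two_frame_def)
  show "a \<sqinter>\<^bsub>two_frame\<^esub> b = (a \<and> b)"
    using I by (simp add: two_frame_def)
qed

lemma two_top: "\<top>\<^bsub>two_frame\<^esub> = True"
  and two_bottom: "\<bottom>\<^bsub>two_frame\<^esub> = False"
  and two_join: "a \<squnion>\<^bsub>two_frame\<^esub> b = (a \<or> b)"
proof -
  interpret two: frame two_frame by (rule frame_two)
  show "\<top>\<^bsub>two_frame\<^esub> = True"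
    using two.top_eqI[of True] by (simp add: carrier_two le_two)
  show "\<bottom>\<^bsub>two_frame\<^esub> = False"
    using two.bottom_eqI[of False] by (simp add: carrier_two le_two)
  show "a \<squnion>\<^bsub>two_frame\<^esub> b = (a \<or> b)"
    by (auto simp: join_def two_sup)
qed

subsection \<open>Frame maps\<close>

lemma frame_mapD:
  assumes "frame_map L M f"
  shows frame_map_closed: "\<And>a. a \<in> carrier L \<Longrightarrow> f a \<in> carrier M"
    and frame_map_top: "f \<top>\<^bsub>L\<^esub> = \<top>\<^bsub>M\<^esub>"
    and frame_map_meet: "\<And>a b. \<lbrakk>a \<in> carrier L; b \<in> carrier L\<rbrakk> \<Longrightarrow> f (a \<sqinter>\<^bsub>L\<^esub> b) = f a \<sqinter>\<^bsub>M\<^esub> f b"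
    and frame_map_sup: "\<And>S. S \<subseteq> carrier L \<Longrightarrow> f (\<Squnion>\<^bsub>L\<^esub> S) = \<Squnion>\<^bsub>M\<^esub> (f ` S)"
    and frame_map_extensional: "f \<in> extensional (carrier L)"
  using assms unfolding frame_map_def by (auto simp: PiE_def)

lemma frame_map_join:
  assumes "frame_map L M f" "a \<in> carrier L" "b \<in> carrier L"
  shows "f (a \<squnion>\<^bsub>L\<^esub> b) = f a \<squnion>\<^bsub>M\<^esub> f b"
  using frame_map_sup[OF assms(1), of "{a, b}"] assms by (simp add: join_def)

lemma frame_map_bottom:
  assumes "frame L" "frame M" "frame_map L M f"
  shows "f \<bottom>\<^bsub>L\<^esub> = \<bottom>\<^bsub>M\<^esub>"
  using frame_map_sup[OF assms(3), of "{}"] assms(1,2) by (simp add: frame.sup_empty_eq)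

lemma frame_map_mono:
  assumes "frame L" "frame M" "frame_map L M f" "a \<in> carrier L" "b \<in> carrier L" "a \<sqsubseteq>\<^bsub>L\<^esub> b"
  shows "f a \<sqsubseteq>\<^bsub>M\<^esub> f b"
proof -
  have "a \<sqinter>\<^bsub>L\<^esub> b = a"
    using assms by (simp add: frame.meet_absorb)
  then have "f a \<sqinter>\<^bsub>M\<^esub> f b = f a"
    using frame_map_meet[OF assms(3-5)] by simp
  then show ?thesis
    using assms(4,5) by (simp add: frame.meet_absorb[OF assms(2)] frame_map_closed[OF assms(3)])
qed

lemma frame_mapI:
  assumes "carrier L = A" "carrier M = B"
    and "f \<in> extensional A" "\<And>a. a \<in> A \<Longrightarrow> f a \<in> B"
    and "f \<top>\<^bsub>L\<^esub> = \<top>\<^bsub>M\<^esub>"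
    and "\<And>a b. \<lbrakk>a \<in> A; b \<in> A\<rbrakk> \<Longrightarrow> f (a \<sqinter>\<^bsub>L\<^esub> b) = f a \<sqinter>\<^bsub>M\<^esub> f b"
    and "\<And>S. S \<subseteq> A \<Longrightarrow> f (\<Squnion>\<^bsub>L\<^esub> S) = \<Squnion>\<^bsub>M\<^esub> (f ` S)"
  shows "frame_map L M f"
  using assms by (simp add: frame_map_def PiE_def)

lemma frame_map_comp:
  assumes "frame L" "frame_map L M f" "frame_map M N g"
  shows "frame_map L N (compose (carrier L) g f)"
proof -
  interpret L: frame L by fact
  note f = frame_mapD[OF assms(2)] and g = frame_mapD[OF assms(3)]
  show ?thesis
  proof (rule frame_mapI[OF refl refl])
    fix S assume S: "S \<subseteq> carrier L"
    then have "f ` S \<subseteq> carrier M" using f(1) by blast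
    then have "g (f (\<Squnion>\<^bsub>L\<^esub> S)) = \<Squnion>\<^bsub>N\<^esub> ((\<lambda>x. g (f x)) ` S)"
      using f(4)[OF S] g(4) by (simp add: image_image)
    moreover have "compose (carrier L) g f ` S = (\<lambda>x. g (f x)) ` S"
      using S by (intro image_cong) (auto simp: compose_def)
    ultimately show "compose (carrier L) g f (\<Squnion>\<^bsub>L\<^esub> S) = \<Squnion>\<^bsub>N\<^esub> (compose (carrier L) g f ` S)"
      using S by (simp add: compose_def)
  qed (use f g in \<open>auto simp: compose_def\<close>)
qed

lemma frame_map_id:
  assumes "frame L"
  shows "frame_map L L (\<lambda>x\<in>carrier L. x)"
proof -
  interpret L: frame L by fact
  show ?thesis
  proof (rule frame_mapI[OF refl refl])
    fix S assume S: "S \<subseteq> carrier L"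
    have "(\<lambda>x\<in>carrier L. x) ` S = S"
      using S by (simp add: subset_iff)
    then show "(\<lambda>x\<in>carrier L. x) (\<Squnion>\<^bsub>L\<^esub> S) = \<Squnion>\<^bsub>L\<^esub> ((\<lambda>x\<in>carrier L. x) ` S)"
      using S by simp
  qed auto
qed

subsection \<open>Subframes\<close>

text \<open>In the restricted record the operations are chosen anew from the bounds that lie in
  \<open>S\<close>. Closure of \<open>S\<close> under joins and binary meets is what makes them
  agree with the operations of \<open>L\<close>.\<close>

lemma subframe_frame:
  fixes L :: "'a gorder"
  assumes "frame L" "subframe S L"
  shows frame_subframe: "frame (L\<lparr>carrier := S\<rparr>)"
    and sup_subframe: "\<And>T. T \<subseteq> S \<Longrightarrow> \<Squnion>\<^bsub>L\<lparr>carrier := S\<rparr>\<^esub> T = \<Squnion>\<^bsub>L\<^esub> T"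
    and meet_subframe: "\<And>a b. \<lbrakk>a \<in> S; b \<in> S\<rbrakk> \<Longrightarrow> a \<sqinter>\<^bsub>L\<lparr>carrier := S\<rparr>\<^esub> b = a \<sqinter>\<^bsub>L\<^esub> b"
    and top_subframe: "\<top>\<^bsub>L\<lparr>carrier := S\<rparr>\<^esub> = \<top>\<^bsub>L\<^esub>"
proof -
  interpret L: frame L by fact
  note S = subframeD[OF assms(2)]
  have c: "a \<in> carrier L" if "a \<in> S" for a using that S(1) by blast
  have c': "T \<subseteq> carrier L" if "T \<subseteq> S" for T using that S(1) by blast
  have le: "a \<sqinter>\<^bsub>L\<^esub> \<Squnion>\<^bsub>L\<^esub> T \<sqsubseteq>\<^bsub>L\<^esub> \<Squnion>\<^bsub>L\<^esub> ((\<sqinter>\<^bsub>L\<^esub>) a ` T)" if "a \<in> S" "T \<subseteq> S" for a T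
  proof -
    have "(\<sqinter>\<^bsub>L\<^esub>) a ` T \<subseteq> carrier L"
      using that by (blast intro: c L.meet_closed)
    then show ?thesis
      using that by (simp add: L.meet_sup_distrib c c')
  qed
  have I: "frame (L\<lparr>carrier := S\<rparr>) \<and> (\<forall>T\<subseteq>S. \<Squnion>\<^bsub>L\<lparr>carrier := S\<rparr>\<^esub> T = \<Squnion>\<^bsub>L\<^esub> T) \<and>
      (\<forall>a\<in>S. \<forall>b\<in>S. a \<sqinter>\<^bsub>L\<lparr>carrier := S\<rparr>\<^esub> b = a \<sqinter>\<^bsub>L\<^esub> b)"
  proof (rule frameI)
    show "a = b" if "a \<in> S" "b \<in> S" "a \<sqsubseteq>\<^bsub>L\<lparr>carrier := S\<rparr>\<^esub> b" "b \<sqsubseteq>\<^bsub>L\<lparr>carrier := S\<rparr>\<^esub> a" for a b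
      using that by (simp add: L.le_antisym c)
    show "a \<sqsubseteq>\<^bsub>L\<lparr>carrier := S\<rparr>\<^esub> d" if "a \<in> S" "b \<in> S" "d \<in> S"
      "a \<sqsubseteq>\<^bsub>L\<lparr>carrier := S\<rparr>\<^esub> b" "b \<sqsubseteq>\<^bsub>L\<lparr>carrier := S\<rparr>\<^esub> d" for a b d
      using L.le_trans[of a b d] that by (simp add: c)
    show "a \<sqinter>\<^bsub>L\<^esub> \<Squnion>\<^bsub>L\<^esub> T \<sqsubseteq>\<^bsub>L\<lparr>carrier := S\<rparr>\<^esub> \<Squnion>\<^bsub>L\<^esub> ((\<sqinter>\<^bsub>L\<^esub>) a ` T)"
      if "a \<in> S" "T \<subseteq> S" for a T
      using le[OF that] by simp
  qed (simp_all add: L.eq_is_equal c c' S(3,4) L.sup_upper L.sup_least L.meet_left L.meet_right L.meet_le)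
  then show fr: "frame (L\<lparr>carrier := S\<rparr>)" by blast
  show "\<Squnion>\<^bsub>L\<lparr>carrier := S\<rparr>\<^esub> T = \<Squnion>\<^bsub>L\<^esub> T" if "T \<subseteq> S" for T
    using I that by blast
  show "a \<sqinter>\<^bsub>L\<lparr>carrier := S\<rparr>\<^esub> b = a \<sqinter>\<^bsub>L\<^esub> b" if "a \<in> S" "b \<in> S" for a b
    using I that by blast
  show "\<top>\<^bsub>L\<lparr>carrier := S\<rparr>\<^esub> = \<top>\<^bsub>L\<^esub>"
    by (rule frame.top_eqI[OF fr]) (use S(1,2) in auto)
qed

lemma subframe_subframe:
  assumes "frame L" "subframe T L" "subframe S L" "S \<subseteq> T"
  shows "subframe S (L\<lparr>carrier := T\<rparr>)"
  unfolding subframe_def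
proof (intro conjI ballI allI impI)
  fix a b assume "a \<in> S" "b \<in> S"
  then show "a \<sqinter>\<^bsub>L\<lparr>carrier := T\<rparr>\<^esub> b \<in> S"
    using assms by (simp add: meet_subframe subframe_meet subset_iff)
next
  fix U assume "U \<subseteq> S"
  then show "\<Squnion>\<^bsub>L\<lparr>carrier := T\<rparr>\<^esub> U \<in> S"
    using assms by (simp add: sup_subframe subframe_sup subset_trans)
qed (use assms in \<open>auto simp: top_subframe subframe_top\<close>)

lemma subframe_trans:
  assumes "frame L" "subframe T L" "subframe S (L\<lparr>carrier := T\<rparr>)"
  shows "subframe S L"
  unfolding subframe_def
proof (intro conjI ballI allI impI)
  have ST: "S \<subseteq> T" using subframe_subset[OF assms(3)] by simp
  show "S \<subseteq> carrier L" using ST subframe_subset[OF assms(2)] by simp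
  show "\<top>\<^bsub>L\<^esub> \<in> S"
    using subframe_top[OF assms(3)] by (simp add: top_subframe[OF assms(1,2)])
  show "a \<sqinter>\<^bsub>L\<^esub> b \<in> S" if "a \<in> S" "b \<in> S" for a b
  proof -
    have "a \<in> T" "b \<in> T" using that ST by auto
    then show ?thesis
      using subframe_meet[OF assms(3) that] by (simp add: meet_subframe[OF assms(1,2)])
  qed
  show "\<Squnion>\<^bsub>L\<^esub> U \<in> S" if "U \<subseteq> S" for U
    using subframe_sup[OF assms(3) that] sup_subframe[OF assms(1,2) subset_trans[OF that ST]] by simp
qed

lemma frame_map_restrict:
  assumes "frame L" "frame M" "frame_map L M f" "subframe S L" "subframe U M" "f ` S \<subseteq> U"
  shows "frame_map (L\<lparr>carrier := S\<rparr>) (M\<lparr>carrier := U\<rparr>) (restrict f S)"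
proof -
  have c: "a \<in> carrier L" if "a \<in> S" for a
    using that assms(4) by (meson subframe_subset subsetD)
  have fU: "f a \<in> U" if "a \<in> S" for a
    using that assms(6) by blast
  show ?thesis
  proof (rule frame_mapI[of _ S _ U])
    show "restrict f S \<top>\<^bsub>L\<lparr>carrier := S\<rparr>\<^esub> = \<top>\<^bsub>M\<lparr>carrier := U\<rparr>\<^esub>"
      using assms by (simp add: top_subframe subframe_top frame_map_top)
  next
    fix a b assume "a \<in> S" "b \<in> S"
    then show "restrict f S (a \<sqinter>\<^bsub>L\<lparr>carrier := S\<rparr>\<^esub> b)
        = restrict f S a \<sqinter>\<^bsub>M\<lparr>carrier := U\<rparr>\<^esub> restrict f S b"
      using assms c fU by (simp add: meet_subframe subframe_meet frame_map_meet)
  next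
    fix T assume T: "T \<subseteq> S"
    then have "restrict f S ` T = f ` T" by (intro image_cong) auto
    moreover have "f ` T \<subseteq> U" using T fU by auto
    moreover have "T \<subseteq> carrier L" using T c by auto
    ultimately show "restrict f S (\<Squnion>\<^bsub>L\<lparr>carrier := S\<rparr>\<^esub> T) = \<Squnion>\<^bsub>M\<lparr>carrier := U\<rparr>\<^esub> (restrict f S ` T)"
      using T assms by (simp add: sup_subframe subframe_sup frame_map_sup)
  qed (use fU in auto)
qed

lemma subframe_total:
  assumes "frame L"
  shows "subframe (carrier L) L"
proof -
  interpret L: frame L by fact
  show ?thesis by (simp add: subframe_def)
qed

lemma frame_map_inclusion:
  assumes "frame L" "subframe S L" "subframe T L" "S \<subseteq> T"
  shows "frame_map (L\<lparr>carrier := S\<rparr>) (L\<lparr>carrier := T\<rparr>) (\<lambda>a\<in>S. a)"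
proof -
  have "restrict (\<lambda>a\<in>carrier L. a) S = (\<lambda>a\<in>S. a)"
    using subframe_subset[OF assms(2)] by (intro ext) auto
  moreover have "(\<lambda>a\<in>carrier L. a) ` S \<subseteq> T"
    using subframe_subset[OF assms(2)] assms(4) by auto
  ultimately show ?thesis
    using frame_map_restrict[OF assms(1,1) frame_map_id[OF assms(1)] assms(2,3)] by simp
qed

lemma frame_map_corestrict:
  assumes "frame L" "frame M" "frame_map L M f" "subframe U M" "\<And>a. a \<in> carrier L \<Longrightarrow> f a \<in> U"
  shows "frame_map L (M\<lparr>carrier := U\<rparr>) f"
proof -
  have "restrict f (carrier L) = f"
    using frame_map_extensional[OF assms(3)] by (rule extensional_restrict)
  then show ?thesis
    using frame_map_restrict[OF assms(1-3) subframe_total[OF assms(1)] assms(4)] assms(5)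
    by (simp add: image_subset_iff)
qed

lemma subframe_vimage:
  assumes "frame L" "frame_map L M f" "subframe U M"
  shows "subframe {a \<in> carrier L. f a \<in> U} L"
proof -
  interpret L: frame L by fact
  have "f (\<Squnion>\<^bsub>L\<^esub> T) \<in> U" if "T \<subseteq> {a \<in> carrier L. f a \<in> U}" for T
  proof -
    have "T \<subseteq> carrier L" "f ` T \<subseteq> U" using that by auto
    then show ?thesis
      using assms by (simp add: frame_map_sup subframe_sup)
  qed
  moreover have "\<Squnion>\<^bsub>L\<^esub> T \<in> carrier L" if "T \<subseteq> {a \<in> carrier L. f a \<in> U}" for T
    using that by (intro L.sup_closed) auto
  ultimately show ?thesis
    using assms unfolding subframe_def
    by (auto simp: frame_map_top frame_map_meet intro: L.meet_closed)
qed

lemma subframe_equalizer: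
  assumes "frame L" "frame_map L M f" "frame_map L M g"
  shows "subframe {a \<in> carrier L. f a = g a} L"
proof -
  interpret L: frame L by fact
  have "f (\<Squnion>\<^bsub>L\<^esub> T) = g (\<Squnion>\<^bsub>L\<^esub> T)" if "T \<subseteq> {a \<in> carrier L. f a = g a}" for T
  proof -
    have "T \<subseteq> carrier L" using that by auto
    moreover have "f ` T = g ` T" using that by (intro image_cong) auto
    ultimately show ?thesis
      using assms by (simp add: frame_map_sup)
  qed
  moreover have "\<Squnion>\<^bsub>L\<^esub> T \<in> carrier L" if "T \<subseteq> {a \<in> carrier L. f a = g a}" for T
    using that by (intro L.sup_closed) auto
  ultimately show ?thesis
    using assms unfolding subframe_def
    by (auto simp: frame_map_top frame_map_meet intro: L.meet_closed)
qed

lemma subframe_image: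
  assumes "frame L" "frame_map L M f"
  shows "subframe (f ` carrier L) M"
proof -
  interpret L: frame L by fact
  note f = frame_mapD[OF assms(2)]
  have "\<Squnion>\<^bsub>M\<^esub> T \<in> f ` carrier L" if "T \<subseteq> f ` carrier L" for T
  proof -
    \<comment> \<open>The full preimage of \<open>T\<close> maps onto \<open>T\<close>, so the image
      of its join is the join of \<open>T\<close>.\<close>
    define S where "S = {a \<in> carrier L. f a \<in> T}"
    have "f ` S = T" using that by (auto simp: S_def)
    moreover have "S \<subseteq> carrier L" by (auto simp: S_def)
    ultimately have "\<Squnion>\<^bsub>M\<^esub> T = f (\<Squnion>\<^bsub>L\<^esub> S)" using f(4) by simp
    then show ?thesis using \<open>S \<subseteq> carrier L\<close> by simp
  qed
  moreover have "f a \<sqinter>\<^bsub>M\<^esub> f b \<in> f ` carrier L" if "a \<in> carrier L" "b \<in> carrier L" for a b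
    using that f(3)[OF that] by (metis L.meet_closed imageI)
  ultimately show ?thesis
    unfolding subframe_def using f(1) by (auto simp: f(2)[symmetric])
qed

lemma generated_subframe:
  assumes "frame L" "G \<subseteq> carrier L"
  shows subframe_generated: "subframe (carrier (generated_subframe L G)) L"
    and generators_subset: "G \<subseteq> carrier (generated_subframe L G)"
    and generated_subframe_least: "\<And>S. \<lbrakk>subframe S L; G \<subseteq> S\<rbrakk> \<Longrightarrow> carrier (generated_subframe L G) \<subseteq> S"
    and generated_subframe_eq: "generated_subframe L G = L\<lparr>carrier := carrier (generated_subframe L G)\<rparr>"
proof -
  interpret L: frame L by fact
  let ?G = "\<Inter>{S. subframe S L \<and> G \<subseteq> S}"
  have "subframe (carrier L) L" by (simp add: subframe_def)
  then have "?G \<subseteq> carrier L" using assms(2) by auto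
  then have "subframe ?G L"
    unfolding subframe_def[of ?G] by (blast intro: subframe_top subframe_meet subframe_sup)
  then show "subframe (carrier (generated_subframe L G)) L"
    by (simp add: generated_subframe_def)
qed (auto simp: generated_subframe_def)

lemma frame_generated_subframe:
  assumes "frame L" "G \<subseteq> carrier L"
  shows "frame (generated_subframe L G)"
  by (metis assms frame_subframe subframe_generated generated_subframe_eq)

text \<open>The equalizer is a subframe of the generated frame, hence of \<open>L\<close> by
  transitivity, and it contains \<open>G\<close>; minimality of the generated subframe makes it
  everything.\<close>

lemma frame_map_generated_eqI:
  assumes "frame L" "G \<subseteq> carrier L"
    and f: "frame_map (generated_subframe L G) M f" and g: "frame_map (generated_subframe L G) M g"
    and eq: "\<And>a. a \<in> G \<Longrightarrow> f a = g a"
  shows "f = g"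
proof (rule extensionalityI)
  let ?L = "generated_subframe L G" and ?E = "{a \<in> carrier (generated_subframe L G). f a = g a}"
  note gen = generated_subframe[OF assms(1,2)]
  have E: "subframe ?E ?L"
    by (rule subframe_equalizer[OF frame_generated_subframe[OF assms(1,2)] f g])
  have "subframe ?E L"
    using subframe_trans[OF assms(1) gen(1)] E gen(4) by simp
  then have "carrier ?L \<subseteq> ?E"
    using gen(2,3) eq by blast
  then show "f a = g a" if "a \<in> carrier ?L" for a
    using that by blast
qed (use f g in \<open>auto intro: frame_map_extensional\<close>)

section \<open>Congruences\<close>

lemma frame_congruenceD:
  assumes "frame_congruence L \<theta>"
  shows congruence_subset: "\<theta> \<subseteq> carrier L \<times> carrier L"
    and congruence_refl: "\<And>a. a \<in> carrier L \<Longrightarrow> (a, a) \<in> \<theta>"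
    and congruence_sym: "\<And>a b. (a, b) \<in> \<theta> \<Longrightarrow> (b, a) \<in> \<theta>"
    and congruence_trans: "\<And>a b c. \<lbrakk>(a, b) \<in> \<theta>; (b, c) \<in> \<theta>\<rbrakk> \<Longrightarrow> (a, c) \<in> \<theta>"
    and congruence_meet:
      "\<And>a b c d. \<lbrakk>(a, b) \<in> \<theta>; (c, d) \<in> \<theta>\<rbrakk> \<Longrightarrow> (a \<sqinter>\<^bsub>L\<^esub> c, b \<sqinter>\<^bsub>L\<^esub> d) \<in> \<theta>"
    and congruence_sup: "\<And>S. S \<subseteq> \<theta> \<Longrightarrow> (\<Squnion>\<^bsub>L\<^esub> (fst ` S), \<Squnion>\<^bsub>L\<^esub> (snd ` S)) \<in> \<theta>"
proof -
  have e: "equiv (carrier L) \<theta>"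
    using assms by (simp add: frame_congruence_def)
  show "\<theta> \<subseteq> carrier L \<times> carrier L" "\<And>a. a \<in> carrier L \<Longrightarrow> (a, a) \<in> \<theta>"
    "\<And>a b. (a, b) \<in> \<theta> \<Longrightarrow> (b, a) \<in> \<theta>" "\<And>a b c. \<lbrakk>(a, b) \<in> \<theta>; (b, c) \<in> \<theta>\<rbrakk> \<Longrightarrow> (a, c) \<in> \<theta>"
    using e unfolding equiv_def by (auto dest: refl_onD symD transD)
qed (use assms in \<open>auto simp: frame_congruence_def\<close>)

lemma congruence_closed:
  assumes "frame_congruence L \<theta>" "(a, b) \<in> \<theta>"
  shows "a \<in> carrier L" "b \<in> carrier L"
  using congruence_subset[OF assms(1)] assms(2) by auto

lemma congruence_join:
  assumes "frame_congruence L \<theta>" "(a, b) \<in> \<theta>" "(c, d) \<in> \<theta>"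
  shows "(a \<squnion>\<^bsub>L\<^esub> c, b \<squnion>\<^bsub>L\<^esub> d) \<in> \<theta>"
  using congruence_sup[OF assms(1), of "{(a, b), (c, d)}"] assms(2,3) by (simp add: join_def)

lemma frame_congruenceI:
  assumes "\<theta> \<subseteq> carrier L \<times> carrier L" "\<And>a. a \<in> carrier L \<Longrightarrow> (a, a) \<in> \<theta>"
    and "\<And>a b. (a, b) \<in> \<theta> \<Longrightarrow> (b, a) \<in> \<theta>"
    and "\<And>a b c. \<lbrakk>(a, b) \<in> \<theta>; (b, c) \<in> \<theta>\<rbrakk> \<Longrightarrow> (a, c) \<in> \<theta>"
    and "\<And>a b c d. \<lbrakk>(a, b) \<in> \<theta>; (c, d) \<in> \<theta>\<rbrakk> \<Longrightarrow> (a \<sqinter>\<^bsub>L\<^esub> c, b \<sqinter>\<^bsub>L\<^esub> d) \<in> \<theta>"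
    and "\<And>S. S \<subseteq> \<theta> \<Longrightarrow> (\<Squnion>\<^bsub>L\<^esub> (fst ` S), \<Squnion>\<^bsub>L\<^esub> (snd ` S)) \<in> \<theta>"
  shows "frame_congruence L \<theta>"
proof -
  have "equiv (carrier L) \<theta>"
  proof (rule equivI)
    show "sym \<theta>" using assms(3) by (rule symI)
    show "trans \<theta>" using assms(4) by (rule transI)
  qed (use assms(1,2) in \<open>auto intro: refl_onI\<close>)
  then show ?thesis
    using assms(5,6) by (simp add: frame_congruence_def)
qed

text \<open>The conditions on \<open>t\<close> are weaker than those of a frame map, so that meeting
  with a fixed element, which moves \<top>, and joining with a fixed element, which moves \<bottom>,
  are covered. For an empty family both joins are \<bottom>, and reflexivity suffices.\<close>

lemma congruence_vimage:
  assumes "frame L" "frame_congruence M \<psi>"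
    and t: "\<And>a. a \<in> carrier L \<Longrightarrow> t a \<in> carrier M"
    and t_meet: "\<And>a b. \<lbrakk>a \<in> carrier L; b \<in> carrier L\<rbrakk> \<Longrightarrow> t (a \<sqinter>\<^bsub>L\<^esub> b) = t a \<sqinter>\<^bsub>M\<^esub> t b"
    and t_sup: "\<And>S. \<lbrakk>S \<subseteq> carrier L; S \<noteq> {}\<rbrakk> \<Longrightarrow> t (\<Squnion>\<^bsub>L\<^esub> S) = \<Squnion>\<^bsub>M\<^esub> (t ` S)"
  shows "frame_congruence L {(u, v). u \<in> carrier L \<and> v \<in> carrier L \<and> (t u, t v) \<in> \<psi>}" (is "frame_congruence L ?\<theta>")
proof -
  interpret L: frame L by fact
  note psi = frame_congruenceD[OF assms(2)]
  show ?thesis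
  proof (rule frame_congruenceI)
    show "(a \<sqinter>\<^bsub>L\<^esub> c, b \<sqinter>\<^bsub>L\<^esub> d) \<in> ?\<theta>" if "(a, b) \<in> ?\<theta>" "(c, d) \<in> ?\<theta>" for a b c d
      using that by (auto simp: t_meet intro!: psi(5) L.meet_closed)
    show "(\<Squnion>\<^bsub>L\<^esub> (fst ` S), \<Squnion>\<^bsub>L\<^esub> (snd ` S)) \<in> ?\<theta>" if S: "S \<subseteq> ?\<theta>" for S
    proof (cases "S = {}")
      case True
      then show ?thesis by (auto intro!: psi(2) t)
    next
      case False
      have c: "fst ` S \<subseteq> carrier L" "snd ` S \<subseteq> carrier L" using S by auto
      have "(\<Squnion>\<^bsub>M\<^esub> (fst ` map_prod t t ` S), \<Squnion>\<^bsub>M\<^esub> (snd ` map_prod t t ` S)) \<in> \<psi>"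
        using S by (intro psi(6)) auto
      then show ?thesis
        using c False by (simp add: t_sup image_image)
    qed
  qed (auto intro: psi t)
qed

lemma congruence_identity:
  assumes "frame L"
  shows "frame_congruence L (Id_on (carrier L))"
proof -
  interpret L: frame L by fact
  show ?thesis
  proof (rule frame_congruenceI)
    fix S assume S: "S \<subseteq> Id_on (carrier L)"
    have "fst ` S \<subseteq> carrier L" using S by auto
    moreover have "fst ` S = snd ` S" using S by (intro image_cong) auto
    ultimately show "(\<Squnion>\<^bsub>L\<^esub> (fst ` S), \<Squnion>\<^bsub>L\<^esub> (snd ` S)) \<in> Id_on (carrier L)"
      using Id_onI[OF L.sup_closed] by simp
  qed auto
qed

text \<open>The factor \<open>carrier L \<times> carrier L\<close> gives the right value, the total
  congruence, for an empty index set.\<close>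

lemma congruence_INT:
  assumes "frame L" and \<theta>: "\<And>i. i \<in> I \<Longrightarrow> frame_congruence L (\<theta> i)"
  shows "frame_congruence L (carrier L \<times> carrier L \<inter> (\<Inter>i\<in>I. \<theta> i))" (is "frame_congruence L ?\<theta>")
proof -
  interpret L: frame L by fact
  note D = frame_congruenceD[OF \<theta>]
  show ?thesis
  proof (rule frame_congruenceI)
    fix S assume S: "S \<subseteq> ?\<theta>"
    then have "fst ` S \<subseteq> carrier L" "snd ` S \<subseteq> carrier L" by auto
    moreover have "(\<Squnion>\<^bsub>L\<^esub> (fst ` S), \<Squnion>\<^bsub>L\<^esub> (snd ` S)) \<in> \<theta> i" if "i \<in> I" for i
      by (rule D(6)[OF that]) (use S that in auto)
    ultimately show "(\<Squnion>\<^bsub>L\<^esub> (fst ` S), \<Squnion>\<^bsub>L\<^esub> (snd ` S)) \<in> ?\<theta>" by simp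
  next
    fix a b c d assume "(a, b) \<in> ?\<theta>" "(c, d) \<in> ?\<theta>"
    then show "(a \<sqinter>\<^bsub>L\<^esub> c, b \<sqinter>\<^bsub>L\<^esub> d) \<in> ?\<theta>"
      using D(5) by simp
  next
    show "(a, c) \<in> ?\<theta>" if "(a, b) \<in> ?\<theta>" "(b, c) \<in> ?\<theta>" for a b c
      using that D(4)[of _ a b c] by auto
  qed (auto intro: D(2,3))
qed

lemma congruence_Inter:
  assumes "frame L" "\<And>\<theta>. \<theta> \<in> T \<Longrightarrow> frame_congruence L \<theta>" "T \<noteq> {}"
  shows "frame_congruence L (\<Inter>T)"
proof -
  have "carrier L \<times> carrier L \<inter> (\<Inter>\<theta>\<in>T. \<theta>) = \<Inter>T"
    using assms(2,3) congruence_subset by fastforce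
  then show ?thesis
    using congruence_INT[OF assms(1), of T "\<lambda>\<theta>. \<theta>"] assms(2) by simp
qed

lemma congruence_Int:
  "\<lbrakk>frame L; frame_congruence L \<theta>; frame_congruence L \<phi>\<rbrakk> \<Longrightarrow> frame_congruence L (\<theta> \<inter> \<phi>)"
  using congruence_Inter[of L "{\<theta>, \<phi>}"] by auto

lemma congruence_total: "frame L \<Longrightarrow> frame_congruence L (carrier L \<times> carrier L)"
  using congruence_INT[of L "{}"] by simp

lemma congruence_kernel:
  assumes "frame L" "frame M" "frame_map L M f"
  shows "frame_congruence L {(u, v). u \<in> carrier L \<and> v \<in> carrier L \<and> f u = f v}"
proof -
  have "{(u, v). u \<in> carrier L \<and> v \<in> carrier L \<and> (f u, f v) \<in> Id_on (carrier M)}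
      = {(u, v). u \<in> carrier L \<and> v \<in> carrier L \<and> f u = f v}"
    using frame_map_closed[OF assms(3)] by (auto simp: Id_on_def)
  then show ?thesis
    using congruence_vimage[OF assms(1) congruence_identity[OF assms(2)], of f] frame_mapD[OF assms(3)]
    by simp
qed

lemma congruence_vimage_meet:
  assumes "frame L" "frame_congruence L \<psi>" "m \<in> carrier L"
  shows "frame_congruence L {(u, v). u \<in> carrier L \<and> v \<in> carrier L \<and> (u \<sqinter>\<^bsub>L\<^esub> m, v \<sqinter>\<^bsub>L\<^esub> m) \<in> \<psi>}"
proof -
  interpret L: frame L by fact
  show ?thesis
  proof (rule congruence_vimage[OF assms(1,2)])
    fix a b assume "a \<in> carrier L" "b \<in> carrier L"
    then show "a \<sqinter>\<^bsub>L\<^esub> b \<sqinter>\<^bsub>L\<^esub> m = a \<sqinter>\<^bsub>L\<^esub> m \<sqinter>\<^bsub>L\<^esub> (b \<sqinter>\<^bsub>L\<^esub> m)"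
      using assms(3) by (metis L.meet_assoc L.meet_closed L.meet_idem L.meet_left_comm)
  qed (use assms(3) in \<open>simp_all add: L.sup_meet_distrib\<close>)
qed

lemma congruence_vimage_join:
  assumes "frame L" "frame_congruence L \<psi>" "m \<in> carrier L"
  shows "frame_congruence L {(u, v). u \<in> carrier L \<and> v \<in> carrier L \<and> (u \<squnion>\<^bsub>L\<^esub> m, v \<squnion>\<^bsub>L\<^esub> m) \<in> \<psi>}"
proof -
  interpret L: frame L by fact
  show ?thesis
    by (rule congruence_vimage[OF assms(1,2)])
      (use assms(3) in \<open>simp_all add: L.join_meet_distrib L.sup_join_distrib\<close>)
qed

subsection \<open>The frame of congruences\<close>

text \<open>
  Distributivity comes from the Heyting implication: if \<open>(a, b) \<in> \<theta>\<close> and \<open>a \<le> b\<close>, then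
  \<open>x \<mapsto> (x \<squnion> a) \<sqinter> b\<close> has all its values in one \<open>\<theta>\<close>-class, and it fixes \<open>x\<close> and \<open>y\<close> when
  \<open>a = x \<sqinter> y\<close> and \<open>b = x \<squnion> y\<close>.
\<close>

lemma congruence_meet_sup_distrib:
  assumes "frame L" and \<theta>: "frame_congruence L \<theta>" and \<Phi>: "\<And>\<phi>. \<phi> \<in> \<Phi> \<Longrightarrow> frame_congruence L \<phi>"
    and \<sigma>: "frame_congruence L \<sigma>" "\<And>\<phi>. \<phi> \<in> \<Phi> \<Longrightarrow> \<theta> \<inter> \<phi> \<subseteq> \<sigma>"
  shows "\<theta> \<inter> \<Inter>{\<psi>. frame_congruence L \<psi> \<and> \<Union>\<Phi> \<subseteq> \<psi>} \<subseteq> \<sigma>"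
proof -
  interpret L: frame L by fact
  \<comment> \<open>Relates x and y when (x \<squnion> a) \<sqinter> b and (y \<squnion> a)
    \<sqinter> b are \<psi>-related. It is written as two nested preimages so that
    \<open>congruence_vimage_join\<close> and \<open>congruence_vimage_meet\<close> show it to be a
    congruence.\<close>
  define t where "t \<psi> a b = {(x, y). x \<in> carrier L \<and> y \<in> carrier L \<and>
    (x \<squnion>\<^bsub>L\<^esub> a, y \<squnion>\<^bsub>L\<^esub> a) \<in> {(x, y). x \<in> carrier L \<and> y \<in> carrier L \<and> (x \<sqinter>\<^bsub>L\<^esub> b, y \<sqinter>\<^bsub>L\<^esub> b) \<in> \<psi>}}" for \<psi> a b
  have t: "frame_congruence L (t \<psi> a b)"
    if "frame_congruence L \<psi>" "a \<in> carrier L" "b \<in> carrier L" for \<psi> a b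
    unfolding t_def
    by (intro congruence_vimage_join congruence_vimage_meet that assms(1))
  \<comment> \<open>The Heyting implication from \<theta> to \<sigma>: \<open>sub\<close> shows that
    it contains each member of \<Phi>, since these meet \<theta> inside \<sigma>, and the final step
    shows that \<tau> itself meets \<theta> inside \<sigma>.\<close>
  define \<tau> where "\<tau> = carrier L \<times> carrier L \<inter> (\<Inter>(a, b)\<in>{(a, b) \<in> \<theta>. a \<sqsubseteq>\<^bsub>L\<^esub> b}. t \<sigma> a b)"
  have \<tau>: "frame_congruence L \<tau>"
    unfolding \<tau>_def
    using congruence_closed[OF \<theta>]
    by (intro congruence_INT[OF assms(1)]) (auto intro!: t \<sigma>)
  have sub: "\<phi> \<subseteq> \<tau>" if "\<phi> \<in> \<Phi>" for \<phi>
  proof clarify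
    fix x y assume xy: "(x, y) \<in> \<phi>"
    note \<phi> = \<Phi>[OF that] and c = congruence_closed[OF \<Phi>[OF that] xy]
    have "((x \<squnion>\<^bsub>L\<^esub> a) \<sqinter>\<^bsub>L\<^esub> b, (y \<squnion>\<^bsub>L\<^esub> a) \<sqinter>\<^bsub>L\<^esub> b) \<in> \<sigma>" if ab: "(a, b) \<in> \<theta>" "a \<sqsubseteq>\<^bsub>L\<^esub> b" for a b
    proof -
      note d = congruence_closed[OF \<theta> ab(1)]
      have "((x \<squnion>\<^bsub>L\<^esub> a) \<sqinter>\<^bsub>L\<^esub> b, (y \<squnion>\<^bsub>L\<^esub> a) \<sqinter>\<^bsub>L\<^esub> b) \<in> \<phi>"
        by (intro congruence_meet[OF \<phi>] congruence_join[OF \<phi>] xy congruence_refl[OF \<phi>] d)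
      moreover have "((z \<squnion>\<^bsub>L\<^esub> a) \<sqinter>\<^bsub>L\<^esub> b, a) \<in> \<theta>" if "z \<in> carrier L" for z
      proof -
        have "((z \<squnion>\<^bsub>L\<^esub> a) \<sqinter>\<^bsub>L\<^esub> b, (z \<squnion>\<^bsub>L\<^esub> a) \<sqinter>\<^bsub>L\<^esub> a) \<in> \<theta>"
          by (intro congruence_meet[OF \<theta>] congruence_refl[OF \<theta>] L.join_closed that d
              congruence_sym[OF \<theta> ab(1)])
        moreover have "(z \<squnion>\<^bsub>L\<^esub> a) \<sqinter>\<^bsub>L\<^esub> a = a"
          using that d by (intro L.meet_eqI) (auto intro: L.join_right)
        ultimately show ?thesis by simp
      qed
      then have "((x \<squnion>\<^bsub>L\<^esub> a) \<sqinter>\<^bsub>L\<^esub> b, (y \<squnion>\<^bsub>L\<^esub> a) \<sqinter>\<^bsub>L\<^esub> b) \<in> \<theta>"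
        using c by (meson congruence_sym[OF \<theta>] congruence_trans[OF \<theta>])
      ultimately show ?thesis using \<sigma>(2)[OF \<open>\<phi> \<in> \<Phi>\<close>] by blast
    qed
    then show "(x, y) \<in> \<tau>"
      using c congruence_closed[OF \<theta>] by (auto simp: \<tau>_def t_def intro: L.join_closed)
  qed
  show ?thesis
  proof clarify
    fix x y assume xy: "(x, y) \<in> \<theta>" "(x, y) \<in> \<Inter>{\<psi>. frame_congruence L \<psi> \<and> \<Union>\<Phi> \<subseteq> \<psi>}"
    then have "(x, y) \<in> \<tau>" using \<tau> sub by blast
    note c = congruence_closed[OF \<theta> xy(1)]
    have "(x \<sqinter>\<^bsub>L\<^esub> y, y \<sqinter>\<^bsub>L\<^esub> y) \<in> \<theta>" "(x \<squnion>\<^bsub>L\<^esub> y, y \<squnion>\<^bsub>L\<^esub> y) \<in> \<theta>"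
      by (intro congruence_meet[OF \<theta>] congruence_join[OF \<theta>] xy congruence_refl[OF \<theta>] c)+
    then have "(x \<sqinter>\<^bsub>L\<^esub> y, x \<squnion>\<^bsub>L\<^esub> y) \<in> \<theta>"
      using c by (metis L.meet_idem L.le_iff_meet L.le_refl congruence_sym[OF \<theta>] congruence_trans[OF \<theta>])
    moreover have "x \<sqinter>\<^bsub>L\<^esub> y \<sqsubseteq>\<^bsub>L\<^esub> x \<squnion>\<^bsub>L\<^esub> y"
      using c by (meson L.join_closed L.join_left L.le_trans L.meet_closed L.meet_left)
    ultimately have "((x \<squnion>\<^bsub>L\<^esub> (x \<sqinter>\<^bsub>L\<^esub> y)) \<sqinter>\<^bsub>L\<^esub> (x \<squnion>\<^bsub>L\<^esub> y), (y \<squnion>\<^bsub>L\<^esub> (x \<sqinter>\<^bsub>L\<^esub> y)) \<sqinter>\<^bsub>L\<^esub> (x \<squnion>\<^bsub>L\<^esub> y)) \<in> \<sigma>"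
      using \<open>(x, y) \<in> \<tau>\<close> by (auto simp: \<tau>_def t_def)
    moreover have "x \<squnion>\<^bsub>L\<^esub> (x \<sqinter>\<^bsub>L\<^esub> y) = x" "y \<squnion>\<^bsub>L\<^esub> (x \<sqinter>\<^bsub>L\<^esub> y) = y"
      using c by (metis L.le_iff_meet L.meet_closed L.meet_left L.meet_right join_comm)+
    moreover have "x \<sqinter>\<^bsub>L\<^esub> (x \<squnion>\<^bsub>L\<^esub> y) = x" "y \<sqinter>\<^bsub>L\<^esub> (x \<squnion>\<^bsub>L\<^esub> y) = y"
      using c by (simp_all add: L.meet_absorb L.join_left L.join_right)
    ultimately show "(x, y) \<in> \<sigma>" by simp
  qed
qed

lemma congruence_frame_carrier: "carrier (congruence_frame L) = {\<theta>. frame_congruence L \<theta>}"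
  and congruence_frame_le: "\<theta> \<sqsubseteq>\<^bsub>congruence_frame L\<^esub> \<phi> \<longleftrightarrow> \<theta> \<subseteq> \<phi>"
  by (simp_all add: congruence_frame_def)

lemma congruence_frame:
  assumes "frame L"
  shows frame_congruence_frame: "frame (congruence_frame L)"
    and congruence_frame_sup: "\<And>\<Phi>. \<Phi> \<subseteq> carrier (congruence_frame L) \<Longrightarrow>
      \<Squnion>\<^bsub>congruence_frame L\<^esub> \<Phi> = \<Inter>{\<psi>. frame_congruence L \<psi> \<and> \<Union>\<Phi> \<subseteq> \<psi>}"
    and congruence_frame_meet: "\<And>\<theta> \<phi>. \<lbrakk>frame_congruence L \<theta>; frame_congruence L \<phi>\<rbrakk> \<Longrightarrow>
      \<theta> \<sqinter>\<^bsub>congruence_frame L\<^esub> \<phi> = \<theta> \<inter> \<phi>"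
    and congruence_frame_top: "\<top>\<^bsub>congruence_frame L\<^esub> = carrier L \<times> carrier L"
    and congruence_frame_bottom: "\<bottom>\<^bsub>congruence_frame L\<^esub> = Id_on (carrier L)"
proof -
  let ?A = "Collect (frame_congruence L)"
  have sup: "frame_congruence L (\<Inter>{\<psi>. frame_congruence L \<psi> \<and> \<Union>\<Phi> \<subseteq> \<psi>})"
    if "\<Phi> \<subseteq> ?A" for \<Phi>
  proof (rule congruence_Inter[OF assms])
    have "carrier L \<times> carrier L \<in> {\<psi>. frame_congruence L \<psi> \<and> \<Union>\<Phi> \<subseteq> \<psi>}"
      using that by (auto simp: congruence_total[OF assms] dest: congruence_closed)
    then show "{\<psi>. frame_congruence L \<psi> \<and> \<Union>\<Phi> \<subseteq> \<psi>} \<noteq> {}" by blast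
  qed auto
  have distrib: "\<theta> \<inter> \<Inter>{\<psi>. frame_congruence L \<psi> \<and> \<Union>\<Phi> \<subseteq> \<psi>}
      \<subseteq> \<Inter>{\<psi>. frame_congruence L \<psi> \<and> \<Union>((\<inter>) \<theta> ` \<Phi>) \<subseteq> \<psi>}"
    if "frame_congruence L \<theta>" "\<Phi> \<subseteq> ?A" for \<theta> \<Phi>
  proof (rule congruence_meet_sup_distrib[OF assms that(1)])
    show "frame_congruence L (\<Inter>{\<psi>. frame_congruence L \<psi> \<and> \<Union>((\<inter>) \<theta> ` \<Phi>) \<subseteq> \<psi>})"
      by (rule sup) (use that congruence_Int[OF assms] in auto)
  qed (use that in auto)
  have I: "frame (congruence_frame L) \<and>
      (\<forall>\<Phi>\<subseteq>?A. \<Squnion>\<^bsub>congruence_frame L\<^esub> \<Phi> = \<Inter>{\<psi>. frame_congruence L \<psi> \<and> \<Union>\<Phi> \<subseteq> \<psi>}) \<and>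
      (\<forall>\<theta>\<in>?A. \<forall>\<phi>\<in>?A. \<theta> \<sqinter>\<^bsub>congruence_frame L\<^esub> \<phi> = \<theta> \<inter> \<phi>)"
  proof (rule frameI)
    show "\<theta> \<inter> \<Inter>{\<psi>. frame_congruence L \<psi> \<and> \<Union>\<Phi> \<subseteq> \<psi>} \<sqsubseteq>\<^bsub>congruence_frame L\<^esub>
      \<Inter>{\<psi>. frame_congruence L \<psi> \<and> \<Union>((\<inter>) \<theta> ` \<Phi>) \<subseteq> \<psi>}" if "\<theta> \<in> ?A" "\<Phi> \<subseteq> ?A" for \<theta> \<Phi>
      using distrib[of \<theta> \<Phi>] that unfolding congruence_frame_def by simp
    show "\<Inter>{\<psi>. frame_congruence L \<psi> \<and> \<Union>\<Phi> \<subseteq> \<psi>} \<in> ?A" if "\<Phi> \<subseteq> ?A" for \<Phi>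
      using sup[OF that] by simp
    show "\<theta> \<inter> \<phi> \<in> ?A" if "\<theta> \<in> ?A" "\<phi> \<in> ?A" for \<theta> \<phi>
      using that congruence_Int[OF assms] by simp
    show "\<Inter>{\<psi>. frame_congruence L \<psi> \<and> \<Union>\<Phi> \<subseteq> \<psi>} \<sqsubseteq>\<^bsub>congruence_frame L\<^esub> \<psi>"
      if "\<psi> \<in> ?A" "\<And>\<phi>. \<phi> \<in> \<Phi> \<Longrightarrow> \<phi> \<sqsubseteq>\<^bsub>congruence_frame L\<^esub> \<psi>" for \<Phi> \<psi>
      using that by (simp add: congruence_frame_def Inter_lower Sup_least)
  qed (auto simp: congruence_frame_def)
  show fr: "frame (congruence_frame L)" using I by blast
  show "\<Squnion>\<^bsub>congruence_frame L\<^esub> \<Phi> = \<Inter>{\<psi>. frame_congruence L \<psi> \<and> \<Union>\<Phi> \<subseteq> \<psi>}"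
    if "\<Phi> \<subseteq> carrier (congruence_frame L)" for \<Phi>
    using I that by (simp add: congruence_frame_def)
  show "\<theta> \<sqinter>\<^bsub>congruence_frame L\<^esub> \<phi> = \<theta> \<inter> \<phi>"
    if "frame_congruence L \<theta>" "frame_congruence L \<phi>" for \<theta> \<phi>
    using I[THEN conjunct2, THEN conjunct2] that by simp
  show "\<top>\<^bsub>congruence_frame L\<^esub> = carrier L \<times> carrier L"
    by (rule frame.top_eqI[OF fr])
      (auto simp: congruence_frame_def congruence_total[OF assms] dest: congruence_closed)
  show "\<bottom>\<^bsub>congruence_frame L\<^esub> = Id_on (carrier L)"
    by (rule frame.bottom_eqI[OF fr])
      (auto simp: congruence_frame_def congruence_identity[OF assms] intro: congruence_refl)
qed

text \<open>Joins are handled through this universal property from here on; the formula as an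
  intersection of congruences stays hidden behind it.\<close>

lemma congruence_frame_sup_le_iff:
  assumes "frame L" "\<Phi> \<subseteq> carrier (congruence_frame L)" "frame_congruence L \<psi>"
  shows "\<Squnion>\<^bsub>congruence_frame L\<^esub> \<Phi> \<subseteq> \<psi> \<longleftrightarrow> (\<forall>\<phi>\<in>\<Phi>. \<phi> \<subseteq> \<psi>)"
proof
  have "\<phi> \<subseteq> \<Squnion>\<^bsub>congruence_frame L\<^esub> \<Phi>" if "\<phi> \<in> \<Phi>" for \<phi>
    using that unfolding congruence_frame_sup[OF assms(1,2)] by blast
  then show "\<forall>\<phi>\<in>\<Phi>. \<phi> \<subseteq> \<psi>" if "\<Squnion>\<^bsub>congruence_frame L\<^esub> \<Phi> \<subseteq> \<psi>"
    using that by blast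
  show "\<Squnion>\<^bsub>congruence_frame L\<^esub> \<Phi> \<subseteq> \<psi>" if "\<forall>\<phi>\<in>\<Phi>. \<phi> \<subseteq> \<psi>"
    using that assms(3) unfolding congruence_frame_sup[OF assms(1,2)]
    by (intro Inter_lower) auto
qed

text \<open>Meeting the pair with \<open>x\<close> gives (\<bottom>, x), so every element is related
  to \<bottom>.\<close>

lemma congruence_eq_totalI:
  assumes "frame L" "frame_congruence L \<theta>" "(\<bottom>\<^bsub>L\<^esub>, \<top>\<^bsub>L\<^esub>) \<in> \<theta>"
  shows "\<theta> = carrier L \<times> carrier L"
proof -
  interpret L: frame L by fact
  have "(\<bottom>\<^bsub>L\<^esub>, x) \<in> \<theta>" if "x \<in> carrier L" for x
    using congruence_meet[OF assms(2,3) congruence_refl[OF assms(2) that]] that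
    by (simp add: L.meet_bottom_left L.meet_top_left)
  then show ?thesis
    using congruence_subset[OF assms(2)]
    by (blast intro: congruence_sym[OF assms(2)] congruence_trans[OF assms(2)])
qed

subsection \<open>Open and closed congruences\<close>

lemma congruence_nabla:
  assumes "frame L" "a \<in> carrier L"
  shows "frame_congruence L (nabla L a)"
proof -
  interpret L: frame L by fact
  have "nabla L a = {(u, v). u \<in> carrier L \<and> v \<in> carrier L \<and>
      (u \<squnion>\<^bsub>L\<^esub> a, v \<squnion>\<^bsub>L\<^esub> a) \<in> Id_on (carrier L)}"
    using assms(2) by (auto simp: nabla_def Id_on_def)
  then show ?thesis
    using congruence_vimage_join[OF assms(1) congruence_identity assms(2)] assms(1) by simp
qed

lemma congruence_delta:
  assumes "frame L" "a \<in> carrier L"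
  shows "frame_congruence L (delta L a)"
proof -
  interpret L: frame L by fact
  have "delta L a = {(u, v). u \<in> carrier L \<and> v \<in> carrier L \<and>
      (u \<sqinter>\<^bsub>L\<^esub> a, v \<sqinter>\<^bsub>L\<^esub> a) \<in> Id_on (carrier L)}"
    using assms(2) by (auto simp: delta_def Id_on_def)
  then show ?thesis
    using congruence_vimage_meet[OF assms(1) congruence_identity assms(2)] assms(1) by simp
qed

lemma bottom_in_nabla: "\<lbrakk>frame L; a \<in> carrier L\<rbrakk> \<Longrightarrow> (\<bottom>\<^bsub>L\<^esub>, a) \<in> nabla L a"
proof -
  assume "frame L" and a: "a \<in> carrier L"
  then interpret L: frame L by simp
  show ?thesis
    using a L.join_bottom_left[OF a] L.le_iff_meet[OF a a] by (simp add: nabla_def)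
qed

lemma top_in_delta: "\<lbrakk>frame L; a \<in> carrier L\<rbrakk> \<Longrightarrow> (a, \<top>\<^bsub>L\<^esub>) \<in> delta L a"
proof -
  assume "frame L" and a: "a \<in> carrier L"
  then interpret L: frame L by simp
  show ?thesis
    using a by (simp add: delta_def L.meet_idem L.meet_top_left)
qed

text \<open>\<open>nabla L a\<close> is the principal congruence of the pair (\<bottom>, a): joining
  this pair with x gives (x, x \<squnion> a), and x \<squnion> a = y \<squnion> a then links x to y.
  An inclusion thus becomes a test on a single pair.\<close>

lemma nabla_subset_iff:
  assumes "frame L" "frame_congruence L \<theta>" "a \<in> carrier L"
  shows "nabla L a \<subseteq> \<theta> \<longleftrightarrow> (\<bottom>\<^bsub>L\<^esub>, a) \<in> \<theta>"
proof
  interpret L: frame L by fact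
  note T = frame_congruenceD[OF assms(2)]
  assume a: "(\<bottom>\<^bsub>L\<^esub>, a) \<in> \<theta>"
  have *: "(x, x \<squnion>\<^bsub>L\<^esub> a) \<in> \<theta>" if "x \<in> carrier L" for x
    using congruence_join[OF assms(2) T(2)[OF that] a] that by (simp add: L.join_bottom_right)
  show "nabla L a \<subseteq> \<theta>"
  proof (clarsimp simp: nabla_def)
    fix x y assume xy: "x \<in> carrier L" "y \<in> carrier L" "x \<squnion>\<^bsub>L\<^esub> a = y \<squnion>\<^bsub>L\<^esub> a"
    then show "(x, y) \<in> \<theta>"
      using T(4)[OF *[OF xy(1)]] T(3)[OF *[OF xy(2)]] by simp
  qed
qed (use bottom_in_nabla[OF assms(1,3)] in blast)

text \<open>Dually, \<open>delta L a\<close> is the principal congruence of (a, \<top>): meeting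
  this pair with x gives (x \<sqinter> a, x).\<close>

lemma delta_subset_iff:
  assumes "frame L" "frame_congruence L \<theta>" "a \<in> carrier L"
  shows "delta L a \<subseteq> \<theta> \<longleftrightarrow> (a, \<top>\<^bsub>L\<^esub>) \<in> \<theta>"
proof
  interpret L: frame L by fact
  note T = frame_congruenceD[OF assms(2)]
  assume a: "(a, \<top>\<^bsub>L\<^esub>) \<in> \<theta>"
  have *: "(x \<sqinter>\<^bsub>L\<^esub> a, x) \<in> \<theta>" if "x \<in> carrier L" for x
    using T(5)[OF T(2)[OF that] a] that by (simp add: L.meet_top_right)
  show "delta L a \<subseteq> \<theta>"
  proof (clarsimp simp: delta_def)
    fix x y assume xy: "x \<in> carrier L" "y \<in> carrier L" "x \<sqinter>\<^bsub>L\<^esub> a = y \<sqinter>\<^bsub>L\<^esub> a"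
    then show "(x, y) \<in> \<theta>"
      using T(4)[OF T(3)[OF *[OF xy(1)]]] *[OF xy(2)] by simp
  qed
qed (use top_in_delta[OF assms(1,3)] in blast)

lemma nabla_mono_iff:
  assumes "frame L" "a \<in> carrier L" "b \<in> carrier L"
  shows "nabla L a \<subseteq> nabla L b \<longleftrightarrow> a \<sqsubseteq>\<^bsub>L\<^esub> b"
proof -
  interpret L: frame L by fact
  have "b = a \<squnion>\<^bsub>L\<^esub> b \<longleftrightarrow> a \<sqsubseteq>\<^bsub>L\<^esub> b"
    using assms by (simp add: L.le_iff_meet eq_commute)
  then show ?thesis
    using assms by (simp add: nabla_subset_iff congruence_nabla) (simp add: nabla_def L.join_bottom_left)
qed

lemma frame_map_nabla:
  assumes "frame L"
  shows "frame_map L (congruence_frame L) (restrict (nabla L) (carrier L))"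
proof (rule frame_mapI[OF refl refl])
  interpret L: frame L by fact
  interpret C: frame "congruence_frame L" using assms by (rule frame_congruence_frame)
  note cn = congruence_nabla[OF assms]
  have "nabla L \<top>\<^bsub>L\<^esub> = carrier L \<times> carrier L"
    by (rule congruence_eq_totalI[OF assms cn bottom_in_nabla[OF assms]]) simp_all
  then show "restrict (nabla L) (carrier L) \<top>\<^bsub>L\<^esub> = \<top>\<^bsub>congruence_frame L\<^esub>"
    by (simp add: congruence_frame_top assms)
  show "restrict (nabla L) (carrier L) (a \<sqinter>\<^bsub>L\<^esub> b)
      = restrict (nabla L) (carrier L) a \<sqinter>\<^bsub>congruence_frame L\<^esub> restrict (nabla L) (carrier L) b"
    if ab: "a \<in> carrier L" "b \<in> carrier L" for a b
  proof -
    have "nabla L (a \<sqinter>\<^bsub>L\<^esub> b) \<subseteq> nabla L a \<inter> nabla L b"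
      using ab assms by (simp add: nabla_mono_iff L.meet_left L.meet_right)
    moreover have "nabla L a \<inter> nabla L b \<subseteq> nabla L (a \<sqinter>\<^bsub>L\<^esub> b)"
    proof (clarsimp simp: nabla_def)
      fix x y assume "x \<in> carrier L" "y \<in> carrier L" "x \<squnion>\<^bsub>L\<^esub> a = y \<squnion>\<^bsub>L\<^esub> a" "x \<squnion>\<^bsub>L\<^esub> b = y \<squnion>\<^bsub>L\<^esub> b"
      then show "x \<squnion>\<^bsub>L\<^esub> (a \<sqinter>\<^bsub>L\<^esub> b) = y \<squnion>\<^bsub>L\<^esub> (a \<sqinter>\<^bsub>L\<^esub> b)"
        using ab L.join_meet_distrib[of a b x] L.join_meet_distrib[of a b y]
        by (simp add: join_comm)
    qed
    ultimately have "nabla L (a \<sqinter>\<^bsub>L\<^esub> b) = nabla L a \<inter> nabla L b"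
      by (rule subset_antisym)
    then show ?thesis
      using ab by (simp add: congruence_frame_meet assms cn)
  qed
  show "restrict (nabla L) (carrier L) (\<Squnion>\<^bsub>L\<^esub> S)
      = \<Squnion>\<^bsub>congruence_frame L\<^esub> (restrict (nabla L) (carrier L) ` S)" if S: "S \<subseteq> carrier L" for S
  proof -
    define \<theta> where "\<theta> = \<Squnion>\<^bsub>congruence_frame L\<^esub> (nabla L ` S)"
    have cS: "nabla L ` S \<subseteq> carrier (congruence_frame L)"
      using S cn by (auto simp: congruence_frame_carrier)
    then have \<theta>: "frame_congruence L \<theta>"
      using C.sup_closed[OF cS] by (simp add: congruence_frame_carrier \<theta>_def)
    have "\<forall>\<phi>\<in>nabla L ` S. \<phi> \<subseteq> \<theta>"
      using congruence_frame_sup_le_iff[OF assms cS \<theta>] by (simp add: \<theta>_def)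
    \<comment> \<open>The generating pairs of the \<nabla>(s) all have first component \<bottom>, so
      their join is the generating pair of \<nabla>(\<Squnion>S), and it stays in \<theta> because
      congruences are closed under joins.\<close>
    then have "(\<lambda>s. (\<bottom>\<^bsub>L\<^esub>, s)) ` S \<subseteq> \<theta>"
      using S bottom_in_nabla[OF assms] by blast
    from congruence_sup[OF \<theta> this] have "(\<Squnion>\<^bsub>L\<^esub> ((\<lambda>s. \<bottom>\<^bsub>L\<^esub>) ` S), \<Squnion>\<^bsub>L\<^esub> S) \<in> \<theta>"
      by (simp add: image_image)
    moreover have "\<Squnion>\<^bsub>L\<^esub> ((\<lambda>s. \<bottom>\<^bsub>L\<^esub>) ` S) = \<bottom>\<^bsub>L\<^esub>"
      by (rule L.sup_eqI) auto
    ultimately have "nabla L (\<Squnion>\<^bsub>L\<^esub> S) \<subseteq> \<theta>"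
      using S by (simp add: nabla_subset_iff[OF assms \<theta>])
    moreover have "nabla L s \<subseteq> nabla L (\<Squnion>\<^bsub>L\<^esub> S)" if "s \<in> S" for s
      using nabla_mono_iff[OF assms subsetD[OF S that] L.sup_closed[OF S]] L.sup_upper[OF S that]
      by simp
    then have "\<theta> \<subseteq> nabla L (\<Squnion>\<^bsub>L\<^esub> S)"
      unfolding \<theta>_def congruence_frame_sup_le_iff[OF assms cS cn[OF L.sup_closed[OF S]]]
      by blast
    moreover have "restrict (nabla L) (carrier L) ` S = nabla L ` S"
      using S by (intro image_cong) auto
    ultimately show ?thesis
      using S by (simp add: \<theta>_def)
  qed
qed (auto simp: congruence_nabla[OF assms] congruence_frame_carrier)

text \<open>In a distributive lattice, elements with equal join and equal meet with \<open>a\<close>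
  coincide, so the two congruences meet in the identity. Their join contains (\<bottom>, a) and (a,
  \<top>), hence (\<bottom>, \<top>).\<close>

lemma nabla_delta_complement:
  assumes "frame L" "a \<in> carrier L"
  shows "nabla L a \<sqinter>\<^bsub>congruence_frame L\<^esub> delta L a = \<bottom>\<^bsub>congruence_frame L\<^esub>"
    and "nabla L a \<squnion>\<^bsub>congruence_frame L\<^esub> delta L a = \<top>\<^bsub>congruence_frame L\<^esub>"
proof -
  interpret L: frame L by fact
  interpret C: frame "congruence_frame L" using assms(1) by (rule frame_congruence_frame)
  note cn = congruence_nabla[OF assms] and cd = congruence_delta[OF assms]
  have "x = y" if "x \<in> carrier L" "y \<in> carrier L" "x \<squnion>\<^bsub>L\<^esub> a = y \<squnion>\<^bsub>L\<^esub> a" "x \<sqinter>\<^bsub>L\<^esub> a = y \<sqinter>\<^bsub>L\<^esub> a" for x y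
  proof -
    have *: "x \<sqsubseteq>\<^bsub>L\<^esub> y" if "x \<in> carrier L" "y \<in> carrier L" "x \<squnion>\<^bsub>L\<^esub> a = y \<squnion>\<^bsub>L\<^esub> a" "x \<sqinter>\<^bsub>L\<^esub> a = y \<sqinter>\<^bsub>L\<^esub> a" for x y
    proof -
      have "x = x \<sqinter>\<^bsub>L\<^esub> (y \<squnion>\<^bsub>L\<^esub> a)"
        using that assms(2) by (metis L.join_closed L.join_left L.meet_absorb)
      also have "\<dots> = (x \<sqinter>\<^bsub>L\<^esub> y) \<squnion>\<^bsub>L\<^esub> (y \<sqinter>\<^bsub>L\<^esub> a)"
        using that assms(2) by (simp add: L.meet_join_distrib)
      finally show ?thesis
        using that assms(2) L.join_le[of "x \<sqinter>\<^bsub>L\<^esub> y" y "y \<sqinter>\<^bsub>L\<^esub> a"] by (simp add: L.meet_left L.meet_right)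
    qed
    show ?thesis
      using *[OF that] *[OF that(2,1) that(3)[symmetric] that(4)[symmetric]] that(1,2)
      by (rule L.le_antisym)
  qed
  then have "nabla L a \<inter> delta L a \<subseteq> Id_on (carrier L)"
    unfolding nabla_def delta_def by blast
  moreover have "Id_on (carrier L) \<subseteq> nabla L a \<inter> delta L a"
    by (auto simp: nabla_def delta_def)
  ultimately have "nabla L a \<inter> delta L a = Id_on (carrier L)"
    by (rule subset_antisym)
  then show "nabla L a \<sqinter>\<^bsub>congruence_frame L\<^esub> delta L a = \<bottom>\<^bsub>congruence_frame L\<^esub>"
    using assms(1) cn cd by (simp add: congruence_frame_meet congruence_frame_bottom)
  let ?j = "nabla L a \<squnion>\<^bsub>congruence_frame L\<^esub> delta L a"
  have j: "frame_congruence L ?j" "nabla L a \<subseteq> ?j" "delta L a \<subseteq> ?j"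
    using C.join_closed[of "nabla L a" "delta L a"] C.join_left[of "nabla L a" "delta L a"]
      C.join_right[of "nabla L a" "delta L a"] cn cd
    by (simp_all add: congruence_frame_carrier congruence_frame_le)
  have "(\<bottom>\<^bsub>L\<^esub>, \<top>\<^bsub>L\<^esub>) \<in> ?j"
    using congruence_trans[OF j(1)] j(2,3) bottom_in_nabla[OF assms] top_in_delta[OF assms] by blast
  then show "?j = \<top>\<^bsub>congruence_frame L\<^esub>"
    using congruence_eq_totalI[OF assms(1) j(1)] by (simp add: congruence_frame_top assms(1))
qed

lemma delta_bottom:
  assumes "frame L"
  shows "delta L \<bottom>\<^bsub>L\<^esub> = \<top>\<^bsub>congruence_frame L\<^esub>"
proof -
  interpret L: frame L by fact
  show ?thesis
    using congruence_eq_totalI[OF assms congruence_delta[OF assms] top_in_delta[OF assms]]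
    by (simp add: congruence_frame_top assms)
qed

text \<open>Identifying \<open>a \<sqinter> b\<close> with \<top> amounts to identifying both
  \<open>a\<close> and \<open>b\<close> with \<top>: in one direction the two generating pairs are
  met, in the other \<open>a\<close> and \<open>b\<close> both absorb \<open>a \<sqinter> b\<close>
  under meets.\<close>

lemma delta_meet:
  assumes "frame L" "a \<in> carrier L" "b \<in> carrier L"
  shows "delta L (a \<sqinter>\<^bsub>L\<^esub> b) = delta L a \<squnion>\<^bsub>congruence_frame L\<^esub> delta L b"
proof -
  interpret L: frame L by fact
  interpret C: frame "congruence_frame L" using assms(1) by (rule frame_congruence_frame)
  note cd = congruence_delta[OF assms(1)]
  let ?j = "delta L a \<squnion>\<^bsub>congruence_frame L\<^esub> delta L b"
  have j: "frame_congruence L ?j" "delta L a \<subseteq> ?j" "delta L b \<subseteq> ?j"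
    using C.join_closed[of "delta L a" "delta L b"] C.join_left[of "delta L a" "delta L b"]
      C.join_right[of "delta L a" "delta L b"] cd[OF assms(2)] cd[OF assms(3)]
    by (simp_all add: congruence_frame_carrier congruence_frame_le)
  have "(a \<sqinter>\<^bsub>L\<^esub> b, \<top>\<^bsub>L\<^esub> \<sqinter>\<^bsub>L\<^esub> \<top>\<^bsub>L\<^esub>) \<in> ?j"
    using j(2,3) top_in_delta[OF assms(1)] assms(2,3) by (intro congruence_meet[OF j(1)]) auto
  then have "delta L (a \<sqinter>\<^bsub>L\<^esub> b) \<subseteq> ?j"
    using assms by (simp add: delta_subset_iff[OF assms(1) j(1)] L.meet_idem)
  moreover have "delta L a \<subseteq> delta L (a \<sqinter>\<^bsub>L\<^esub> b)" "delta L b \<subseteq> delta L (a \<sqinter>\<^bsub>L\<^esub> b)"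
    using assms(2,3)
    by (simp_all add: delta_subset_iff[OF assms(1) cd])
      (simp_all add: delta_def L.meet_top_left L.meet_left_comm[of b a b] L.meet_idem
        flip: L.meet_assoc[of a a b])
  then have "?j \<subseteq> delta L (a \<sqinter>\<^bsub>L\<^esub> b)"
    using C.join_le[of "delta L a" "delta L (a \<sqinter>\<^bsub>L\<^esub> b)" "delta L b"] cd assms(2,3)
    by (simp add: congruence_frame_carrier congruence_frame_le)
  ultimately show ?thesis by blast
qed

text \<open>Meets distribute over binary joins, so agreement below \<open>a\<close> and below
  \<open>b\<close> is agreement below \<open>a \<squnion> b\<close>. Together with
  \<open>delta_bottom\<close> this covers all finite joins.\<close>

lemma delta_join:
  assumes "frame L" "a \<in> carrier L" "b \<in> carrier L"
  shows "delta L (a \<squnion>\<^bsub>L\<^esub> b) = delta L a \<sqinter>\<^bsub>congruence_frame L\<^esub> delta L b"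
proof -
  interpret L: frame L by fact
  note cd = congruence_delta[OF assms(1)]
  have ab: "(a \<squnion>\<^bsub>L\<^esub> b) \<sqinter>\<^bsub>L\<^esub> a = a" "(a \<squnion>\<^bsub>L\<^esub> b) \<sqinter>\<^bsub>L\<^esub> b = b"
    unfolding meet_comm[of L "a \<squnion>\<^bsub>L\<^esub> b"]
    using assms by (simp_all add: L.meet_absorb L.join_left L.join_right)
  have "delta L (a \<squnion>\<^bsub>L\<^esub> b) \<subseteq> delta L a" "delta L (a \<squnion>\<^bsub>L\<^esub> b) \<subseteq> delta L b"
    using assms(2,3) ab
    by (simp_all add: delta_subset_iff[OF assms(1) cd])
      (simp_all add: delta_def L.meet_top_left)
  moreover have "delta L a \<inter> delta L b \<subseteq> delta L (a \<squnion>\<^bsub>L\<^esub> b)"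
    using assms(2,3) by (auto simp: delta_def L.meet_join_distrib)
  ultimately show ?thesis
    using assms(2,3) by (auto simp: congruence_frame_meet assms(1) cd)
qed

subsection \<open>Quotients\<close>

text \<open>A quotient is represented by the largest elements of the congruence classes.\<close>

definition quotient_frame :: "'a gorder \<Rightarrow> ('a \<times> 'a) set \<Rightarrow> 'a gorder" where
  "quotient_frame L \<theta> = L\<lparr>carrier := {a \<in> carrier L. \<forall>b. (a, b) \<in> \<theta> \<longrightarrow> b \<sqsubseteq>\<^bsub>L\<^esub> a}\<rparr>"

definition quotient_map :: "'a gorder \<Rightarrow> ('a \<times> 'a) set \<Rightarrow> 'a \<Rightarrow> 'a" where
  "quotient_map L \<theta> = (\<lambda>a\<in>carrier L. \<Squnion>\<^bsub>L\<^esub> {b. (a, b) \<in> \<theta>})"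

text \<open>A congruence is closed under joins, so the join \<open>j a\<close> of the class of
  \<open>a\<close> belongs to that class. Hence \<open>j\<close> is a nucleus: inflationary,
  idempotent and compatible with binary meets. Binary meets of the quotient are those of
  \<open>L\<close>, joins are \<open>j\<close> of the joins in \<open>L\<close>, and distributivity
  holds because \<theta> relates a \<sqinter> \<Squnion>S to a \<sqinter> j (\<Squnion>S).\<close>

lemma quotient:
  assumes "frame L" "frame_congruence L \<theta>"
  shows frame_quotient: "frame (quotient_frame L \<theta>)"
    and frame_map_quotient: "frame_map L (quotient_frame L \<theta>) (quotient_map L \<theta>)"
    and quotient_map_eq_iff: "\<And>a b. \<lbrakk>a \<in> carrier L; b \<in> carrier L\<rbrakk> \<Longrightarrow>
      quotient_map L \<theta> a = quotient_map L \<theta> b \<longleftrightarrow> (a, b) \<in> \<theta>"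
proof -
  interpret L: frame L by fact
  note T = frame_congruenceD[OF assms(2)] and C = congruence_closed[OF assms(2)]
  define Q where "Q = {a \<in> carrier L. \<forall>b. (a, b) \<in> \<theta> \<longrightarrow> b \<sqsubseteq>\<^bsub>L\<^esub> a}"
  define j where "j a = \<Squnion>\<^bsub>L\<^esub> {b. (a, b) \<in> \<theta>}" for a
  have Qc: "a \<in> carrier L" if "a \<in> Q" for a using that by (simp add: Q_def)
  have Qs: "S \<subseteq> carrier L" if "S \<subseteq> Q" for S using that Qc by blast
  have block: "{b. (a, b) \<in> \<theta>} \<subseteq> carrier L" for a using T(1) by blast
  have j_closed: "j a \<in> carrier L" for a
    unfolding j_def by (rule L.sup_closed[OF block])
  have j_upper: "b \<sqsubseteq>\<^bsub>L\<^esub> j a" if "(a, b) \<in> \<theta>" for a b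
    unfolding j_def using that by (intro L.sup_upper block) simp
  have j_rel: "(a, j a) \<in> \<theta>" if "a \<in> carrier L" for a
  proof -
    \<comment> \<open>Nonemptiness makes the first components of the pairs (a, b) join to
      \<open>a\<close>; the second components join to \<open>j a\<close>.\<close>
    have "{b. (a, b) \<in> \<theta>} \<noteq> {}" using T(2)[OF that] by blast
    then have "fst ` Pair a ` {b. (a, b) \<in> \<theta>} = {a}"
      by (simp add: image_image image_constant_conv)
    then show ?thesis
      using T(6)[of "Pair a ` {b. (a, b) \<in> \<theta>}"] that by (auto simp: j_def image_image)
  qed
  have jQ: "j a \<in> Q" if "a \<in> carrier L" for a
    using j_closed j_upper T(4)[OF j_rel[OF that]] by (simp add: Q_def)
  have j_eqI: "j a = b" if "(a, b) \<in> \<theta>" "b \<in> Q" for a b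
  proof (rule L.le_antisym)
    have "(b, j a) \<in> \<theta>" using that(1) C(1) j_rel T(3,4) by blast
    then show "j a \<sqsubseteq>\<^bsub>L\<^esub> b" using that(2) by (simp add: Q_def)
  qed (use that j_closed j_upper C in auto)
  have j_least: "j a \<sqsubseteq>\<^bsub>L\<^esub> q" if "a \<in> carrier L" "a \<sqsubseteq>\<^bsub>L\<^esub> q" "q \<in> Q" for a q
  proof -
    \<comment> \<open>As a \<squnion> q = q, this puts j a \<squnion> q into the class of
      \<open>q\<close>, whose largest element is \<open>q\<close>.\<close>
    have "(a \<squnion>\<^bsub>L\<^esub> q, j a \<squnion>\<^bsub>L\<^esub> q) \<in> \<theta>"
      using that Qc by (intro congruence_join[OF assms(2)] j_rel T(2)) auto
    then have "(q, j a \<squnion>\<^bsub>L\<^esub> q) \<in> \<theta>" using that Qc L.le_iff_meet by simp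
    then have "j a \<squnion>\<^bsub>L\<^esub> q \<sqsubseteq>\<^bsub>L\<^esub> q" using that(3) by (simp add: Q_def)
    then show ?thesis
      using that Qc j_closed by (meson L.join_closed L.join_left L.le_trans)
  qed
  have j_ext: "a \<sqsubseteq>\<^bsub>L\<^esub> j a" if "a \<in> carrier L" for a
    using that by (intro j_upper T(2))
  have meetQ: "a \<sqinter>\<^bsub>L\<^esub> b \<in> Q" if "a \<in> Q" "b \<in> Q" for a b
  proof -
    \<comment> \<open>Joining the relation between a \<sqinter> b and \<open>c\<close> with either
      factor a' relates a' to c \<squnion> a', and a' is the largest element of its class; so
      \<open>c\<close> lies below both factors.\<close>
    have "c \<sqsubseteq>\<^bsub>L\<^esub> a'" if "(a \<sqinter>\<^bsub>L\<^esub> b, c) \<in> \<theta>" "a' = a \<or> a' = b" for c a'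
    proof -
      have a': "a' \<in> Q" using that(2) \<open>a \<in> Q\<close> \<open>b \<in> Q\<close> by blast
      have le: "a \<sqinter>\<^bsub>L\<^esub> b \<sqsubseteq>\<^bsub>L\<^esub> a'"
        using that(2) Qc \<open>a \<in> Q\<close> \<open>b \<in> Q\<close> by (auto intro: L.meet_left L.meet_right)
      have "(a \<sqinter>\<^bsub>L\<^esub> b \<squnion>\<^bsub>L\<^esub> a', c \<squnion>\<^bsub>L\<^esub> a') \<in> \<theta>"
        using that(1) a' Qc by (intro congruence_join[OF assms(2)] T(2)) auto
      then have "c \<squnion>\<^bsub>L\<^esub> a' \<sqsubseteq>\<^bsub>L\<^esub> a'"
        using le a' \<open>a \<in> Q\<close> \<open>b \<in> Q\<close> L.le_iff_meet[of "a \<sqinter>\<^bsub>L\<^esub> b" a'] by (simp add: Q_def)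
      then show ?thesis
        using C(2)[OF that(1)] Qc[OF a'] by (meson L.join_closed L.join_left L.le_trans)
    qed
    then show ?thesis
      using that C by (auto simp: Q_def intro!: L.meet_le)
  qed
  have Q_eq: "quotient_frame L \<theta> = L\<lparr>carrier := Q\<rparr>"
    by (simp add: quotient_frame_def Q_def)
  have I: "frame (quotient_frame L \<theta>) \<and>
      (\<forall>S\<subseteq>Q. \<Squnion>\<^bsub>quotient_frame L \<theta>\<^esub> S = j (\<Squnion>\<^bsub>L\<^esub> S)) \<and>
      (\<forall>a\<in>Q. \<forall>b\<in>Q. a \<sqinter>\<^bsub>quotient_frame L \<theta>\<^esub> b = a \<sqinter>\<^bsub>L\<^esub> b)"
    unfolding Q_eq
  proof (rule frameI)
    show "a = b" if "a \<in> Q" "b \<in> Q" "a \<sqsubseteq>\<^bsub>L\<lparr>carrier := Q\<rparr>\<^esub> b" "b \<sqsubseteq>\<^bsub>L\<lparr>carrier := Q\<rparr>\<^esub> a" for a b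
      using that by (simp add: L.le_antisym Qc)
    show "a \<sqsubseteq>\<^bsub>L\<lparr>carrier := Q\<rparr>\<^esub> d" if "a \<in> Q" "b \<in> Q" "d \<in> Q"
      "a \<sqsubseteq>\<^bsub>L\<lparr>carrier := Q\<rparr>\<^esub> b" "b \<sqsubseteq>\<^bsub>L\<lparr>carrier := Q\<rparr>\<^esub> d" for a b d
      using L.le_trans[of a b d] that by (simp add: Qc)
    show "x \<sqsubseteq>\<^bsub>L\<lparr>carrier := Q\<rparr>\<^esub> j (\<Squnion>\<^bsub>L\<^esub> S)" if "S \<subseteq> Q" "x \<in> S" for S x
      using L.le_trans[OF L.sup_upper[OF Qs[OF that(1)] that(2)] j_ext] that Qs[OF that(1)] j_closed
      by auto
    show "j (\<Squnion>\<^bsub>L\<^esub> S) \<sqsubseteq>\<^bsub>L\<lparr>carrier := Q\<rparr>\<^esub> z"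
      if "S \<subseteq> Q" "z \<in> Q" "\<And>x. x \<in> S \<Longrightarrow> x \<sqsubseteq>\<^bsub>L\<lparr>carrier := Q\<rparr>\<^esub> z" for S z
      using that Qs[OF that(1)] j_least by (simp add: L.sup_least Qc)
    show "a \<sqinter>\<^bsub>L\<^esub> j (\<Squnion>\<^bsub>L\<^esub> S) \<sqsubseteq>\<^bsub>L\<lparr>carrier := Q\<rparr>\<^esub> j (\<Squnion>\<^bsub>L\<^esub> ((\<sqinter>\<^bsub>L\<^esub>) a ` S))"
      if "a \<in> Q" "S \<subseteq> Q" for a S
    proof -
      have "(a \<sqinter>\<^bsub>L\<^esub> \<Squnion>\<^bsub>L\<^esub> S, a \<sqinter>\<^bsub>L\<^esub> j (\<Squnion>\<^bsub>L\<^esub> S)) \<in> \<theta>"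
        using that Qs[OF that(2)] by (intro T(5) T(2) j_rel Qc L.sup_closed)
      then show ?thesis
        using j_upper Qs[OF that(2)] that(1) by (simp add: L.meet_sup_distrib Qc)
    qed
  qed (simp_all add: L.eq_is_equal Qc Qs jQ meetQ L.meet_left L.meet_right L.meet_le)
  show fr: "frame (quotient_frame L \<theta>)" using I by blast
  have qmap: "quotient_map L \<theta> = restrict j (carrier L)"
    unfolding quotient_map_def j_def ..
  show "quotient_map L \<theta> a = quotient_map L \<theta> b \<longleftrightarrow> (a, b) \<in> \<theta>"
    if "a \<in> carrier L" "b \<in> carrier L" for a b
  proof
    assume "quotient_map L \<theta> a = quotient_map L \<theta> b"
    then have "j a = j b" using that by (simp add: qmap)
    then show "(a, b) \<in> \<theta>" using T(4)[OF j_rel[OF that(1)]] T(3)[OF j_rel[OF that(2)]] by simp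
  next
    assume "(a, b) \<in> \<theta>"
    then have "j a = j b" using T(4)[OF _ j_rel[OF that(2)]] jQ[OF that(2)] by (intro j_eqI)
    then show "quotient_map L \<theta> a = quotient_map L \<theta> b" using that by (simp add: qmap)
  qed
  show "frame_map L (quotient_frame L \<theta>) (quotient_map L \<theta>)"
    unfolding qmap
  proof (rule frame_mapI[of _ "carrier L" _ Q])
    have "\<top>\<^bsub>quotient_frame L \<theta>\<^esub> = j \<top>\<^bsub>L\<^esub>"
    proof (rule frame.top_eqI[OF fr])
      show "x \<sqsubseteq>\<^bsub>quotient_frame L \<theta>\<^esub> j \<top>\<^bsub>L\<^esub>" if "x \<in> carrier (quotient_frame L \<theta>)" for x
        using that L.le_trans[OF L.top_higher j_ext] j_closed by (simp add: Q_eq Qc)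
    qed (simp add: Q_eq jQ)
    then show "restrict j (carrier L) \<top>\<^bsub>L\<^esub> = \<top>\<^bsub>quotient_frame L \<theta>\<^esub>"
      by simp
    show "restrict j (carrier L) (a \<sqinter>\<^bsub>L\<^esub> b)
        = restrict j (carrier L) a \<sqinter>\<^bsub>quotient_frame L \<theta>\<^esub> restrict j (carrier L) b"
      if "a \<in> carrier L" "b \<in> carrier L" for a b
      using that I[THEN conjunct2, THEN conjunct2] jQ
      by (simp add: j_eqI[OF T(5)[OF j_rel j_rel] meetQ])
    show "restrict j (carrier L) (\<Squnion>\<^bsub>L\<^esub> S) = \<Squnion>\<^bsub>quotient_frame L \<theta>\<^esub> (restrict j (carrier L) ` S)"
      if "S \<subseteq> carrier L" for S
    proof -
      have im: "restrict j (carrier L) ` S = j ` S" using that by (intro image_cong) auto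
      have jS: "j ` S \<subseteq> Q" using that jQ by auto
      have "(\<lambda>a. (a, j a)) ` S \<subseteq> \<theta>" using that j_rel by blast
      from T(6)[OF this] have "(\<Squnion>\<^bsub>L\<^esub> S, \<Squnion>\<^bsub>L\<^esub> (j ` S)) \<in> \<theta>" by (simp add: image_image)
      then have "j (\<Squnion>\<^bsub>L\<^esub> S) = j (\<Squnion>\<^bsub>L\<^esub> (j ` S))"
        using T(4)[OF _ j_rel] jQ L.sup_closed[OF Qs[OF jS]] by (intro j_eqI)
      moreover have "\<Squnion>\<^bsub>quotient_frame L \<theta>\<^esub> (j ` S) = j (\<Squnion>\<^bsub>L\<^esub> (j ` S))"
        using I jS by blast
      ultimately show ?thesis
        unfolding im using L.sup_closed[OF that] by simp
    qed
  qed (auto simp: Q_eq jQ)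
qed

text \<open>\<open>s\<close> chooses a preimage under the surjection \<open>q\<close>, and
  \<open>ker\<close> makes the value of \<open>g\<close> independent of the choice. Each operation
  of \<open>L\<close> can therefore be computed on preimages in \<open>K\<close>.\<close>

lemma frame_map_factor:
  assumes "frame K" "frame L" "frame M" "frame_map K L q" "q ` carrier K = carrier L" "frame_map K M \<phi>"
    and ker: "\<And>D D'. \<lbrakk>D \<in> carrier K; D' \<in> carrier K; q D = q D'\<rbrakk> \<Longrightarrow> \<phi> D = \<phi> D'"
  obtains g where "frame_map L M g" "\<And>D. D \<in> carrier K \<Longrightarrow> g (q D) = \<phi> D"
proof -
  interpret K: frame K by fact
  interpret L: frame L by fact
  note q = frame_mapD[OF assms(4)] and \<phi> = frame_mapD[OF assms(6)]
  define s where "s = inv_into (carrier K) q"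
  have s: "s x \<in> carrier K" "q (s x) = x" if "x \<in> carrier L" for x
    using that assms(5) by (auto simp: s_def inv_into_into f_inv_into_f)
  define g where "g = (\<lambda>x\<in>carrier L. \<phi> (s x))"
  have g: "g (q D) = \<phi> D" if "D \<in> carrier K" for D
    using ker[OF s(1)[OF q(1)[OF that]] that s(2)[OF q(1)[OF that]]] q(1)[OF that]
    by (simp add: g_def)
  have "frame_map L M g"
  proof (rule frame_mapI[OF refl refl])
    show "g \<in> extensional (carrier L)" by (simp add: g_def)
    show "g a \<in> carrier M" if "a \<in> carrier L" for a
      using that s(1) \<phi>(1) by (simp add: g_def)
    show "g \<top>\<^bsub>L\<^esub> = \<top>\<^bsub>M\<^esub>"
      using g[OF K.top_closed] by (simp add: q(2) \<phi>(2))
    show "g (a \<sqinter>\<^bsub>L\<^esub> b) = g a \<sqinter>\<^bsub>M\<^esub> g b" if "a \<in> carrier L" "b \<in> carrier L" for a b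
      using g[OF K.meet_closed[OF s(1)[OF that(1)] s(1)[OF that(2)]]] g[OF s(1)[OF that(1)]]
        g[OF s(1)[OF that(2)]] that by (simp add: q(3) \<phi>(3) s)
    show "g (\<Squnion>\<^bsub>L\<^esub> S) = \<Squnion>\<^bsub>M\<^esub> (g ` S)" if "S \<subseteq> carrier L" for S
    proof -
      have sS: "s ` S \<subseteq> carrier K" using that s(1) by auto
      have "q ` s ` S = (\<lambda>x. x) ` S"
        unfolding image_image using that s(2) by (intro image_cong) auto
      moreover have "\<phi> ` s ` S = g ` S"
        unfolding image_image using that by (intro image_cong) (auto simp: g_def)
      ultimately show ?thesis
        using g[OF K.sup_closed[OF sS]] by (simp add: q(4)[OF sS] \<phi>(4)[OF sS])
    qed
  qed
  with g that show ?thesis by blast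
qed

section \<open>Congruences presented by inequalities\<close>

lemma generated_congruence_least:
  assumes "frame_congruence L \<theta>" "\<And>a b. (a, b) \<in> R \<Longrightarrow> (a \<sqinter>\<^bsub>L\<^esub> b, a) \<in> \<theta>"
  shows "generated_congruence L R \<subseteq> \<theta>"
  unfolding generated_congruence_def using assms by (intro Inter_lower) auto

lemma generated_congruence_base: "(a, b) \<in> R \<Longrightarrow> (a \<sqinter>\<^bsub>L\<^esub> b, a) \<in> generated_congruence L R"
  unfolding generated_congruence_def by auto

lemma congruence_generated:
  assumes "frame L" "R \<subseteq> carrier L \<times> carrier L"
  shows "frame_congruence L (generated_congruence L R)"
  unfolding generated_congruence_def
proof (rule congruence_Inter[OF assms(1)])
  interpret L: frame L by fact
  have "carrier L \<times> carrier L \<in> {\<theta>. frame_congruence L \<theta> \<and> (\<forall>(a, b)\<in>R. (a \<sqinter>\<^bsub>L\<^esub> b, a) \<in> \<theta>)}"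
    using assms by (auto simp: congruence_total)
  then show "{\<theta>. frame_congruence L \<theta> \<and> (\<forall>(a, b)\<in>R. (a \<sqinter>\<^bsub>L\<^esub> b, a) \<in> \<theta>)} \<noteq> {}" by blast
qed auto

section \<open>Coproducts\<close>

lemma c_idealD:
  assumes "c_ideal A B D"
  shows c_ideal_subset: "D \<subseteq> carrier A \<times> carrier B"
    and c_ideal_down: "\<And>a b a' b'. \<lbrakk>(a, b) \<in> D; a' \<in> carrier A; b' \<in> carrier B; a' \<sqsubseteq>\<^bsub>A\<^esub> a; b' \<sqsubseteq>\<^bsub>B\<^esub> b\<rbrakk> \<Longrightarrow> (a', b') \<in> D"
    and c_ideal_sup_left: "\<And>S b. \<lbrakk>b \<in> carrier B; S \<subseteq> carrier A; S \<times> {b} \<subseteq> D\<rbrakk> \<Longrightarrow> (\<Squnion>\<^bsub>A\<^esub> S, b) \<in> D"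
    and c_ideal_sup_right: "\<And>S a. \<lbrakk>a \<in> carrier A; S \<subseteq> carrier B; {a} \<times> S \<subseteq> D\<rbrakk> \<Longrightarrow> (a, \<Squnion>\<^bsub>B\<^esub> S) \<in> D"
proof -
  note c = assms[unfolded c_ideal_def]
  show "D \<subseteq> carrier A \<times> carrier B"
    using c by (rule conjunct1)
  show "(a', b') \<in> D"
    if "(a, b) \<in> D" "a' \<in> carrier A" "b' \<in> carrier B" "a' \<sqsubseteq>\<^bsub>A\<^esub> a" "b' \<sqsubseteq>\<^bsub>B\<^esub> b" for a b a' b'
    using c[THEN conjunct2, THEN conjunct1] that by fast
  show "(\<Squnion>\<^bsub>A\<^esub> S, b) \<in> D" if "b \<in> carrier B" "S \<subseteq> carrier A" "S \<times> {b} \<subseteq> D" for S b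
    using c[THEN conjunct2, THEN conjunct2, THEN conjunct1] that by simp
  show "(a, \<Squnion>\<^bsub>B\<^esub> S) \<in> D" if "a \<in> carrier A" "S \<subseteq> carrier B" "{a} \<times> S \<subseteq> D" for S a
    using c[THEN conjunct2, THEN conjunct2, THEN conjunct2] that by simp
qed

lemma c_idealI:
  assumes "D \<subseteq> carrier A \<times> carrier B"
    and "\<And>a b a' b'. \<lbrakk>(a, b) \<in> D; a' \<in> carrier A; b' \<in> carrier B; a' \<sqsubseteq>\<^bsub>A\<^esub> a; b' \<sqsubseteq>\<^bsub>B\<^esub> b\<rbrakk> \<Longrightarrow> (a', b') \<in> D"
    and "\<And>S b. \<lbrakk>b \<in> carrier B; S \<subseteq> carrier A; S \<times> {b} \<subseteq> D\<rbrakk> \<Longrightarrow> (\<Squnion>\<^bsub>A\<^esub> S, b) \<in> D"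
    and "\<And>S a. \<lbrakk>a \<in> carrier A; S \<subseteq> carrier B; {a} \<times> S \<subseteq> D\<rbrakk> \<Longrightarrow> (a, \<Squnion>\<^bsub>B\<^esub> S) \<in> D"
  shows "c_ideal A B D"
  unfolding c_ideal_def
proof (intro conjI ballI allI impI; (elim conjE)?)
  show "case z of (a, b) \<Rightarrow> \<forall>a'\<in>carrier A. \<forall>b'\<in>carrier B. a' \<sqsubseteq>\<^bsub>A\<^esub> a \<and> b' \<sqsubseteq>\<^bsub>B\<^esub> b \<longrightarrow> (a', b') \<in> D"
    if "z \<in> D" for z
    using that assms(2) by (cases z) simp
qed (simp_all add: assms(1,3,4))

text \<open>These pairs arise from the empty join in one coordinate.\<close>

lemma c_ideal_bottom:
  assumes "frame A" "frame B" "c_ideal A B D"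
  shows "b \<in> carrier B \<Longrightarrow> (\<bottom>\<^bsub>A\<^esub>, b) \<in> D" "a \<in> carrier A \<Longrightarrow> (a, \<bottom>\<^bsub>B\<^esub>) \<in> D"
  using c_ideal_sup_left[OF assms(3), of b "{}"] c_ideal_sup_right[OF assms(3), of a "{}"] assms(1,2)
  by (simp_all add: frame.sup_empty_eq)

lemma c_ideal_Inter:
  assumes "\<And>D. D \<in> T \<Longrightarrow> c_ideal A B D" "T \<noteq> {}"
  shows "c_ideal A B (\<Inter>T)"
proof (rule c_idealI)
  show "\<Inter>T \<subseteq> carrier A \<times> carrier B" using assms c_ideal_subset by fastforce
  show "(a', b') \<in> \<Inter>T" if "(a, b) \<in> \<Inter>T" "a' \<in> carrier A" "b' \<in> carrier B" "a' \<sqsubseteq>\<^bsub>A\<^esub> a" "b' \<sqsubseteq>\<^bsub>B\<^esub> b" for a b a' b'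
    using c_ideal_down[OF assms(1)] that by blast
  show "(\<Squnion>\<^bsub>A\<^esub> S, b) \<in> \<Inter>T" if "b \<in> carrier B" "S \<subseteq> carrier A" "S \<times> {b} \<subseteq> \<Inter>T" for S b
    using c_ideal_sup_left[OF assms(1)] that by blast
  show "(a, \<Squnion>\<^bsub>B\<^esub> S) \<in> \<Inter>T" if "a \<in> carrier A" "S \<subseteq> carrier B" "{a} \<times> S \<subseteq> \<Inter>T" for S a
    using c_ideal_sup_right[OF assms(1)] that by blast
qed

lemma c_ideal_total:
  assumes "frame A" "frame B"
  shows "c_ideal A B (carrier A \<times> carrier B)"
proof -
  interpret A: frame A by fact
  interpret B: frame B by fact
  show ?thesis by (rule c_idealI) auto
qed

text \<open>This is the Heyting implication from \<open>D\<close> to \<open>E\<close>, and it is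
  what makes the coproduct distributive. It is closed under joins in each coordinate because meeting
  with a fixed element preserves joins.\<close>

lemma c_ideal_imp:
  assumes "frame A" "frame B" "D \<subseteq> carrier A \<times> carrier B" "c_ideal A B E"
  shows "c_ideal A B {(a, b). a \<in> carrier A \<and> b \<in> carrier B \<and>
    (\<forall>(c, d)\<in>D. (a \<sqinter>\<^bsub>A\<^esub> c, b \<sqinter>\<^bsub>B\<^esub> d) \<in> E)}" (is "c_ideal A B ?I")
proof -
  interpret A: frame A by fact
  interpret B: frame B by fact
  note E = c_idealD[OF assms(4)]
  have c: "c \<in> carrier A" "d \<in> carrier B" if "(c, d) \<in> D" for c d
    using that assms(3) by auto
  show ?thesis
  proof (rule c_idealI)
    show "(a', b') \<in> ?I" if "(a, b) \<in> ?I" "a' \<in> carrier A" "b' \<in> carrier B" "a' \<sqsubseteq>\<^bsub>A\<^esub> a" "b' \<sqsubseteq>\<^bsub>B\<^esub> b" for a b a' b'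
    proof -
      have "(a' \<sqinter>\<^bsub>A\<^esub> x, b' \<sqinter>\<^bsub>B\<^esub> y) \<in> E" if xy: "(x, y) \<in> D" for x y
      proof (rule E(2))
        show "(a \<sqinter>\<^bsub>A\<^esub> x, b \<sqinter>\<^bsub>B\<^esub> y) \<in> E" using \<open>(a, b) \<in> ?I\<close> xy by blast
        show "a' \<sqinter>\<^bsub>A\<^esub> x \<sqsubseteq>\<^bsub>A\<^esub> a \<sqinter>\<^bsub>A\<^esub> x" "b' \<sqinter>\<^bsub>B\<^esub> y \<sqsubseteq>\<^bsub>B\<^esub> b \<sqinter>\<^bsub>B\<^esub> y"
          using \<open>a' \<sqsubseteq>\<^bsub>A\<^esub> a\<close> \<open>b' \<sqsubseteq>\<^bsub>B\<^esub> b\<close> \<open>(a, b) \<in> ?I\<close> \<open>a' \<in> carrier A\<close> \<open>b' \<in> carrier B\<close> c[OF xy]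
          by (auto intro!: A.meet_mono B.meet_mono)
      qed (use that \<open>a' \<in> carrier A\<close> \<open>b' \<in> carrier B\<close> c in auto)
      then show ?thesis using that by blast
    qed
    show "(\<Squnion>\<^bsub>A\<^esub> S, b) \<in> ?I" if "b \<in> carrier B" "S \<subseteq> carrier A" "S \<times> {b} \<subseteq> ?I" for S b
    proof -
      have "(\<Squnion>\<^bsub>A\<^esub> S \<sqinter>\<^bsub>A\<^esub> x, b \<sqinter>\<^bsub>B\<^esub> y) \<in> E" if xy: "(x, y) \<in> D" for x y
        unfolding A.sup_meet_distrib[OF \<open>S \<subseteq> carrier A\<close> c(1)[OF xy]]
        using that \<open>b \<in> carrier B\<close> \<open>S \<subseteq> carrier A\<close> \<open>S \<times> {b} \<subseteq> ?I\<close> c[OF xy]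
        by (intro E(3)) (auto intro!: A.meet_closed)
      then show ?thesis using that by auto
    qed
    show "(a, \<Squnion>\<^bsub>B\<^esub> S) \<in> ?I" if "a \<in> carrier A" "S \<subseteq> carrier B" "{a} \<times> S \<subseteq> ?I" for S a
    proof -
      have "(a \<sqinter>\<^bsub>A\<^esub> x, \<Squnion>\<^bsub>B\<^esub> S \<sqinter>\<^bsub>B\<^esub> y) \<in> E" if xy: "(x, y) \<in> D" for x y
        unfolding B.sup_meet_distrib[OF \<open>S \<subseteq> carrier B\<close> c(2)[OF xy]]
        using that \<open>a \<in> carrier A\<close> \<open>S \<subseteq> carrier B\<close> \<open>{a} \<times> S \<subseteq> ?I\<close> c[OF xy]
        by (intro E(4)) (auto intro!: B.meet_closed)
      then show ?thesis using that by auto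
    qed
  qed auto
qed

section \<open>The coproduct frame and its basic elements\<close>

lemma frame_coproduct_carrier: "carrier (frame_coproduct A B) = {D. c_ideal A B D}"
  and frame_coproduct_le: "D \<sqsubseteq>\<^bsub>frame_coproduct A B\<^esub> E \<longleftrightarrow> D \<subseteq> E"
  by (simp_all add: frame_coproduct_def)

lemma frame_coproduct:
  assumes "frame A" "frame B"
  shows frame_frame_coproduct: "frame (frame_coproduct A B)"
    and frame_coproduct_sup: "\<And>\<Phi>. \<Phi> \<subseteq> carrier (frame_coproduct A B) \<Longrightarrow>
      \<Squnion>\<^bsub>frame_coproduct A B\<^esub> \<Phi> = \<Inter>{E. c_ideal A B E \<and> \<Union>\<Phi> \<subseteq> E}"
    and frame_coproduct_meet: "\<And>D E. \<lbrakk>c_ideal A B D; c_ideal A B E\<rbrakk> \<Longrightarrow>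
      D \<sqinter>\<^bsub>frame_coproduct A B\<^esub> E = D \<inter> E"
    and frame_coproduct_top: "\<top>\<^bsub>frame_coproduct A B\<^esub> = carrier A \<times> carrier B"
proof -
  interpret A: frame A by fact
  interpret B: frame B by fact
  let ?A = "Collect (c_ideal A B)"
  have sup: "c_ideal A B (\<Inter>{E. c_ideal A B E \<and> \<Union>\<Phi> \<subseteq> E})" if "\<Phi> \<subseteq> ?A" for \<Phi>
  proof (rule c_ideal_Inter)
    have "\<Union>\<Phi> \<subseteq> carrier A \<times> carrier B"
      using that by (intro Sup_least c_ideal_subset) auto
    then have "carrier A \<times> carrier B \<in> {E. c_ideal A B E \<and> \<Union>\<Phi> \<subseteq> E}"
      using c_ideal_total[OF assms] by simp
    then show "{E. c_ideal A B E \<and> \<Union>\<Phi> \<subseteq> E} \<noteq> {}" by blast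
  qed auto
  have Int: "c_ideal A B (D \<inter> E)" if "c_ideal A B D" "c_ideal A B E" for D E
    using c_ideal_Inter[of "{D, E}"] that by auto
  have distrib: "D \<inter> \<Inter>{E. c_ideal A B E \<and> \<Union>\<Phi> \<subseteq> E} \<subseteq> \<Inter>{E. c_ideal A B E \<and> \<Union>((\<inter>) D ` \<Phi>) \<subseteq> E}"
    (is "_ \<subseteq> ?\<sigma>") if D: "c_ideal A B D" and \<Phi>: "\<Phi> \<subseteq> ?A" for D \<Phi>
  proof -
    have "(\<inter>) D ` \<Phi> \<subseteq> ?A" using D \<Phi> Int by auto
    note \<sigma> = sup[OF this]
    let ?I = "{(a, b). a \<in> carrier A \<and> b \<in> carrier B \<and> (\<forall>(c, d)\<in>D. (a \<sqinter>\<^bsub>A\<^esub> c, b \<sqinter>\<^bsub>B\<^esub> d) \<in> ?\<sigma>)}"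
    have I: "c_ideal A B ?I"
      by (rule c_ideal_imp[OF assms c_ideal_subset[OF D] \<sigma>])
    have "F \<subseteq> ?I" if F: "F \<in> \<Phi>" for F
    proof clarify
      fix a b assume ab: "(a, b) \<in> F"
      have F': "c_ideal A B F" using F \<Phi> by auto
      have c: "a \<in> carrier A" "b \<in> carrier B" using c_ideal_subset[OF F'] ab by auto
      have "(a \<sqinter>\<^bsub>A\<^esub> x, b \<sqinter>\<^bsub>B\<^esub> y) \<in> ?\<sigma>" if xy: "(x, y) \<in> D" for x y
      proof -
        have d: "x \<in> carrier A" "y \<in> carrier B" using c_ideal_subset[OF D] xy by auto
        have "(a \<sqinter>\<^bsub>A\<^esub> x, b \<sqinter>\<^bsub>B\<^esub> y) \<in> D"
          by (rule c_ideal_down[OF D xy]) (use c d in \<open>auto intro: A.meet_right B.meet_right\<close>)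
        moreover have "(a \<sqinter>\<^bsub>A\<^esub> x, b \<sqinter>\<^bsub>B\<^esub> y) \<in> F"
          by (rule c_ideal_down[OF F' ab]) (use c d in \<open>auto intro: A.meet_left B.meet_left\<close>)
        ultimately show ?thesis using F by blast
      qed
      then show "a \<in> carrier A \<and> b \<in> carrier B \<and> (\<forall>(c, d)\<in>D. (a \<sqinter>\<^bsub>A\<^esub> c, b \<sqinter>\<^bsub>B\<^esub> d) \<in> ?\<sigma>)"
        using c by blast
    qed
    then have "\<Union>\<Phi> \<subseteq> ?I" by (rule Sup_least)
    with I have le: "\<Inter>{E. c_ideal A B E \<and> \<Union>\<Phi> \<subseteq> E} \<subseteq> ?I"
      by (intro Inter_lower CollectI conjI)
    show ?thesis
    proof
      fix z assume z: "z \<in> D \<inter> \<Inter>{E. c_ideal A B E \<and> \<Union>\<Phi> \<subseteq> E}"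
      obtain a b where ab: "z = (a, b)" by (cases z)
      \<comment> \<open>The pair lies in \<open>D\<close> itself, so the implication may be tested
        against that same pair, and idempotence of meets returns (a, b).\<close>
      have "(a, b) \<in> ?I" by (rule subsetD[OF le IntD2[OF z[unfolded ab]]])
      then have "(a \<sqinter>\<^bsub>A\<^esub> a, b \<sqinter>\<^bsub>B\<^esub> b) \<in> ?\<sigma>" "a \<in> carrier A" "b \<in> carrier B"
        using z unfolding ab by blast+
      then show "z \<in> ?\<sigma>" by (simp only: ab A.meet_idem B.meet_idem)
    qed
  qed
  have I: "frame (frame_coproduct A B) \<and>
      (\<forall>\<Phi>\<subseteq>?A. \<Squnion>\<^bsub>frame_coproduct A B\<^esub> \<Phi> = \<Inter>{E. c_ideal A B E \<and> \<Union>\<Phi> \<subseteq> E}) \<and>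
      (\<forall>D\<in>?A. \<forall>E\<in>?A. D \<sqinter>\<^bsub>frame_coproduct A B\<^esub> E = D \<inter> E)"
  proof (rule frameI)
    show "D \<inter> \<Inter>{E. c_ideal A B E \<and> \<Union>\<Phi> \<subseteq> E} \<sqsubseteq>\<^bsub>frame_coproduct A B\<^esub>
      \<Inter>{E. c_ideal A B E \<and> \<Union>((\<inter>) D ` \<Phi>) \<subseteq> E}" if "D \<in> ?A" "\<Phi> \<subseteq> ?A" for D \<Phi>
      using distrib[of D \<Phi>] that unfolding frame_coproduct_le by simp
    show "\<Inter>{E. c_ideal A B E \<and> \<Union>\<Phi> \<subseteq> E} \<in> ?A" if "\<Phi> \<subseteq> ?A" for \<Phi>
      using sup[OF that] by simp
    show "D \<inter> E \<in> ?A" if "D \<in> ?A" "E \<in> ?A" for D E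
      using that Int by simp
    show "\<Inter>{E. c_ideal A B E \<and> \<Union>\<Phi> \<subseteq> E} \<sqsubseteq>\<^bsub>frame_coproduct A B\<^esub> E"
      if "E \<in> ?A" "\<And>D. D \<in> \<Phi> \<Longrightarrow> D \<sqsubseteq>\<^bsub>frame_coproduct A B\<^esub> E" for \<Phi> E
      using that by (simp add: frame_coproduct_le Inter_lower Sup_least)
  qed (auto simp: frame_coproduct_def)
  show fr: "frame (frame_coproduct A B)" using I by blast
  show "\<Squnion>\<^bsub>frame_coproduct A B\<^esub> \<Phi> = \<Inter>{E. c_ideal A B E \<and> \<Union>\<Phi> \<subseteq> E}"
    if "\<Phi> \<subseteq> carrier (frame_coproduct A B)" for \<Phi>
    using I that by (simp add: frame_coproduct_carrier)
  show "D \<sqinter>\<^bsub>frame_coproduct A B\<^esub> E = D \<inter> E" if "c_ideal A B D" "c_ideal A B E" for D E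
    using I[THEN conjunct2, THEN conjunct2] that by simp
  show "\<top>\<^bsub>frame_coproduct A B\<^esub> = carrier A \<times> carrier B"
    by (rule frame.top_eqI[OF fr])
      (simp_all add: frame_coproduct_carrier frame_coproduct_le c_ideal_total assms c_ideal_subset)
qed

lemma frame_coproduct_sup_le_iff:
  assumes "frame A" "frame B" "\<Phi> \<subseteq> carrier (frame_coproduct A B)" "c_ideal A B E"
  shows "\<Squnion>\<^bsub>frame_coproduct A B\<^esub> \<Phi> \<subseteq> E \<longleftrightarrow> (\<forall>D\<in>\<Phi>. D \<subseteq> E)"
proof
  have "D \<subseteq> \<Squnion>\<^bsub>frame_coproduct A B\<^esub> \<Phi>" if "D \<in> \<Phi>" for D
    using that unfolding frame_coproduct_sup[OF assms(1-3)] by blast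
  then show "\<forall>D\<in>\<Phi>. D \<subseteq> E" if "\<Squnion>\<^bsub>frame_coproduct A B\<^esub> \<Phi> \<subseteq> E"
    using that by blast
  show "\<Squnion>\<^bsub>frame_coproduct A B\<^esub> \<Phi> \<subseteq> E" if "\<forall>D\<in>\<Phi>. D \<subseteq> E"
    using that assms(4) unfolding frame_coproduct_sup[OF assms(1-3)]
    by (intro Inter_lower) auto
qed

lemma c_ideal_inl:
  assumes "frame A" "frame B" "x \<in> carrier A"
  shows "c_ideal A B (coproduct_inl A B x)"
proof -
  interpret A: frame A by fact
  interpret B: frame B by fact
  have eq: "coproduct_inl A B x =
      {(a, b). a \<in> carrier A \<and> b \<in> carrier B \<and> (a \<sqsubseteq>\<^bsub>A\<^esub> x \<or> b = \<bottom>\<^bsub>B\<^esub>)}"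
    using assms(3) by (simp add: coproduct_inl_def)
  show ?thesis
    unfolding eq
  proof (rule c_idealI; clarsimp)
    fix a b a' b'
    assume *: "a \<in> carrier A" "b \<in> carrier B" "a' \<in> carrier A" "b' \<in> carrier B" "a' \<sqsubseteq>\<^bsub>A\<^esub> a"
      "b' \<sqsubseteq>\<^bsub>B\<^esub> b" "a \<sqsubseteq>\<^bsub>A\<^esub> x \<or> b = \<bottom>\<^bsub>B\<^esub>" "b' \<noteq> \<bottom>\<^bsub>B\<^esub>"
    then have "b \<noteq> \<bottom>\<^bsub>B\<^esub>" using B.le_antisym[of b' b] by auto
    then show "a' \<sqsubseteq>\<^bsub>A\<^esub> x" using * A.le_trans[of a' a x] assms(3) by simp
  next
    fix S b assume "b \<in> carrier B" "S \<subseteq> carrier A" "b \<noteq> \<bottom>\<^bsub>B\<^esub>"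
      "S \<times> {b} \<subseteq> {(a, b). a \<in> carrier A \<and> b \<in> carrier B \<and> (a \<sqsubseteq>\<^bsub>A\<^esub> x \<or> b = \<bottom>\<^bsub>B\<^esub>)}"
    then show "\<Squnion>\<^bsub>A\<^esub> S \<sqsubseteq>\<^bsub>A\<^esub> x"
      using assms(3) by (intro A.sup_least) auto
  next
    fix S a assume *: "a \<in> carrier A" "S \<subseteq> carrier B" "\<Squnion>\<^bsub>B\<^esub> S \<noteq> \<bottom>\<^bsub>B\<^esub>"
      "{a} \<times> S \<subseteq> {(a, b). a \<in> carrier A \<and> b \<in> carrier B \<and> (a \<sqsubseteq>\<^bsub>A\<^esub> x \<or> b = \<bottom>\<^bsub>B\<^esub>)}"
    show "a \<sqsubseteq>\<^bsub>A\<^esub> x"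
    \<comment> \<open>Unless a \<sqsubseteq> x, each member of \<open>S\<close> is \<bottom> by the
      second alternative, and then so is the join of \<open>S\<close>.\<close>
    proof (rule ccontr)
      assume "\<not> a \<sqsubseteq>\<^bsub>A\<^esub> x"
      then have "\<Squnion>\<^bsub>B\<^esub> S = \<bottom>\<^bsub>B\<^esub>"
        using * by (intro B.sup_eqI) auto
      then show False using * by simp
    qed
  qed
qed

lemma c_ideal_inr:
  assumes "frame A" "frame B" "y \<in> carrier B"
  shows "c_ideal A B (coproduct_inr A B y)"
proof -
  interpret A: frame A by fact
  interpret B: frame B by fact
  have eq: "coproduct_inr A B y =
      {(a, b). a \<in> carrier A \<and> b \<in> carrier B \<and> (b \<sqsubseteq>\<^bsub>B\<^esub> y \<or> a = \<bottom>\<^bsub>A\<^esub>)}"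
    using assms(3) by (simp add: coproduct_inr_def)
  show ?thesis
    unfolding eq
  proof (rule c_idealI; clarsimp)
    fix a b a' b'
    assume *: "a \<in> carrier A" "b \<in> carrier B" "a' \<in> carrier A" "b' \<in> carrier B" "a' \<sqsubseteq>\<^bsub>A\<^esub> a"
      "b' \<sqsubseteq>\<^bsub>B\<^esub> b" "b \<sqsubseteq>\<^bsub>B\<^esub> y \<or> a = \<bottom>\<^bsub>A\<^esub>" "a' \<noteq> \<bottom>\<^bsub>A\<^esub>"
    then have "a \<noteq> \<bottom>\<^bsub>A\<^esub>" using A.le_antisym[of a' a] by auto
    then show "b' \<sqsubseteq>\<^bsub>B\<^esub> y" using * B.le_trans[of b' b y] assms(3) by simp
  next
    fix S b assume *: "b \<in> carrier B" "S \<subseteq> carrier A" "\<Squnion>\<^bsub>A\<^esub> S \<noteq> \<bottom>\<^bsub>A\<^esub>"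
      "S \<times> {b} \<subseteq> {(a, b). a \<in> carrier A \<and> b \<in> carrier B \<and> (b \<sqsubseteq>\<^bsub>B\<^esub> y \<or> a = \<bottom>\<^bsub>A\<^esub>)}"
    show "b \<sqsubseteq>\<^bsub>B\<^esub> y"
    proof (rule ccontr)
      assume "\<not> b \<sqsubseteq>\<^bsub>B\<^esub> y"
      then have "\<Squnion>\<^bsub>A\<^esub> S = \<bottom>\<^bsub>A\<^esub>"
        using * by (intro A.sup_eqI) auto
      then show False using * by simp
    qed
  next
    fix S a assume "a \<in> carrier A" "S \<subseteq> carrier B" "a \<noteq> \<bottom>\<^bsub>A\<^esub>"
      "{a} \<times> S \<subseteq> {(a, b). a \<in> carrier A \<and> b \<in> carrier B \<and> (b \<sqsubseteq>\<^bsub>B\<^esub> y \<or> a = \<bottom>\<^bsub>A\<^esub>)}"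
    then show "\<Squnion>\<^bsub>B\<^esub> S \<sqsubseteq>\<^bsub>B\<^esub> y"
      using assms(3) by (intro B.sup_least) auto
  qed
qed

text \<open>\<open>coproduct_inl A B x\<close> is the least C-ideal that contains (x, \<top>): what
  it has besides the pairs below (x, \<top>) has a bottom coordinate and so belongs to every
  C-ideal.\<close>

lemma inl_subset_iff:
  assumes "frame A" "frame B" "x \<in> carrier A" "c_ideal A B E"
  shows "coproduct_inl A B x \<subseteq> E \<longleftrightarrow> (x, \<top>\<^bsub>B\<^esub>) \<in> E"
proof -
  interpret A: frame A by fact
  interpret B: frame B by fact
  have "(a, b) \<in> E" if "(x, \<top>\<^bsub>B\<^esub>) \<in> E" "a \<in> carrier A" "b \<in> carrier B" "a \<sqsubseteq>\<^bsub>A\<^esub> x \<or> b = \<bottom>\<^bsub>B\<^esub>" for a b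
    using that(4) c_ideal_down[OF assms(4) that(1-3)] c_ideal_bottom(2)[OF assms(1,2,4) that(2)] that(3)
    by auto
  moreover have "(x, \<top>\<^bsub>B\<^esub>) \<in> coproduct_inl A B x"
    using assms(3) by (simp add: coproduct_inl_def)
  ultimately show ?thesis
    using assms(3) by (auto simp: coproduct_inl_def)
qed

lemma inr_subset_iff:
  assumes "frame A" "frame B" "y \<in> carrier B" "c_ideal A B E"
  shows "coproduct_inr A B y \<subseteq> E \<longleftrightarrow> (\<top>\<^bsub>A\<^esub>, y) \<in> E"
proof -
  interpret A: frame A by fact
  interpret B: frame B by fact
  have "(a, b) \<in> E" if "(\<top>\<^bsub>A\<^esub>, y) \<in> E" "a \<in> carrier A" "b \<in> carrier B" "b \<sqsubseteq>\<^bsub>B\<^esub> y \<or> a = \<bottom>\<^bsub>A\<^esub>" for a b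
    using that(4) c_ideal_down[OF assms(4) that(1-3)] c_ideal_bottom(1)[OF assms(1,2,4) that(3)] that(2)
    by auto
  moreover have "(\<top>\<^bsub>A\<^esub>, y) \<in> coproduct_inr A B y"
    using assms(3) by (simp add: coproduct_inr_def)
  ultimately show ?thesis
    using assms(3) by (auto simp: coproduct_inr_def)
qed

text \<open>The meet of the two injected elements is the least C-ideal containing (x, y). Membership
  of a pair in a C-ideal is thus the order relation between a basic element and that
  C-ideal.\<close>

lemma inl_Int_inr_subset_iff:
  assumes "frame A" "frame B" "x \<in> carrier A" "y \<in> carrier B" "c_ideal A B E"
  shows "coproduct_inl A B x \<inter> coproduct_inr A B y \<subseteq> E \<longleftrightarrow> (x, y) \<in> E"
proof -
  interpret A: frame A by fact
  interpret B: frame B by fact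
  have "(a, b) \<in> E" if xy: "(x, y) \<in> E" and ab: "a \<in> carrier A" "b \<in> carrier B"
    and le: "a \<sqsubseteq>\<^bsub>A\<^esub> x \<or> b = \<bottom>\<^bsub>B\<^esub>" "b \<sqsubseteq>\<^bsub>B\<^esub> y \<or> a = \<bottom>\<^bsub>A\<^esub>" for a b
    using le c_ideal_down[OF assms(5) xy ab] c_ideal_bottom[OF assms(1,2,5)] ab by auto
  moreover have "(x, y) \<in> coproduct_inl A B x \<inter> coproduct_inr A B y"
    using assms(3,4) by (simp add: coproduct_inl_def coproduct_inr_def)
  ultimately show ?thesis
    using assms(3,4) by (auto simp: coproduct_inl_def coproduct_inr_def)
qed

section \<open>The injections and the universal property of the coproduct\<close>

lemma frame_map_inl:
  assumes "frame A" "frame B"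
  shows "frame_map A (frame_coproduct A B) (coproduct_inl A B)"
proof (rule frame_mapI[OF refl refl])
  interpret A: frame A by fact
  interpret B: frame B by fact
  interpret K: frame "frame_coproduct A B" using assms by (rule frame_frame_coproduct)
  note ci = c_ideal_inl[OF assms]
  show "coproduct_inl A B \<in> extensional (carrier A)"
    by (simp add: coproduct_inl_def)
  show "coproduct_inl A B a \<in> carrier (frame_coproduct A B)" if "a \<in> carrier A" for a
    using ci[OF that] by (simp add: frame_coproduct_carrier)
  show "coproduct_inl A B \<top>\<^bsub>A\<^esub> = \<top>\<^bsub>frame_coproduct A B\<^esub>"
    by (auto simp: frame_coproduct_top[OF assms] coproduct_inl_def)
  show "coproduct_inl A B (a \<sqinter>\<^bsub>A\<^esub> b) = coproduct_inl A B a \<sqinter>\<^bsub>frame_coproduct A B\<^esub> coproduct_inl A B b"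
    if "a \<in> carrier A" "b \<in> carrier A" for a b
  proof -
    have "coproduct_inl A B (a \<sqinter>\<^bsub>A\<^esub> b) = coproduct_inl A B a \<inter> coproduct_inl A B b"
      using that by (auto simp: coproduct_inl_def A.le_meet_iff)
    then show ?thesis
      using that by (simp add: frame_coproduct_meet[OF assms] ci)
  qed
  show "coproduct_inl A B (\<Squnion>\<^bsub>A\<^esub> S) = \<Squnion>\<^bsub>frame_coproduct A B\<^esub> (coproduct_inl A B ` S)"
    if S: "S \<subseteq> carrier A" for S
  proof
    have sub: "coproduct_inl A B ` S \<subseteq> carrier (frame_coproduct A B)"
      using ci S by (auto simp: frame_coproduct_carrier)
    then have sup: "c_ideal A B (\<Squnion>\<^bsub>frame_coproduct A B\<^esub> (coproduct_inl A B ` S))" (is "c_ideal A B ?s")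
      using K.sup_closed by (auto simp: frame_coproduct_carrier)
    have "(s, \<top>\<^bsub>B\<^esub>) \<in> ?s" if "s \<in> S" for s
      using frame_coproduct_sup_le_iff[OF assms sub sup] that
        inl_subset_iff[OF assms subsetD[OF S that] sup] by simp
    \<comment> \<open>Joins of first coordinates may be taken over the fixed second coordinate
      \<top>, which turns the pairs that generate the images of the members of \<open>S\<close> into
      the one that generates the image of \<Squnion>S.\<close>
    then have "S \<times> {\<top>\<^bsub>B\<^esub>} \<subseteq> ?s" by auto
    then have "(\<Squnion>\<^bsub>A\<^esub> S, \<top>\<^bsub>B\<^esub>) \<in> ?s"
      using S by (intro c_ideal_sup_left[OF sup]) auto
    then show "coproduct_inl A B (\<Squnion>\<^bsub>A\<^esub> S) \<subseteq> ?s"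
      using S by (simp add: inl_subset_iff[OF assms _ sup])
    have "coproduct_inl A B s \<subseteq> coproduct_inl A B (\<Squnion>\<^bsub>A\<^esub> S)" if "s \<in> S" for s
    proof -
      have "s \<in> carrier A" using that S by blast
      then show ?thesis
        using S that A.sup_upper[OF S that]
        by (simp add: inl_subset_iff[OF assms _ ci]) (simp add: coproduct_inl_def)
    qed
    then show "?s \<subseteq> coproduct_inl A B (\<Squnion>\<^bsub>A\<^esub> S)"
      unfolding frame_coproduct_sup_le_iff[OF assms sub ci[OF A.sup_closed[OF S]]] by blast
  qed
qed

lemma frame_map_inr:
  assumes "frame A" "frame B"
  shows "frame_map B (frame_coproduct A B) (coproduct_inr A B)"
proof (rule frame_mapI[OF refl refl])
  interpret A: frame A by fact
  interpret B: frame B by fact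
  interpret K: frame "frame_coproduct A B" using assms by (rule frame_frame_coproduct)
  note ci = c_ideal_inr[OF assms]
  show "coproduct_inr A B \<in> extensional (carrier B)"
    by (simp add: coproduct_inr_def)
  show "coproduct_inr A B a \<in> carrier (frame_coproduct A B)" if "a \<in> carrier B" for a
    using ci[OF that] by (simp add: frame_coproduct_carrier)
  show "coproduct_inr A B \<top>\<^bsub>B\<^esub> = \<top>\<^bsub>frame_coproduct A B\<^esub>"
    by (auto simp: frame_coproduct_top[OF assms] coproduct_inr_def)
  show "coproduct_inr A B (a \<sqinter>\<^bsub>B\<^esub> b) = coproduct_inr A B a \<sqinter>\<^bsub>frame_coproduct A B\<^esub> coproduct_inr A B b"
    if "a \<in> carrier B" "b \<in> carrier B" for a b
  proof -
    have "coproduct_inr A B (a \<sqinter>\<^bsub>B\<^esub> b) = coproduct_inr A B a \<inter> coproduct_inr A B b"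
      using that by (auto simp: coproduct_inr_def B.le_meet_iff)
    then show ?thesis
      using that by (simp add: frame_coproduct_meet[OF assms] ci)
  qed
  show "coproduct_inr A B (\<Squnion>\<^bsub>B\<^esub> S) = \<Squnion>\<^bsub>frame_coproduct A B\<^esub> (coproduct_inr A B ` S)"
    if S: "S \<subseteq> carrier B" for S
  proof
    have sub: "coproduct_inr A B ` S \<subseteq> carrier (frame_coproduct A B)"
      using ci S by (auto simp: frame_coproduct_carrier)
    then have sup: "c_ideal A B (\<Squnion>\<^bsub>frame_coproduct A B\<^esub> (coproduct_inr A B ` S))" (is "c_ideal A B ?s")
      using K.sup_closed by (auto simp: frame_coproduct_carrier)
    have "(\<top>\<^bsub>A\<^esub>, s) \<in> ?s" if "s \<in> S" for s
      using frame_coproduct_sup_le_iff[OF assms sub sup] that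
        inr_subset_iff[OF assms subsetD[OF S that] sup] by simp
    then have "{\<top>\<^bsub>A\<^esub>} \<times> S \<subseteq> ?s" by auto
    then have "(\<top>\<^bsub>A\<^esub>, \<Squnion>\<^bsub>B\<^esub> S) \<in> ?s"
      using S by (intro c_ideal_sup_right[OF sup]) auto
    then show "coproduct_inr A B (\<Squnion>\<^bsub>B\<^esub> S) \<subseteq> ?s"
      using S by (simp add: inr_subset_iff[OF assms _ sup])
    have "coproduct_inr A B s \<subseteq> coproduct_inr A B (\<Squnion>\<^bsub>B\<^esub> S)" if "s \<in> S" for s
    proof -
      have "s \<in> carrier B" using that S by blast
      then show ?thesis
        using S that B.sup_upper[OF S that]
        by (simp add: inr_subset_iff[OF assms _ ci]) (simp add: coproduct_inr_def)
    qed
    then show "?s \<subseteq> coproduct_inr A B (\<Squnion>\<^bsub>B\<^esub> S)"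
      unfolding frame_coproduct_sup_le_iff[OF assms sub ci[OF B.sup_closed[OF S]]] by blast
  qed
qed

text \<open>Both sides lie below the same C-ideals \<open>E\<close>: such an \<open>E\<close>
  contains the basic element of (a, b) exactly when (a, b) belongs to it.\<close>

lemma frame_coproduct_elem_eq_sup:
  assumes "frame A" "frame B" "c_ideal A B D"
  shows "D = \<Squnion>\<^bsub>frame_coproduct A B\<^esub>
    ((\<lambda>(a, b). coproduct_inl A B a \<sqinter>\<^bsub>frame_coproduct A B\<^esub> coproduct_inr A B b) ` D)"
    (is "D = \<Squnion>\<^bsub>?K\<^esub> ?P")
proof -
  interpret K: frame ?K using assms(1,2) by (rule frame_frame_coproduct)
  note cl = c_ideal_inl[OF assms(1,2)] and cr = c_ideal_inr[OF assms(1,2)]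
  have c: "a \<in> carrier A" "b \<in> carrier B" if "(a, b) \<in> D" for a b
    using that c_ideal_subset[OF assms(3)] by auto
  have meet: "coproduct_inl A B a \<sqinter>\<^bsub>?K\<^esub> coproduct_inr A B b = coproduct_inl A B a \<inter> coproduct_inr A B b"
    if "(a, b) \<in> D" for a b
    using c[OF that] cl cr by (simp add: frame_coproduct_meet[OF assms(1,2)])
  have P: "?P \<subseteq> carrier ?K"
    using c cl cr by (auto simp: frame_coproduct_carrier intro!: K.meet_closed[unfolded frame_coproduct_carrier mem_Collect_eq])
  then have s: "c_ideal A B (\<Squnion>\<^bsub>?K\<^esub> ?P)"
    using K.sup_closed by (auto simp: frame_coproduct_carrier)
  have E: "(\<forall>z\<in>?P. z \<subseteq> E) \<longleftrightarrow> D \<subseteq> E" if "c_ideal A B E" for E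
  proof -
    have "coproduct_inl A B a \<sqinter>\<^bsub>?K\<^esub> coproduct_inr A B b \<subseteq> E \<longleftrightarrow> (a, b) \<in> E" if ab: "(a, b) \<in> D" for a b
      using inl_Int_inr_subset_iff[OF assms(1,2) c[OF ab] \<open>c_ideal A B E\<close>] by (simp add: meet[OF ab])
    then show ?thesis by auto
  qed
  show ?thesis
    using E[OF s] E[OF assms(3)] frame_coproduct_sup_le_iff[OF assms(1,2) P s]
      frame_coproduct_sup_le_iff[OF assms(1,2) P assms(3)] by auto
qed

lemma frame_map_coproduct_eqI:
  assumes "frame A" "frame B" "frame_map (frame_coproduct A B) M f" "frame_map (frame_coproduct A B) M g"
    and inl: "\<And>a. a \<in> carrier A \<Longrightarrow> f (coproduct_inl A B a) = g (coproduct_inl A B a)"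
    and inr: "\<And>b. b \<in> carrier B \<Longrightarrow> f (coproduct_inr A B b) = g (coproduct_inr A B b)"
  shows "f = g"
proof (rule extensionalityI)
  let ?K = "frame_coproduct A B"
  interpret K: frame ?K using assms(1,2) by (rule frame_frame_coproduct)
  note cl = frame_map_closed[OF frame_map_inl[OF assms(1,2)]]
    and cr = frame_map_closed[OF frame_map_inr[OF assms(1,2)]]
  show "f D = g D" if D: "D \<in> carrier ?K" for D
  proof -
    let ?h = "\<lambda>(a, b). coproduct_inl A B a \<sqinter>\<^bsub>?K\<^esub> coproduct_inr A B b"
    have D': "c_ideal A B D" using D by (simp add: frame_coproduct_carrier)
    have c: "a \<in> carrier A" "b \<in> carrier B" if "(a, b) \<in> D" for a b
      using that c_ideal_subset[OF D'] by auto
    have sub: "?h ` D \<subseteq> carrier ?K" using c cl cr by auto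
    have "f ` ?h ` D = g ` ?h ` D"
      unfolding image_image using c cl cr
      by (intro image_cong) (auto simp: frame_map_meet[OF assms(3)] frame_map_meet[OF assms(4)] inl inr)
    then have "f (\<Squnion>\<^bsub>?K\<^esub> (?h ` D)) = g (\<Squnion>\<^bsub>?K\<^esub> (?h ` D))"
      using frame_map_sup[OF assms(3) sub] frame_map_sup[OF assms(4) sub] by simp
    then show ?thesis
      using frame_coproduct_elem_eq_sup[OF assms(1,2) D'] by simp
  qed
qed (use assms(3,4) in \<open>auto intro: frame_map_extensional\<close>)

text \<open>The sets {(a, b). f a \<sqinter> g b \<sqsubseteq> m} are C-ideals (\<open>adj\<close>),
  so m |-> {(a, b). f a \<sqinter> g b \<sqsubseteq> m} is right adjoint to \<open>q\<close>; this
  gives preservation of joins. For binary meets, the product of two joins is expanded and the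
  factors are regrouped: (a \<sqinter> a', b \<sqinter> b') lies in both C-ideals because they are
  down-sets.\<close>

lemma copairing:
  assumes "frame A" "frame B" "frame M" "frame_map A M f" "frame_map B M g"
  shows frame_map_copairing: "frame_map (frame_coproduct A B) M (copairing A B M f g)"
    and copairing_inl: "\<And>a. a \<in> carrier A \<Longrightarrow> copairing A B M f g (coproduct_inl A B a) = f a"
    and copairing_inr: "\<And>b. b \<in> carrier B \<Longrightarrow> copairing A B M f g (coproduct_inr A B b) = g b"
proof -
  interpret A: frame A by fact
  interpret B: frame B by fact
  interpret M: frame M by fact
  let ?K = "frame_coproduct A B"
  interpret K: frame ?K using assms(1,2) by (rule frame_frame_coproduct)
  note f = frame_mapD[OF assms(4)] and g = frame_mapD[OF assms(5)]
  note fmono = frame_map_mono[OF assms(1,3,4)] and gmono = frame_map_mono[OF assms(2,3,5)]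
  let ?m = "\<lambda>(a, b). f a \<sqinter>\<^bsub>M\<^esub> g b"
  define q where "q D = \<Squnion>\<^bsub>M\<^esub> (?m ` D)" for D
  have q: "copairing A B M f g = (\<lambda>D\<in>carrier ?K. q D)"
    by (simp add: copairing_def q_def)
  have c: "a \<in> carrier A" "b \<in> carrier B" if "c_ideal A B D" "(a, b) \<in> D" for D a b
    using that c_ideal_subset by fastforce+
  have mc: "?m ` D \<subseteq> carrier M" if "c_ideal A B D" for D
    using c[OF that] f(1) g(1) by auto
  have q_closed: "q D \<in> carrier M" if "c_ideal A B D" for D
    unfolding q_def using mc[OF that] by simp
  have q_le_iff: "q D \<sqsubseteq>\<^bsub>M\<^esub> m \<longleftrightarrow> (\<forall>(a, b)\<in>D. f a \<sqinter>\<^bsub>M\<^esub> g b \<sqsubseteq>\<^bsub>M\<^esub> m)"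
    if D: "c_ideal A B D" and m: "m \<in> carrier M" for D m
  proof
    assume *: "q D \<sqsubseteq>\<^bsub>M\<^esub> m"
    have "x \<sqsubseteq>\<^bsub>M\<^esub> m" if "x \<in> ?m ` D" for x
    proof -
      have "x \<sqsubseteq>\<^bsub>M\<^esub> q D" unfolding q_def by (rule M.sup_upper[OF mc[OF D] that])
      then show ?thesis
        using M.le_trans[OF _ *] that mc[OF D] q_closed[OF D] m by blast
    qed
    then show "\<forall>(a, b)\<in>D. f a \<sqinter>\<^bsub>M\<^esub> g b \<sqsubseteq>\<^bsub>M\<^esub> m" by auto
  next
    assume "\<forall>(a, b)\<in>D. f a \<sqinter>\<^bsub>M\<^esub> g b \<sqsubseteq>\<^bsub>M\<^esub> m"
    then show "q D \<sqsubseteq>\<^bsub>M\<^esub> m"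
      unfolding q_def by (intro M.sup_least mc[OF D] m) auto
  qed
  have adj: "c_ideal A B {(a, b). a \<in> carrier A \<and> b \<in> carrier B \<and> f a \<sqinter>\<^bsub>M\<^esub> g b \<sqsubseteq>\<^bsub>M\<^esub> m}"
    if m: "m \<in> carrier M" for m
  proof (rule c_idealI; clarsimp)
    fix a b a' b' assume "a \<in> carrier A" "b \<in> carrier B" "a' \<in> carrier A" "b' \<in> carrier B"
      "a' \<sqsubseteq>\<^bsub>A\<^esub> a" "b' \<sqsubseteq>\<^bsub>B\<^esub> b" and le: "f a \<sqinter>\<^bsub>M\<^esub> g b \<sqsubseteq>\<^bsub>M\<^esub> m"
    then show "f a' \<sqinter>\<^bsub>M\<^esub> g b' \<sqsubseteq>\<^bsub>M\<^esub> m"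
      using m f(1) g(1)
      by (intro M.le_trans[OF M.meet_mono[OF fmono gmono] le]) simp_all
  next
    fix S b assume *: "b \<in> carrier B" "S \<subseteq> carrier A"
      "S \<times> {b} \<subseteq> {(a, b). a \<in> carrier A \<and> b \<in> carrier B \<and> f a \<sqinter>\<^bsub>M\<^esub> g b \<sqsubseteq>\<^bsub>M\<^esub> m}"
    have "f ` S \<subseteq> carrier M" using * f(1) by auto
    then have "f (\<Squnion>\<^bsub>A\<^esub> S) \<sqinter>\<^bsub>M\<^esub> g b = \<Squnion>\<^bsub>M\<^esub> ((\<lambda>x. x \<sqinter>\<^bsub>M\<^esub> g b) ` f ` S)"
      using * g(1) by (simp add: f(4) M.sup_meet_distrib)
    also have "\<dots> \<sqsubseteq>\<^bsub>M\<^esub> m"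
      using * \<open>f ` S \<subseteq> carrier M\<close> g(1) m by (intro M.sup_least) auto
    finally show "f (\<Squnion>\<^bsub>A\<^esub> S) \<sqinter>\<^bsub>M\<^esub> g b \<sqsubseteq>\<^bsub>M\<^esub> m" .
  next
    fix S a assume *: "a \<in> carrier A" "S \<subseteq> carrier B"
      "{a} \<times> S \<subseteq> {(a, b). a \<in> carrier A \<and> b \<in> carrier B \<and> f a \<sqinter>\<^bsub>M\<^esub> g b \<sqsubseteq>\<^bsub>M\<^esub> m}"
    have "g ` S \<subseteq> carrier M" using * g(1) by auto
    then have "f a \<sqinter>\<^bsub>M\<^esub> g (\<Squnion>\<^bsub>B\<^esub> S) = \<Squnion>\<^bsub>M\<^esub> ((\<lambda>x. f a \<sqinter>\<^bsub>M\<^esub> x) ` g ` S)"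
      using * f(1) by (simp add: g(4) M.meet_sup_distrib)
    also have "\<dots> \<sqsubseteq>\<^bsub>M\<^esub> m"
      using * \<open>g ` S \<subseteq> carrier M\<close> f(1) m by (intro M.sup_least) auto
    finally show "f a \<sqinter>\<^bsub>M\<^esub> g (\<Squnion>\<^bsub>B\<^esub> S) \<sqsubseteq>\<^bsub>M\<^esub> m" .
  qed
  have q_le_iff': "q D \<sqsubseteq>\<^bsub>M\<^esub> m \<longleftrightarrow> D \<subseteq> {(a, b). a \<in> carrier A \<and> b \<in> carrier B \<and> f a \<sqinter>\<^bsub>M\<^esub> g b \<sqsubseteq>\<^bsub>M\<^esub> m}"
    if D: "c_ideal A B D" and m: "m \<in> carrier M" for D m
    unfolding q_le_iff[OF that] using c[OF D] by auto
  have q_ge: "f a \<sqinter>\<^bsub>M\<^esub> g b \<sqsubseteq>\<^bsub>M\<^esub> q D" if "c_ideal A B D" "(a, b) \<in> D" for a b D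
    unfolding q_def by (rule M.sup_upper[OF mc[OF that(1)]]) (use that(2) in auto)
  have q_mono: "q D \<sqsubseteq>\<^bsub>M\<^esub> q E" if "c_ideal A B D" "c_ideal A B E" "D \<subseteq> E" for D E
    using that q_ge[OF that(2)] by (auto simp: q_le_iff[OF that(1) q_closed[OF that(2)]])
  have q_inl: "q (coproduct_inl A B a) = f a" if a: "a \<in> carrier A" for a
  proof (rule M.le_antisym)
    show "q (coproduct_inl A B a) \<sqsubseteq>\<^bsub>M\<^esub> f a"
      unfolding q_le_iff'[OF c_ideal_inl[OF assms(1,2) a] f(1)[OF a]] inl_subset_iff[OF assms(1,2) a adj[OF f(1)[OF a]]]
      using a f(1) by (simp add: g(2) M.meet_top_right)
    have "(a, \<top>\<^bsub>B\<^esub>) \<in> coproduct_inl A B a" using a by (simp add: coproduct_inl_def)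
    from q_ge[OF c_ideal_inl[OF assms(1,2) a] this] show "f a \<sqsubseteq>\<^bsub>M\<^esub> q (coproduct_inl A B a)"
      using a f(1) by (simp add: g(2) M.meet_top_right)
  qed (use a f(1) q_closed c_ideal_inl[OF assms(1,2)] in auto)
  have q_inr: "q (coproduct_inr A B b) = g b" if b: "b \<in> carrier B" for b
  proof (rule M.le_antisym)
    show "q (coproduct_inr A B b) \<sqsubseteq>\<^bsub>M\<^esub> g b"
      unfolding q_le_iff'[OF c_ideal_inr[OF assms(1,2) b] g(1)[OF b]] inr_subset_iff[OF assms(1,2) b adj[OF g(1)[OF b]]]
      using b g(1) by (simp add: f(2) M.meet_top_left)
    have "(\<top>\<^bsub>A\<^esub>, b) \<in> coproduct_inr A B b" using b by (simp add: coproduct_inr_def)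
    from q_ge[OF c_ideal_inr[OF assms(1,2) b] this] show "g b \<sqsubseteq>\<^bsub>M\<^esub> q (coproduct_inr A B b)"
      using b g(1) by (simp add: f(2) M.meet_top_left)
  qed (use b g(1) q_closed c_ideal_inr[OF assms(1,2)] in auto)
  show "copairing A B M f g (coproduct_inl A B a) = f a" if "a \<in> carrier A" for a
    using that q_inl c_ideal_inl[OF assms(1,2)] by (simp add: q frame_coproduct_carrier)
  show "copairing A B M f g (coproduct_inr A B b) = g b" if "b \<in> carrier B" for b
    using that q_inr c_ideal_inr[OF assms(1,2)] by (simp add: q frame_coproduct_carrier)
  show "frame_map ?K M (copairing A B M f g)"
    unfolding q
  proof (rule frame_mapI[of _ "Collect (c_ideal A B)", OF frame_coproduct_carrier refl])
    have "\<top>\<^bsub>?K\<^esub> = coproduct_inl A B \<top>\<^bsub>A\<^esub>"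
      using frame_map_top[OF frame_map_inl[OF assms(1,2)]] by simp
    then show "restrict q (carrier ?K) \<top>\<^bsub>?K\<^esub> = \<top>\<^bsub>M\<^esub>"
      using q_inl[OF A.top_closed] f(2) K.top_closed by simp
  next
    fix D E assume "D \<in> Collect (c_ideal A B)" "E \<in> Collect (c_ideal A B)"
    then have D: "c_ideal A B D" and E: "c_ideal A B E" by auto
    have DE: "c_ideal A B (D \<inter> E)"
      using K.meet_closed[of D E] D E by (simp add: frame_coproduct_carrier frame_coproduct_meet[OF assms(1,2)])
    have "q (D \<inter> E) = q D \<sqinter>\<^bsub>M\<^esub> q E"
    proof (rule M.le_antisym)
      show "q (D \<inter> E) \<sqsubseteq>\<^bsub>M\<^esub> q D \<sqinter>\<^bsub>M\<^esub> q E"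
        using D E DE q_closed by (intro M.meet_le q_mono) auto
      have "q D \<sqinter>\<^bsub>M\<^esub> q E = \<Squnion>\<^bsub>M\<^esub> ((\<lambda>(x, y). x \<sqinter>\<^bsub>M\<^esub> y) ` (?m ` D \<times> ?m ` E))"
        unfolding q_def by (rule M.meet_sup_sup[OF mc[OF D] mc[OF E]])
      also have "\<dots> \<sqsubseteq>\<^bsub>M\<^esub> q (D \<inter> E)"
      proof (rule M.sup_least)
        fix x assume "x \<in> (\<lambda>(x, y). x \<sqinter>\<^bsub>M\<^esub> y) ` (?m ` D \<times> ?m ` E)"
        then obtain a b a' b' where ab: "(a, b) \<in> D" "(a', b') \<in> E"
          "x = (f a \<sqinter>\<^bsub>M\<^esub> g b) \<sqinter>\<^bsub>M\<^esub> (f a' \<sqinter>\<^bsub>M\<^esub> g b')" by auto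
        note cc = c[OF D ab(1)] c[OF E ab(2)]
        have "x = (f a \<sqinter>\<^bsub>M\<^esub> f a') \<sqinter>\<^bsub>M\<^esub> (g b \<sqinter>\<^bsub>M\<^esub> g b')"
          unfolding ab(3) using cc f(1) g(1)
          by (simp add: M.meet_assoc M.meet_left_comm[of "g b" "f a'" "g b'"])
        then have "x = f (a \<sqinter>\<^bsub>A\<^esub> a') \<sqinter>\<^bsub>M\<^esub> g (b \<sqinter>\<^bsub>B\<^esub> b')"
          using cc by (simp add: f(3) g(3))
        moreover have "(a \<sqinter>\<^bsub>A\<^esub> a', b \<sqinter>\<^bsub>B\<^esub> b') \<in> D"
          by (rule c_ideal_down[OF D ab(1)]) (use cc in \<open>auto intro: A.meet_left B.meet_left\<close>)
        moreover have "(a \<sqinter>\<^bsub>A\<^esub> a', b \<sqinter>\<^bsub>B\<^esub> b') \<in> E"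
          by (rule c_ideal_down[OF E ab(2)]) (use cc in \<open>auto intro: A.meet_right B.meet_right\<close>)
        ultimately show "x \<sqsubseteq>\<^bsub>M\<^esub> q (D \<inter> E)"
          using q_ge[OF DE] by simp
      next
        show "(\<lambda>(x, y). x \<sqinter>\<^bsub>M\<^esub> y) ` (?m ` D \<times> ?m ` E) \<subseteq> carrier M"
          using c[OF D] c[OF E] by (auto intro!: M.meet_closed f(1) g(1))
      qed (rule q_closed[OF DE])
      finally show "q D \<sqinter>\<^bsub>M\<^esub> q E \<sqsubseteq>\<^bsub>M\<^esub> q (D \<inter> E)" .
    qed (use D E DE q_closed in auto)
    then show "restrict q (carrier ?K) (D \<sqinter>\<^bsub>?K\<^esub> E) = restrict q (carrier ?K) D \<sqinter>\<^bsub>M\<^esub> restrict q (carrier ?K) E"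
      using D E DE by (simp add: frame_coproduct_meet[OF assms(1,2)] frame_coproduct_carrier)
  next
    fix \<Phi> assume "\<Phi> \<subseteq> Collect (c_ideal A B)"
    then have \<Phi>: "\<Phi> \<subseteq> carrier ?K" by (simp add: frame_coproduct_carrier)
    have ci: "c_ideal A B D" if "D \<in> \<Phi>" for D
      using that \<Phi> by (auto simp: frame_coproduct_carrier)
    have s: "c_ideal A B (\<Squnion>\<^bsub>?K\<^esub> \<Phi>)"
      using K.sup_closed[OF \<Phi>] by (simp add: frame_coproduct_carrier)
    have le: "D \<subseteq> \<Squnion>\<^bsub>?K\<^esub> \<Phi>" if "D \<in> \<Phi>" for D
      using frame_coproduct_sup_le_iff[OF assms(1,2) \<Phi> s] that by blast
    have "\<Squnion>\<^bsub>M\<^esub> (q ` \<Phi>) = q (\<Squnion>\<^bsub>?K\<^esub> \<Phi>)"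
    proof (rule M.sup_eqI)
      fix z assume z: "z \<in> carrier M" "\<And>x. x \<in> q ` \<Phi> \<Longrightarrow> x \<sqsubseteq>\<^bsub>M\<^esub> z"
      then have "q D \<sqsubseteq>\<^bsub>M\<^esub> z" if "D \<in> \<Phi>" for D using that by blast
      then show "q (\<Squnion>\<^bsub>?K\<^esub> \<Phi>) \<sqsubseteq>\<^bsub>M\<^esub> z"
        unfolding q_le_iff'[OF s z(1)] frame_coproduct_sup_le_iff[OF assms(1,2) \<Phi> adj[OF z(1)]]
        using q_le_iff'[OF ci z(1)] by blast
    qed (use ci s le q_closed in \<open>auto intro: q_mono\<close>)
    moreover have "restrict q (carrier ?K) ` \<Phi> = q ` \<Phi>"
      using \<Phi> by (intro image_cong) auto
    ultimately show "restrict q (carrier ?K) (\<Squnion>\<^bsub>?K\<^esub> \<Phi>) = \<Squnion>\<^bsub>M\<^esub> (restrict q (carrier ?K) ` \<Phi>)"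
      using K.sup_closed[OF \<Phi>] by simp
  qed (auto simp: frame_coproduct_carrier q_closed)
qed

section \<open>Extending frame maps to congruences\<close>

text \<open>
  \<open>represents L M g \<theta> m\<close> says that the congruence on \<open>M\<close> generated by the image of \<open>\<theta>\<close> under \<open>g\<close>
  is \<open>\<nabla>(m)\<close>.  The congruences \<open>\<theta>\<close> for which such an \<open>m\<close> exists form a subframe, on which
  \<open>\<theta> \<mapsto> m\<close> is the frame map extending \<open>g\<close> along \<open>\<nabla>\<close>.
\<close>

definition represents :: "'a gorder \<Rightarrow> 'b gorder \<Rightarrow> ('a \<Rightarrow> 'b) \<Rightarrow> ('a \<times> 'a) set \<Rightarrow> 'b \<Rightarrow> bool" where
  "represents L M g \<theta> m \<longleftrightarrow> frame_congruence L \<theta> \<and> m \<in> carrier M \<and>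
    (\<forall>(a, b)\<in>\<theta>. (g a, g b) \<in> nabla M m) \<and>
    (\<forall>\<psi>. frame_congruence M \<psi> \<and> (\<forall>(a, b)\<in>\<theta>. (g a, g b) \<in> \<psi>) \<longrightarrow> (\<bottom>\<^bsub>M\<^esub>, m) \<in> \<psi>)"

lemma representsI:
  assumes "frame_congruence L \<theta>" "m \<in> carrier M"
    and "\<And>a b. (a, b) \<in> \<theta> \<Longrightarrow> (g a, g b) \<in> nabla M m"
    and "\<And>\<psi>. \<lbrakk>frame_congruence M \<psi>; \<And>a b. (a, b) \<in> \<theta> \<Longrightarrow> (g a, g b) \<in> \<psi>\<rbrakk> \<Longrightarrow> (\<bottom>\<^bsub>M\<^esub>, m) \<in> \<psi>"
  shows "represents L M g \<theta> m"
  unfolding represents_def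
proof (intro conjI allI impI)
  show "(\<bottom>\<^bsub>M\<^esub>, m) \<in> \<psi>" if "frame_congruence M \<psi> \<and> (\<forall>(a, b)\<in>\<theta>. (g a, g b) \<in> \<psi>)" for \<psi>
    using that by (intro assms(4)) auto
qed (use assms(1-3) in auto)

lemma representsD:
  assumes "represents L M g \<theta> m"
  shows "frame_congruence L \<theta>" "m \<in> carrier M" "\<And>a b. (a, b) \<in> \<theta> \<Longrightarrow> (g a, g b) \<in> nabla M m"
    "\<And>\<psi>. \<lbrakk>frame_congruence M \<psi>; \<And>a b. (a, b) \<in> \<theta> \<Longrightarrow> (g a, g b) \<in> \<psi>\<rbrakk> \<Longrightarrow> (\<bottom>\<^bsub>M\<^esub>, m) \<in> \<psi>"
  using assms unfolding represents_def by auto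

text \<open>\<open>nabla M m'\<close> is itself a congruence containing the image of \<theta>, so it
  contains (\<bottom>, m) and hence \<nabla>(m); \<nabla> reflects the order, and the argument is
  symmetric.\<close>

lemma represents_unique:
  assumes "frame M" "represents L M g \<theta> m" "represents L M g \<theta> m'"
  shows "m = m'"
proof -
  interpret M: frame M by fact
  have "m \<sqsubseteq>\<^bsub>M\<^esub> m'" if "represents L M g \<theta> m" "represents L M g \<theta> m'" for m m'
    using representsD[OF that(1)] representsD(2,3)[OF that(2)] congruence_nabla[OF assms(1)]
    by (simp add: nabla_mono_iff[OF assms(1), symmetric] nabla_subset_iff[OF assms(1)])
  then show ?thesis
    using assms(2,3) by (intro M.le_antisym) (auto dest: representsD)
qed

lemma represents_top:
  assumes "frame L" "frame M" "frame_map L M g"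
  shows "represents L M g \<top>\<^bsub>congruence_frame L\<^esub> \<top>\<^bsub>M\<^esub>"
proof (rule representsI)
  interpret L: frame L by fact
  interpret M: frame M by fact
  note g = frame_mapD[OF assms(3)] and gbot = frame_map_bottom[OF assms]
  show "frame_congruence L \<top>\<^bsub>congruence_frame L\<^esub>"
    by (simp add: congruence_frame_top congruence_total assms)
  have "nabla M \<top>\<^bsub>M\<^esub> = carrier M \<times> carrier M"
    by (rule congruence_eq_totalI[OF assms(2) congruence_nabla bottom_in_nabla]) (simp_all add: assms)
  then show "(g a, g b) \<in> nabla M \<top>\<^bsub>M\<^esub>" if "(a, b) \<in> \<top>\<^bsub>congruence_frame L\<^esub>" for a b
    using that g(1) by (simp add: congruence_frame_top assms)
  show "(\<bottom>\<^bsub>M\<^esub>, \<top>\<^bsub>M\<^esub>) \<in> \<psi>" if "\<And>a b. (a, b) \<in> \<top>\<^bsub>congruence_frame L\<^esub> \<Longrightarrow> (g a, g b) \<in> \<psi>" for \<psi>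
    using that[of "\<bottom>\<^bsub>L\<^esub>" "\<top>\<^bsub>L\<^esub>"] by (simp add: congruence_frame_top assms g(2) gbot)
  show "\<top>\<^bsub>M\<^esub> \<in> carrier M" by simp
qed

text \<open>
  For \<open>(a, b) \<in> \<theta>\<close> with \<open>a \<le> b\<close>, the pairs \<open>(u, v)\<close> with
  \<open>((u \<squnion> g a) \<sqinter> g b, (v \<squnion> g a) \<sqinter> g b) \<in> \<psi>\<close> form a congruence containing the image of \<open>\<phi>\<close>, because
  \<open>x \<mapsto> (x \<squnion> a) \<sqinter> b\<close> maps \<open>\<phi>\<close> into \<open>\<theta> \<inter> \<phi>\<close>.
\<close>

lemma represents_meet:
  assumes "frame L" "frame M" "frame_map L M g"
    and \<theta>: "represents L M g \<theta> m" and \<phi>: "represents L M g \<phi> n"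
  shows "represents L M g (\<theta> \<sqinter>\<^bsub>congruence_frame L\<^esub> \<phi>) (m \<sqinter>\<^bsub>M\<^esub> n)"
proof (rule representsI)
  interpret L: frame L by fact
  interpret M: frame M by fact
  note g = frame_mapD[OF assms(3)]
  note gj = frame_map_join[OF assms(3)]
  note T = representsD[OF \<theta>] and P = representsD[OF \<phi>]
  note TC = frame_congruenceD[OF T(1)] and PC = frame_congruenceD[OF P(1)]
  have meet: "\<theta> \<sqinter>\<^bsub>congruence_frame L\<^esub> \<phi> = \<theta> \<inter> \<phi>"
    using T(1) P(1) by (simp add: congruence_frame_meet assms(1))
  show "frame_congruence L (\<theta> \<sqinter>\<^bsub>congruence_frame L\<^esub> \<phi>)"
    using T(1) P(1) by (simp add: meet congruence_Int assms(1))
  show "(g a, g b) \<in> nabla M (m \<sqinter>\<^bsub>M\<^esub> n)" if "(a, b) \<in> \<theta> \<sqinter>\<^bsub>congruence_frame L\<^esub> \<phi>" for a b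
  proof -
    have "(g a, g b) \<in> nabla M m" "(g a, g b) \<in> nabla M n"
      using that T(3) P(3) by (auto simp: meet)
    then show ?thesis
      using T(2) P(2) M.join_meet_distrib[of m n "g a"] M.join_meet_distrib[of m n "g b"]
      by (simp add: nabla_def join_comm[of M _ m] join_comm[of M _ n] join_comm[of M _ "m \<sqinter>\<^bsub>M\<^esub> n"])
  qed
  show "(\<bottom>\<^bsub>M\<^esub>, m \<sqinter>\<^bsub>M\<^esub> n) \<in> \<psi>" if \<psi>: "frame_congruence M \<psi>"
    and sub: "\<And>a b. (a, b) \<in> \<theta> \<sqinter>\<^bsub>congruence_frame L\<^esub> \<phi> \<Longrightarrow> (g a, g b) \<in> \<psi>" for \<psi>
  proof -
    note X = frame_congruenceD[OF \<psi>]
    \<comment> \<open>Here the pair from \<theta> is fixed and \<phi> varies. As \<open>n\<close>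
      represents \<phi>, the congruence ?\<chi> contains (\<bottom>, n), that is, \<psi> relates g a
      to (n \<squnion> g a) \<sqinter> g b; meeting with \<open>n\<close> gives the claim.\<close>
    have le: "(g a \<sqinter>\<^bsub>M\<^esub> n, g b \<sqinter>\<^bsub>M\<^esub> n) \<in> \<psi>" if ab: "(a, b) \<in> \<theta>" "a \<sqsubseteq>\<^bsub>L\<^esub> b" for a b
    proof -
      have c: "a \<in> carrier L" "b \<in> carrier L" using congruence_closed[OF T(1) ab(1)] by auto
      note gc = g(1)[OF c(1)] g(1)[OF c(2)]
      let ?\<chi> = "{(u, v). u \<in> carrier M \<and> v \<in> carrier M \<and>
        (u \<squnion>\<^bsub>M\<^esub> g a, v \<squnion>\<^bsub>M\<^esub> g a) \<in> {(u, v). u \<in> carrier M \<and> v \<in> carrier M \<and>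
          (u \<sqinter>\<^bsub>M\<^esub> g b, v \<sqinter>\<^bsub>M\<^esub> g b) \<in> \<psi>}}"
      have \<chi>: "frame_congruence M ?\<chi>"
        by (intro congruence_vimage_join congruence_vimage_meet assms(2) \<psi> gc)
      have "(g u, g v) \<in> ?\<chi>" if uv: "(u, v) \<in> \<phi>" for u v
      proof -
        have d: "u \<in> carrier L" "v \<in> carrier L" using congruence_closed[OF P(1) uv] by auto
        have "((x \<squnion>\<^bsub>L\<^esub> a) \<sqinter>\<^bsub>L\<^esub> b, a) \<in> \<theta>" if x: "x \<in> carrier L" for x
        proof -
          have "((x \<squnion>\<^bsub>L\<^esub> a) \<sqinter>\<^bsub>L\<^esub> b, (x \<squnion>\<^bsub>L\<^esub> a) \<sqinter>\<^bsub>L\<^esub> a) \<in> \<theta>"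
            using x c ab by (intro TC(5) TC(2) TC(3)[OF ab(1)]) simp_all
          moreover have "(x \<squnion>\<^bsub>L\<^esub> a) \<sqinter>\<^bsub>L\<^esub> a = a"
            using x c by (intro L.meet_eqI) (auto intro: L.join_right)
          ultimately show ?thesis by simp
        qed
        then have "((u \<squnion>\<^bsub>L\<^esub> a) \<sqinter>\<^bsub>L\<^esub> b, (v \<squnion>\<^bsub>L\<^esub> a) \<sqinter>\<^bsub>L\<^esub> b) \<in> \<theta>"
          using d TC(3,4) by blast
        moreover have "((u \<squnion>\<^bsub>L\<^esub> a) \<sqinter>\<^bsub>L\<^esub> b, (v \<squnion>\<^bsub>L\<^esub> a) \<sqinter>\<^bsub>L\<^esub> b) \<in> \<phi>"
          by (intro PC(5) congruence_join[OF P(1)] uv PC(2) c)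
        ultimately have "(g ((u \<squnion>\<^bsub>L\<^esub> a) \<sqinter>\<^bsub>L\<^esub> b), g ((v \<squnion>\<^bsub>L\<^esub> a) \<sqinter>\<^bsub>L\<^esub> b)) \<in> \<psi>"
          by (intro sub) (simp add: meet)
        then show ?thesis
          using c d gc g(1)[OF d(1)] g(1)[OF d(2)] by (simp add: g(3) gj)
      qed
      from P(4)[OF \<chi> this] have "((\<bottom>\<^bsub>M\<^esub> \<squnion>\<^bsub>M\<^esub> g a) \<sqinter>\<^bsub>M\<^esub> g b, (n \<squnion>\<^bsub>M\<^esub> g a) \<sqinter>\<^bsub>M\<^esub> g b) \<in> \<psi>"
        by auto
      then have "(g a, (n \<squnion>\<^bsub>M\<^esub> g a) \<sqinter>\<^bsub>M\<^esub> g b) \<in> \<psi>"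
        using gc frame_map_mono[OF assms(1-3) c ab(2)]
        by (simp add: M.join_bottom_left M.meet_absorb[symmetric])
      then have "(g a \<sqinter>\<^bsub>M\<^esub> n, ((n \<squnion>\<^bsub>M\<^esub> g a) \<sqinter>\<^bsub>M\<^esub> g b) \<sqinter>\<^bsub>M\<^esub> n) \<in> \<psi>"
        by (intro X(5) X(2) P(2))
      moreover have "((n \<squnion>\<^bsub>M\<^esub> g a) \<sqinter>\<^bsub>M\<^esub> g b) \<sqinter>\<^bsub>M\<^esub> n = g b \<sqinter>\<^bsub>M\<^esub> n"
      proof -
        have "(n \<squnion>\<^bsub>M\<^esub> g a) \<sqinter>\<^bsub>M\<^esub> n = n"
          using gc P(2) by (intro M.meet_eqI) (auto intro: M.join_left)
        then show ?thesis
          using gc P(2) M.meet_left_comm[of "n \<squnion>\<^bsub>M\<^esub> g a" "g b" n] by (simp add: M.meet_assoc)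
      qed
      ultimately show ?thesis by simp
    qed
    \<comment> \<open>Now \<theta> varies: by \<open>le\<close> the elements that become
      \<psi>-related after meeting with \<open>n\<close> form a congruence containing the image of
      \<theta>, hence containing (\<bottom>, m).\<close>
    let ?\<psi> = "{(u, v). u \<in> carrier M \<and> v \<in> carrier M \<and> (u \<sqinter>\<^bsub>M\<^esub> n, v \<sqinter>\<^bsub>M\<^esub> n) \<in> \<psi>}"
    have \<psi>n: "frame_congruence M ?\<psi>"
      by (intro congruence_vimage_meet assms(2) \<psi> P(2))
    have "(g a, g b) \<in> ?\<psi>" if ab: "(a, b) \<in> \<theta>" for a b
    proof -
      have c: "a \<in> carrier L" "b \<in> carrier L" using congruence_closed[OF T(1) ab] by auto
      \<comment> \<open>An arbitrary pair is split at a \<sqinter> b into two comparable pairs, to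
        which \<open>le\<close> applies.\<close>
      have "(a \<sqinter>\<^bsub>L\<^esub> b, b \<sqinter>\<^bsub>L\<^esub> b) \<in> \<theta>" using ab c by (intro TC(5) TC(2))
      then have b: "(a \<sqinter>\<^bsub>L\<^esub> b, b) \<in> \<theta>" using c by (simp add: L.meet_idem)
      then have a: "(a \<sqinter>\<^bsub>L\<^esub> b, a) \<in> \<theta>" using TC(3,4) ab by blast
      show ?thesis
        using X(4)[OF X(3)[OF le[OF a]] le[OF b]] c g(1) by (simp add: L.meet_left L.meet_right)
    qed
    from T(4)[OF \<psi>n this] have "(\<bottom>\<^bsub>M\<^esub> \<sqinter>\<^bsub>M\<^esub> n, m \<sqinter>\<^bsub>M\<^esub> n) \<in> \<psi>" by auto
    then show ?thesis using P(2) by (simp add: M.meet_bottom_left)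
  qed
  show "m \<sqinter>\<^bsub>M\<^esub> n \<in> carrier M" using T(2) P(2) by simp
qed

text \<open>The inverse image along \<open>g\<close> of a congruence on \<open>M\<close> is a
  congruence on \<open>L\<close>, so it contains the join of \<open>T\<close> as soon as it contains
  every member. In the other direction the pairs (\<bottom>, m \<theta>) are joined inside
  \<psi>.\<close>

lemma represents_sup:
  assumes "frame L" "frame M" "frame_map L M g" and r: "\<And>\<theta>. \<theta> \<in> T \<Longrightarrow> represents L M g \<theta> (m \<theta>)"
  shows "represents L M g (\<Squnion>\<^bsub>congruence_frame L\<^esub> T) (\<Squnion>\<^bsub>M\<^esub> (m ` T))"
proof (rule representsI)
  interpret L: frame L by fact
  interpret M: frame M by fact
  interpret C: frame "congruence_frame L" using assms(1) by (rule frame_congruence_frame)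
  note g = frame_mapD[OF assms(3)]
  have T: "T \<subseteq> carrier (congruence_frame L)"
    using representsD(1)[OF r] by (auto simp: congruence_frame_carrier)
  have mT: "m ` T \<subseteq> carrier M" using representsD(2)[OF r] by auto
  show s: "frame_congruence L (\<Squnion>\<^bsub>congruence_frame L\<^esub> T)"
    using C.sup_closed[OF T] by (simp add: congruence_frame_carrier)
  show mc: "\<Squnion>\<^bsub>M\<^esub> (m ` T) \<in> carrier M" using mT by simp
  let ?\<theta> = "{(u, v). u \<in> carrier L \<and> v \<in> carrier L \<and> (g u, g v) \<in> nabla M (\<Squnion>\<^bsub>M\<^esub> (m ` T))}"
  have cong: "frame_congruence L ?\<theta>"
    by (rule congruence_vimage[OF assms(1) congruence_nabla[OF assms(2) mc]]) (auto simp: g)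
  have "\<theta> \<subseteq> ?\<theta>" if t: "\<theta> \<in> T" for \<theta>
  proof -
    have "nabla M (m \<theta>) \<subseteq> nabla M (\<Squnion>\<^bsub>M\<^esub> (m ` T))"
      using t mT M.sup_upper[OF mT] by (subst nabla_mono_iff[OF assms(2) _ mc]) auto
    then show ?thesis
      using representsD(3)[OF r[OF t]] congruence_closed[OF representsD(1)[OF r[OF t]]] by blast
  qed
  then have "\<Squnion>\<^bsub>congruence_frame L\<^esub> T \<subseteq> ?\<theta>"
    using congruence_frame_sup_le_iff[OF assms(1) T cong] by blast
  then show "(g a, g b) \<in> nabla M (\<Squnion>\<^bsub>M\<^esub> (m ` T))" if "(a, b) \<in> \<Squnion>\<^bsub>congruence_frame L\<^esub> T" for a b
    using that by blast
  show "(\<bottom>\<^bsub>M\<^esub>, \<Squnion>\<^bsub>M\<^esub> (m ` T)) \<in> \<psi>" if \<psi>: "frame_congruence M \<psi>"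
    and sub: "\<And>a b. (a, b) \<in> \<Squnion>\<^bsub>congruence_frame L\<^esub> T \<Longrightarrow> (g a, g b) \<in> \<psi>" for \<psi>
  proof -
    have "(\<bottom>\<^bsub>M\<^esub>, m \<theta>) \<in> \<psi>" if t: "\<theta> \<in> T" for \<theta>
    proof -
      have "\<theta> \<subseteq> \<Squnion>\<^bsub>congruence_frame L\<^esub> T"
        using congruence_frame_sup_le_iff[OF assms(1) T s] t by blast
      then show ?thesis
        using representsD(4)[OF r[OF t] \<psi>] sub by blast
    qed
    then have "(\<lambda>x. (\<bottom>\<^bsub>M\<^esub>, x)) ` m ` T \<subseteq> \<psi>" by auto
    from congruence_sup[OF \<psi> this] have "(\<Squnion>\<^bsub>M\<^esub> ((\<lambda>x. \<bottom>\<^bsub>M\<^esub>) ` m ` T), \<Squnion>\<^bsub>M\<^esub> (m ` T)) \<in> \<psi>"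
      by (simp add: image_image)
    moreover have "\<Squnion>\<^bsub>M\<^esub> ((\<lambda>x. \<bottom>\<^bsub>M\<^esub>) ` m ` T) = \<bottom>\<^bsub>M\<^esub>"
      by (rule M.sup_eqI) auto
    ultimately show ?thesis by simp
  qed
qed

section \<open>Representing closed and open congruences; the induced frame map\<close>

lemma represents_nabla:
  assumes "frame L" "frame M" "frame_map L M g" "a \<in> carrier L"
  shows "represents L M g (nabla L a) (g a)"
proof (rule representsI)
  interpret L: frame L by fact
  interpret M: frame M by fact
  note g = frame_mapD[OF assms(3)] and gj = frame_map_join[OF assms(3)]
  show "frame_congruence L (nabla L a)" by (rule congruence_nabla[OF assms(1,4)])
  show "g a \<in> carrier M" using g(1) assms(4) by simp
  show "(g x, g y) \<in> nabla M (g a)" if "(x, y) \<in> nabla L a" for x y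
    using that assms(4) by (auto simp: nabla_def g(1) gj[symmetric])
  show "(\<bottom>\<^bsub>M\<^esub>, g a) \<in> \<psi>" if "\<And>x y. (x, y) \<in> nabla L a \<Longrightarrow> (g x, g y) \<in> \<psi>" for \<psi>
    using that[OF bottom_in_nabla[OF assms(1,4)]] by (simp add: frame_map_bottom[OF assms(1-3)])
qed

text \<open>Joining with \<open>c\<close> undoes meeting with \<open>g a\<close>, since (g z
  \<sqinter> g a) \<squnion> c = g z \<squnion> c; so the image of \<Delta>(a) lies in \<nabla>(c).
  Conversely (a, \<top>) has image (g a, \<top>), and meeting with \<open>c\<close> leaves
  (\<bottom>, c).\<close>

lemma represents_delta:
  assumes "frame L" "frame M" "frame_map L M g" "a \<in> carrier L" and c: "c \<in> carrier M"
    and compl: "g a \<sqinter>\<^bsub>M\<^esub> c = \<bottom>\<^bsub>M\<^esub>" "g a \<squnion>\<^bsub>M\<^esub> c = \<top>\<^bsub>M\<^esub>"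
  shows "represents L M g (delta L a) c"
proof (rule representsI)
  interpret L: frame L by fact
  interpret M: frame M by fact
  note g = frame_mapD[OF assms(3)]
  show "frame_congruence L (delta L a)" by (rule congruence_delta[OF assms(1,4)])
  show "(g x, g y) \<in> nabla M c" if xy: "(x, y) \<in> delta L a" for x y
  proof -
    have d: "x \<in> carrier L" "y \<in> carrier L" "x \<sqinter>\<^bsub>L\<^esub> a = y \<sqinter>\<^bsub>L\<^esub> a" using xy by (auto simp: delta_def)
    have "g z \<squnion>\<^bsub>M\<^esub> c = g (z \<sqinter>\<^bsub>L\<^esub> a) \<squnion>\<^bsub>M\<^esub> c" if "z \<in> carrier L" for z
      using that assms(4) c g(1) compl(2) by (simp add: g(3) M.join_meet_distrib M.meet_top_right)
    then show ?thesis using d g(1) by (simp add: nabla_def)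
  qed
  show "(\<bottom>\<^bsub>M\<^esub>, c) \<in> \<psi>" if \<psi>: "frame_congruence M \<psi>"
    and sub: "\<And>x y. (x, y) \<in> delta L a \<Longrightarrow> (g x, g y) \<in> \<psi>" for \<psi>
  proof -
    have "(g a \<sqinter>\<^bsub>M\<^esub> c, \<top>\<^bsub>M\<^esub> \<sqinter>\<^bsub>M\<^esub> c) \<in> \<psi>"
      using sub[OF top_in_delta[OF assms(1,4)]] c
      by (intro congruence_meet[OF \<psi>] congruence_refl[OF \<psi>]) (simp_all add: g(2))
    then show ?thesis using c by (simp add: compl M.meet_top_left)
  qed
qed (rule c)

lemma subframe_represented:
  assumes "frame L" "frame M" "frame_map L M g"
  shows "subframe {\<theta>. \<exists>m. represents L M g \<theta> m} (congruence_frame L)"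
  unfolding subframe_def
proof (intro conjI ballI allI impI)
  show "{\<theta>. \<exists>m. represents L M g \<theta> m} \<subseteq> carrier (congruence_frame L)"
    by (auto simp: congruence_frame_carrier dest: representsD(1))
  show "\<top>\<^bsub>congruence_frame L\<^esub> \<in> {\<theta>. \<exists>m. represents L M g \<theta> m}"
    using represents_top[OF assms] by blast
  show "\<theta> \<sqinter>\<^bsub>congruence_frame L\<^esub> \<phi> \<in> {\<theta>. \<exists>m. represents L M g \<theta> m}"
    if "\<theta> \<in> {\<theta>. \<exists>m. represents L M g \<theta> m}" "\<phi> \<in> {\<theta>. \<exists>m. represents L M g \<theta> m}" for \<theta> \<phi>
    using represents_meet[OF assms] that by blast
  show "\<Squnion>\<^bsub>congruence_frame L\<^esub> T \<in> {\<theta>. \<exists>m. represents L M g \<theta> m}"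
    if "T \<subseteq> {\<theta>. \<exists>m. represents L M g \<theta> m}" for T
  proof -
    have "represents L M g \<theta> (SOME m. represents L M g \<theta> m)" if "\<theta> \<in> T" for \<theta>
      using that \<open>T \<subseteq> _\<close> by (intro someI_ex[of "represents L M g \<theta>"]) blast
    from represents_sup[OF assms this] show ?thesis by blast
  qed
qed

text \<open>Uniqueness of the representing element turns the relation into a function, and each
  preservation law becomes an instance of a closure property of \<open>represents\<close>.\<close>

lemma represented_frame_map:
  assumes "frame L" "frame M" "frame_map L M g" "subframe S (congruence_frame L)"
    and ex: "\<And>\<theta>. \<theta> \<in> S \<Longrightarrow> \<exists>m. represents L M g \<theta> m"
  obtains G where "frame_map (congruence_frame L\<lparr>carrier := S\<rparr>) M G"
    "\<And>\<theta> m. \<lbrakk>\<theta> \<in> S; represents L M g \<theta> m\<rbrakk> \<Longrightarrow> G \<theta> = m"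
proof -
  let ?C = "congruence_frame L"
  have C: "frame ?C" by (rule frame_congruence_frame[OF assms(1)])
  define G where "G = (\<lambda>\<theta>\<in>S. SOME m. represents L M g \<theta> m)"
  have G: "represents L M g \<theta> (G \<theta>)" if "\<theta> \<in> S" for \<theta>
    using someI_ex[OF ex[OF that]] that by (simp add: G_def)
  have Geq: "G \<theta> = m" if "\<theta> \<in> S" "represents L M g \<theta> m" for \<theta> m
    by (rule represents_unique[OF assms(2) G[OF that(1)] that(2)])
  have "frame_map (?C\<lparr>carrier := S\<rparr>) M G"
  proof (rule frame_mapI[of _ S, OF _ refl])
    show "G \<in> extensional S" by (simp add: G_def)
    show "G \<theta> \<in> carrier M" if "\<theta> \<in> S" for \<theta> using representsD(2)[OF G[OF that]] .
    show "G \<top>\<^bsub>?C\<lparr>carrier := S\<rparr>\<^esub> = \<top>\<^bsub>M\<^esub>"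
      unfolding top_subframe[OF C assms(4)]
      by (rule Geq[OF subframe_top[OF assms(4)] represents_top[OF assms(1-3)]])
    show "G (\<theta> \<sqinter>\<^bsub>?C\<lparr>carrier := S\<rparr>\<^esub> \<phi>) = G \<theta> \<sqinter>\<^bsub>M\<^esub> G \<phi>" if "\<theta> \<in> S" "\<phi> \<in> S" for \<theta> \<phi>
      unfolding meet_subframe[OF C assms(4) that]
      by (rule Geq[OF subframe_meet[OF assms(4) that] represents_meet[OF assms(1-3) G G]]) fact+
    show "G (\<Squnion>\<^bsub>?C\<lparr>carrier := S\<rparr>\<^esub> T) = \<Squnion>\<^bsub>M\<^esub> (G ` T)" if "T \<subseteq> S" for T
      unfolding sup_subframe[OF C assms(4) that]
      by (rule Geq[OF subframe_sup[OF assms(4) that] represents_sup[OF assms(1-3) G]]) (use that in blast)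
  qed simp
  with Geq that show ?thesis by blast
qed

section \<open>The assembly of a biframe\<close>

lemma biframeD:
  assumes "biframe L"
  shows frame_pos: "frame (pos L)" and frame_neg: "frame (neg L)" and frame_main: "frame (main L)"
    and frame_map_epos: "frame_map (pos L) (main L) (epos L)"
    and frame_map_eneg: "frame_map (neg L) (main L) (eneg L)"
    and biframe_dense: "\<And>a. a \<in> carrier (main L) \<Longrightarrow>
      \<exists>P \<subseteq> carrier (pos L) \<times> carrier (neg L). a = \<Squnion>\<^bsub>main L\<^esub> (meet_pn L ` P)"
  using assms unfolding biframe_def by auto

lemma epos_closed: "\<lbrakk>biframe L; x \<in> carrier (pos L)\<rbrakk> \<Longrightarrow> epos L x \<in> carrier (main L)"
  and eneg_closed: "\<lbrakk>biframe L; y \<in> carrier (neg L)\<rbrakk> \<Longrightarrow> eneg L y \<in> carrier (main L)"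
  using frame_map_epos frame_map_eneg frame_map_closed by fast+

lemma meet_pn_closed:
  assumes "biframe L" "z \<in> carrier (pos L) \<times> carrier (neg L)"
  shows "meet_pn L z \<in> carrier (main L)"
proof -
  interpret M: frame "main L" using assms(1) by (rule frame_main)
  show ?thesis
    using assms by (auto simp: meet_pn_def intro!: M.meet_closed epos_closed eneg_closed)
qed

lemma epos_in_fin_part:
  assumes "biframe L" "x \<in> carrier (pos L)"
  shows "epos L x \<in> fin_part L"
proof -
  interpret N: frame "neg L" using assms(1) by (rule frame_neg)
  interpret M: frame "main L" using assms(1) by (rule frame_main)
  have "meet_pn L (x, \<top>\<^bsub>neg L\<^esub>) = epos L x"
    using assms by (simp add: meet_pn_def frame_map_top[OF frame_map_eneg] M.meet_top_right epos_closed)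
  then show ?thesis
    using assms unfolding fin_part_def
    by (intro CollectI exI[of _ "{(x, \<top>\<^bsub>neg L\<^esub>)}"]) (simp add: epos_closed)
qed

lemma eneg_in_fin_part:
  assumes "biframe L" "y \<in> carrier (neg L)"
  shows "eneg L y \<in> fin_part L"
proof -
  interpret P: frame "pos L" using assms(1) by (rule frame_pos)
  interpret M: frame "main L" using assms(1) by (rule frame_main)
  have "meet_pn L (\<top>\<^bsub>pos L\<^esub>, y) = eneg L y"
    using assms by (simp add: meet_pn_def frame_map_top[OF frame_map_epos] M.meet_top_left eneg_closed)
  then show ?thesis
    using assms unfolding fin_part_def
    by (intro CollectI exI[of _ "{(\<top>\<^bsub>pos L\<^esub>, y)}"]) (simp add: eneg_closed)
qed

lemma fin_part_subset:
  assumes "biframe L"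
  shows "fin_part L \<subseteq> carrier (main L)"
proof -
  interpret M: frame "main L" using assms by (rule frame_main)
  show ?thesis
    unfolding fin_part_def using meet_pn_closed[OF assms] by (auto intro!: M.sup_closed)
qed

lemma assembly_generators:
  assumes "biframe L"
  shows assembly_pos_generators:
      "nabla_pos L ` carrier (pos L) \<union> delta_neg L ` carrier (neg L) \<subseteq> carrier (congruence_frame (main L))"
    and assembly_neg_generators:
      "nabla_neg L ` carrier (neg L) \<union> delta_pos L ` carrier (pos L) \<subseteq> carrier (congruence_frame (main L))"
    and assembly_main_generators:
      "nabla (main L) ` carrier (main L) \<union> delta (main L) ` fin_part L \<subseteq> carrier (congruence_frame (main L))"
  using epos_closed[OF assms] eneg_closed[OF assms] fin_part_subset[OF assms]
    congruence_nabla[OF frame_main[OF assms]] congruence_delta[OF frame_main[OF assms]]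
  by (auto simp: congruence_frame_carrier nabla_pos_def nabla_neg_def delta_pos_def delta_neg_def)

lemma assembly_eq:
  assumes "biframe L"
  shows assembly_pos_eq: "assembly_pos L = congruence_frame (main L)\<lparr>carrier := carrier (assembly_pos L)\<rparr>"
    and assembly_neg_eq: "assembly_neg L = congruence_frame (main L)\<lparr>carrier := carrier (assembly_neg L)\<rparr>"
    and assembly_main_eq: "assembly_main L = congruence_frame (main L)\<lparr>carrier := carrier (assembly_main L)\<rparr>"
  unfolding assembly_pos_def assembly_neg_def assembly_main_def
  by (rule generated_subframe_eq[OF frame_congruence_frame[OF frame_main[OF assms]]],
      rule assembly_generators[OF assms])+

lemma subframe_assembly:
  assumes "biframe L"
  shows subframe_assembly_pos: "subframe (carrier (assembly_pos L)) (congruence_frame (main L))"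
    and subframe_assembly_neg: "subframe (carrier (assembly_neg L)) (congruence_frame (main L))"
    and subframe_assembly_main: "subframe (carrier (assembly_main L)) (congruence_frame (main L))"
  unfolding assembly_pos_def assembly_neg_def assembly_main_def
  by (rule subframe_generated[OF frame_congruence_frame[OF frame_main[OF assms]]],
      rule assembly_generators[OF assms])+

lemma frame_assembly:
  assumes "biframe L"
  shows frame_assembly_pos: "frame (assembly_pos L)"
    and frame_assembly_neg: "frame (assembly_neg L)"
    and frame_assembly_main: "frame (assembly_main L)"
  unfolding assembly_pos_def assembly_neg_def assembly_main_def
  by (intro frame_generated_subframe frame_congruence_frame frame_main assembly_generators assms)+

lemma assembly_mem:
  assumes "biframe L"
  shows nabla_pos_mem: "\<And>x. x \<in> carrier (pos L) \<Longrightarrow> nabla_pos L x \<in> carrier (assembly_pos L)"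
    and delta_neg_mem: "\<And>y. y \<in> carrier (neg L) \<Longrightarrow> delta_neg L y \<in> carrier (assembly_pos L)"
    and nabla_neg_mem: "\<And>y. y \<in> carrier (neg L) \<Longrightarrow> nabla_neg L y \<in> carrier (assembly_neg L)"
    and delta_pos_mem: "\<And>x. x \<in> carrier (pos L) \<Longrightarrow> delta_pos L x \<in> carrier (assembly_neg L)"
    and nabla_mem: "\<And>a. a \<in> carrier (main L) \<Longrightarrow> nabla (main L) a \<in> carrier (assembly_main L)"
    and delta_mem: "\<And>a. a \<in> fin_part L \<Longrightarrow> delta (main L) a \<in> carrier (assembly_main L)"
  using generated_subframe(2)[OF frame_congruence_frame[OF frame_main[OF assms]]]
    assembly_generators[OF assms]
  unfolding assembly_pos_def assembly_neg_def assembly_main_def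
  by blast+

section \<open>Generators and universal property of the main component\<close>

lemma assembly_components_subset:
  assumes "biframe L"
  shows assembly_pos_subset: "carrier (assembly_pos L) \<subseteq> carrier (assembly_main L)"
    and assembly_neg_subset: "carrier (assembly_neg L) \<subseteq> carrier (assembly_main L)"
proof -
  note least = generated_subframe_least[OF frame_congruence_frame[OF frame_main[OF assms]] _
      subframe_assembly_main[OF assms]]
  note mem = nabla_mem[OF assms epos_closed[OF assms]] nabla_mem[OF assms eneg_closed[OF assms]]
    delta_mem[OF assms epos_in_fin_part[OF assms]] delta_mem[OF assms eneg_in_fin_part[OF assms]]
  show "carrier (assembly_pos L) \<subseteq> carrier (assembly_main L)"
    unfolding assembly_pos_def
    by (rule least[OF assembly_pos_generators[OF assms]])
      (auto simp: nabla_pos_def delta_neg_def intro: mem)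
  show "carrier (assembly_neg L) \<subseteq> carrier (assembly_main L)"
    unfolding assembly_neg_def
    by (rule least[OF assembly_neg_generators[OF assms]])
      (auto simp: nabla_neg_def delta_pos_def intro: mem)
qed

text \<open>Reduces the generators of the main component to four families. For \<nabla> this is
  density, as \<nabla> preserves meets and arbitrary joins. For \<Delta>, meets x+ \<sqinter> x-
  become joins and a finite join becomes a finite meet, whence the induction over the finite set of
  pairs.\<close>

lemma assembly_main_least:
  assumes L: "biframe L" and S: "subframe S (congruence_frame (main L))"
    and np: "\<And>x. x \<in> carrier (pos L) \<Longrightarrow> nabla_pos L x \<in> S"
    and nn: "\<And>y. y \<in> carrier (neg L) \<Longrightarrow> nabla_neg L y \<in> S"
    and dp: "\<And>x. x \<in> carrier (pos L) \<Longrightarrow> delta_pos L x \<in> S"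
    and dn: "\<And>y. y \<in> carrier (neg L) \<Longrightarrow> delta_neg L y \<in> S"
  shows "carrier (assembly_main L) \<subseteq> S"
proof -
  let ?M = "main L" and ?C = "congruence_frame (main L)"
  note M = frame_main[OF L]
  interpret M: frame ?M by (rule M)
  note nab = frame_mapD[OF frame_map_nabla[OF M]]
  have mc: "epos L x \<in> carrier ?M" "eneg L y \<in> carrier ?M" if "x \<in> carrier (pos L)" "y \<in> carrier (neg L)" for x y
    using that epos_closed[OF L] eneg_closed[OF L] by auto
  have nS: "nabla ?M (meet_pn L z) \<in> S" if "z \<in> carrier (pos L) \<times> carrier (neg L)" for z
  proof -
    obtain x y where z: "z = (x, y)" by (cases z)
    then have c: "x \<in> carrier (pos L)" "y \<in> carrier (neg L)" using that by auto
    have "nabla ?M (epos L x \<sqinter>\<^bsub>?M\<^esub> eneg L y) = nabla ?M (epos L x) \<sqinter>\<^bsub>?C\<^esub> nabla ?M (eneg L y)"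
      using nab(3)[OF mc[OF c]] mc[OF c] by simp
    then show ?thesis
      using subframe_meet[OF S np[OF c(1)] nn[OF c(2)]]
      by (simp add: z meet_pn_def nabla_pos_def nabla_neg_def)
  qed
  have nabla: "nabla ?M a \<in> S" if a: "a \<in> carrier ?M" for a
  proof -
    obtain P where P: "P \<subseteq> carrier (pos L) \<times> carrier (neg L)" "a = \<Squnion>\<^bsub>?M\<^esub> (meet_pn L ` P)"
      using biframe_dense[OF L a] by blast
    have c: "meet_pn L ` P \<subseteq> carrier ?M" using P(1) meet_pn_closed[OF L] by blast
    have "restrict (nabla ?M) (carrier ?M) ` meet_pn L ` P = nabla ?M ` meet_pn L ` P"
      using c by (intro image_cong) auto
    then have "nabla ?M a = \<Squnion>\<^bsub>?C\<^esub> (nabla ?M ` meet_pn L ` P)"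
      using nab(4)[OF c] a P(2) by simp
    moreover have "nabla ?M ` meet_pn L ` P \<subseteq> S" using nS P(1) by blast
    ultimately show ?thesis using subframe_sup[OF S] by simp
  qed
  have dS: "delta ?M (meet_pn L z) \<in> S" if "z \<in> carrier (pos L) \<times> carrier (neg L)" for z
  proof -
    obtain x y where z: "z = (x, y)" by (cases z)
    then have c: "x \<in> carrier (pos L)" "y \<in> carrier (neg L)" using that by auto
    show ?thesis
      using subframe_join[OF S dp[OF c(1)] dn[OF c(2)]] delta_meet[OF M mc[OF c]]
      by (simp add: z meet_pn_def delta_pos_def delta_neg_def)
  qed
  have "delta ?M (\<Squnion>\<^bsub>?M\<^esub> (meet_pn L ` F)) \<in> S"
    if "finite F" "F \<subseteq> carrier (pos L) \<times> carrier (neg L)" for F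
    using that
  proof (induction F rule: finite_induct)
    case empty
    then show ?case using subframe_top[OF S] by (simp add: M.sup_empty_eq delta_bottom[OF M])
  next
    case (insert z F)
    then have c: "meet_pn L z \<in> carrier ?M" "meet_pn L ` F \<subseteq> carrier ?M"
      using meet_pn_closed[OF L] by auto
    have "\<Squnion>\<^bsub>?M\<^esub> (meet_pn L ` insert z F) = meet_pn L z \<squnion>\<^bsub>?M\<^esub> \<Squnion>\<^bsub>?M\<^esub> (meet_pn L ` F)"
      using M.weak_sup_insert[OF c] by (simp add: M.eq_is_equal)
    then show ?case
      using insert.IH insert.prems dS subframe_meet[OF S]
        delta_join[OF M c(1) M.sup_closed[OF c(2)]] by simp
  qed
  then have delta: "delta ?M a \<in> S" if "a \<in> fin_part L" for a
    using that by (auto simp: fin_part_def)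
  show ?thesis
    unfolding assembly_main_def
    by (rule generated_subframe_least[OF frame_congruence_frame[OF M] assembly_main_generators[OF L] S])
      (use nabla delta in auto)
qed

text \<open>The complements are supplied as functions \<open>p\<close> and \<open>n\<close> so that
  the values of the extension at \<Delta>(x+) and \<Delta>(x-) become part of the conclusion.
  Existence rests on \<open>assembly_main_least\<close>: the represented congruences form a subframe
  containing all four families.\<close>

lemma assembly_main_extension:
  assumes L: "biframe L" and M: "frame M" and g: "frame_map (main L) M g"
    and p: "\<And>x. x \<in> carrier (pos L) \<Longrightarrow> p x \<in> carrier M \<and>
      g (epos L x) \<sqinter>\<^bsub>M\<^esub> p x = \<bottom>\<^bsub>M\<^esub> \<and> g (epos L x) \<squnion>\<^bsub>M\<^esub> p x = \<top>\<^bsub>M\<^esub>"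
    and n: "\<And>y. y \<in> carrier (neg L) \<Longrightarrow> n y \<in> carrier M \<and>
      g (eneg L y) \<sqinter>\<^bsub>M\<^esub> n y = \<bottom>\<^bsub>M\<^esub> \<and> g (eneg L y) \<squnion>\<^bsub>M\<^esub> n y = \<top>\<^bsub>M\<^esub>"
  obtains G where "frame_map (assembly_main L) M G"
    "\<And>a. a \<in> carrier (main L) \<Longrightarrow> G (nabla (main L) a) = g a"
    "\<And>x. x \<in> carrier (pos L) \<Longrightarrow> G (delta_pos L x) = p x"
    "\<And>y. y \<in> carrier (neg L) \<Longrightarrow> G (delta_neg L y) = n y"
proof -
  note m = frame_main[OF L]
  have rn: "represents (main L) M g (nabla (main L) a) (g a)" if "a \<in> carrier (main L)" for a
    by (rule represents_nabla[OF m M g that])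
  have rp: "represents (main L) M g (delta_pos L x) (p x)" if "x \<in> carrier (pos L)" for x
    unfolding delta_pos_def
    using p[OF that] by (intro represents_delta[OF m M g epos_closed[OF L that]]) auto
  have rm: "represents (main L) M g (delta_neg L y) (n y)" if "y \<in> carrier (neg L)" for y
    unfolding delta_neg_def
    using n[OF that] by (intro represents_delta[OF m M g eneg_closed[OF L that]]) auto
  have sub: "carrier (assembly_main L) \<subseteq> {\<theta>. \<exists>m. represents (main L) M g \<theta> m}"
  proof (rule assembly_main_least[OF L subframe_represented[OF m M g]])
    show "nabla_pos L x \<in> {\<theta>. \<exists>m. represents (main L) M g \<theta> m}" if "x \<in> carrier (pos L)" for x
      using rn[OF epos_closed[OF L that]] by (auto simp: nabla_pos_def)
    show "nabla_neg L y \<in> {\<theta>. \<exists>m. represents (main L) M g \<theta> m}" if "y \<in> carrier (neg L)" for y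
      using rn[OF eneg_closed[OF L that]] by (auto simp: nabla_neg_def)
  qed (use rp rm in blast)+
  obtain G where G: "frame_map (congruence_frame (main L)\<lparr>carrier := carrier (assembly_main L)\<rparr>) M G"
    "\<And>\<theta> c. \<lbrakk>\<theta> \<in> carrier (assembly_main L); represents (main L) M g \<theta> c\<rbrakk> \<Longrightarrow> G \<theta> = c"
    using represented_frame_map[OF m M g subframe_assembly_main[OF L]] sub by blast
  show thesis
  proof (rule that)
    show "frame_map (assembly_main L) M G"
      using G(1) assembly_main_eq[OF L] by simp
    show "G (nabla (main L) a) = g a" if "a \<in> carrier (main L)" for a
      by (rule G(2)[OF nabla_mem[OF L that] rn[OF that]])
    show "G (delta_pos L x) = p x" if "x \<in> carrier (pos L)" for x
      by (rule G(2)[OF subsetD[OF assembly_neg_subset[OF L] delta_pos_mem[OF L that]] rp[OF that]])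
    show "G (delta_neg L y) = n y" if "y \<in> carrier (neg L)" for y
      by (rule G(2)[OF subsetD[OF assembly_pos_subset[OF L] delta_neg_mem[OF L that]] rm[OF that]])
  qed
qed

section \<open>The biframe structure of the assembly\<close>

lemma assembly_sel [simp]:
  "pos (assembly L) = assembly_pos L" "neg (assembly L) = assembly_neg L"
  "main (assembly L) = assembly_main L"
  "epos (assembly L) = (\<lambda>\<theta>\<in>carrier (assembly_pos L). \<theta>)"
  "eneg (assembly L) = (\<lambda>\<theta>\<in>carrier (assembly_neg L). \<theta>)"
  by (simp_all add: assembly_def)

lemma frame_map_assembly_inclusions:
  assumes "biframe L"
  shows "frame_map (assembly_pos L) (assembly_main L) (\<lambda>\<theta>\<in>carrier (assembly_pos L). \<theta>)"
    and "frame_map (assembly_neg L) (assembly_main L) (\<lambda>\<theta>\<in>carrier (assembly_neg L). \<theta>)"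
  using frame_map_inclusion[OF frame_congruence_frame[OF frame_main[OF assms]]
      subframe_assembly_pos[OF assms] subframe_assembly_main[OF assms] assembly_pos_subset[OF assms]]
    frame_map_inclusion[OF frame_congruence_frame[OF frame_main[OF assms]]
      subframe_assembly_neg[OF assms] subframe_assembly_main[OF assms] assembly_neg_subset[OF assms]]
  by (simp_all flip: assembly_eq[OF assms])

text \<open>Complementation is known in the congruence frame and passes to the main component, since
  a subframe has the same top, bottom, binary meets and binary joins.\<close>

lemma assembly_nabla_delta:
  assumes "biframe L"
  shows "\<And>x. x \<in> carrier (pos L) \<Longrightarrow> nabla_pos L x \<sqinter>\<^bsub>assembly_main L\<^esub> delta_pos L x = \<bottom>\<^bsub>assembly_main L\<^esub>"
    and "\<And>x. x \<in> carrier (pos L) \<Longrightarrow> nabla_pos L x \<squnion>\<^bsub>assembly_main L\<^esub> delta_pos L x = \<top>\<^bsub>assembly_main L\<^esub>"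
    and "\<And>y. y \<in> carrier (neg L) \<Longrightarrow> nabla_neg L y \<sqinter>\<^bsub>assembly_main L\<^esub> delta_neg L y = \<bottom>\<^bsub>assembly_main L\<^esub>"
    and "\<And>y. y \<in> carrier (neg L) \<Longrightarrow> nabla_neg L y \<squnion>\<^bsub>assembly_main L\<^esub> delta_neg L y = \<top>\<^bsub>assembly_main L\<^esub>"
proof -
  let ?C = "congruence_frame (main L)" and ?S = "carrier (assembly_main L)"
  note m = frame_main[OF assms]
  have C: "frame ?C" by (rule frame_congruence_frame[OF m])
  note S = subframe_assembly_main[OF assms]
  have bot: "\<bottom>\<^bsub>assembly_main L\<^esub> = \<bottom>\<^bsub>?C\<^esub>"
    using sup_subframe[OF C S, of "{}"] frame.sup_empty_eq[OF C]
      frame.sup_empty_eq[OF frame_assembly_main[OF assms]] assembly_main_eq[OF assms] by simp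
  have top: "\<top>\<^bsub>assembly_main L\<^esub> = \<top>\<^bsub>?C\<^esub>"
    using top_subframe[OF C S] assembly_main_eq[OF assms] by simp
  have meet: "a \<sqinter>\<^bsub>assembly_main L\<^esub> b = a \<sqinter>\<^bsub>?C\<^esub> b" if "a \<in> ?S" "b \<in> ?S" for a b
    using meet_subframe[OF C S that] assembly_main_eq[OF assms] by simp
  have join: "a \<squnion>\<^bsub>assembly_main L\<^esub> b = a \<squnion>\<^bsub>?C\<^esub> b" if "a \<in> ?S" "b \<in> ?S" for a b
    using sup_subframe[OF C S, of "{a, b}"] that assembly_main_eq[OF assms] by (simp add: join_def)
  have *: "nabla (main L) a \<sqinter>\<^bsub>assembly_main L\<^esub> delta (main L) a = \<bottom>\<^bsub>assembly_main L\<^esub> \<and>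
      nabla (main L) a \<squnion>\<^bsub>assembly_main L\<^esub> delta (main L) a = \<top>\<^bsub>assembly_main L\<^esub>"
    if "a \<in> fin_part L" for a
    using that nabla_delta_complement[OF m] fin_part_subset[OF assms] nabla_mem[OF assms] delta_mem[OF assms]
    by (auto simp: bot top meet join)
  show "nabla_pos L x \<sqinter>\<^bsub>assembly_main L\<^esub> delta_pos L x = \<bottom>\<^bsub>assembly_main L\<^esub>"
    "nabla_pos L x \<squnion>\<^bsub>assembly_main L\<^esub> delta_pos L x = \<top>\<^bsub>assembly_main L\<^esub>" if "x \<in> carrier (pos L)" for x
    using *[OF epos_in_fin_part[OF assms that]] by (simp_all add: nabla_pos_def delta_pos_def)
  show "nabla_neg L y \<sqinter>\<^bsub>assembly_main L\<^esub> delta_neg L y = \<bottom>\<^bsub>assembly_main L\<^esub>"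
    "nabla_neg L y \<squnion>\<^bsub>assembly_main L\<^esub> delta_neg L y = \<top>\<^bsub>assembly_main L\<^esub>" if "y \<in> carrier (neg L)" for y
    using *[OF eneg_in_fin_part[OF assms that]] by (simp_all add: nabla_neg_def delta_neg_def)
qed

lemma frame_map_nabla_assembly:
  assumes "biframe L"
  shows frame_map_nabla_main: "frame_map (main L) (assembly_main L) (restrict (nabla (main L)) (carrier (main L)))"
    and frame_map_nabla_pos: "frame_map (pos L) (assembly_pos L) (restrict (nabla_pos L) (carrier (pos L)))"
    and frame_map_nabla_neg: "frame_map (neg L) (assembly_neg L) (restrict (nabla_neg L) (carrier (neg L)))"
proof -
  note m = frame_main[OF assms]
  note C = frame_congruence_frame[OF m] and n = frame_map_nabla[OF m]
  show "frame_map (main L) (assembly_main L) (restrict (nabla (main L)) (carrier (main L)))"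
    using frame_map_corestrict[OF m C n subframe_assembly_main[OF assms]] nabla_mem[OF assms]
    by (simp flip: assembly_eq[OF assms])
  have "compose (carrier (pos L)) (restrict (nabla (main L)) (carrier (main L))) (epos L)
      = restrict (nabla_pos L) (carrier (pos L))"
    using epos_closed[OF assms] by (intro ext) (auto simp: compose_def nabla_pos_def)
  then show "frame_map (pos L) (assembly_pos L) (restrict (nabla_pos L) (carrier (pos L)))"
    using frame_map_corestrict[OF frame_pos[OF assms] C
        frame_map_comp[OF frame_pos[OF assms] frame_map_epos[OF assms] n] subframe_assembly_pos[OF assms]]
      nabla_pos_mem[OF assms]
    by (simp flip: assembly_eq[OF assms])
  have "compose (carrier (neg L)) (restrict (nabla (main L)) (carrier (main L))) (eneg L)
      = restrict (nabla_neg L) (carrier (neg L))"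
    using eneg_closed[OF assms] by (intro ext) (auto simp: compose_def nabla_neg_def)
  then show "frame_map (neg L) (assembly_neg L) (restrict (nabla_neg L) (carrier (neg L)))"
    using frame_map_corestrict[OF frame_neg[OF assms] C
        frame_map_comp[OF frame_neg[OF assms] frame_map_eneg[OF assms] n] subframe_assembly_neg[OF assms]]
      nabla_neg_mem[OF assms]
    by (simp flip: assembly_eq[OF assms])
qed

lemma frame_map_assembly_eqI:
  assumes "biframe L"
  shows frame_map_assembly_pos_eqI: "\<And>f g. \<lbrakk>frame_map (assembly_pos L) M f; frame_map (assembly_pos L) M g;
      \<And>x. x \<in> carrier (pos L) \<Longrightarrow> f (nabla_pos L x) = g (nabla_pos L x);
      \<And>y. y \<in> carrier (neg L) \<Longrightarrow> f (delta_neg L y) = g (delta_neg L y)\<rbrakk> \<Longrightarrow> f = g"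
    and frame_map_assembly_neg_eqI: "\<And>f g. \<lbrakk>frame_map (assembly_neg L) M f; frame_map (assembly_neg L) M g;
      \<And>y. y \<in> carrier (neg L) \<Longrightarrow> f (nabla_neg L y) = g (nabla_neg L y);
      \<And>x. x \<in> carrier (pos L) \<Longrightarrow> f (delta_pos L x) = g (delta_pos L x)\<rbrakk> \<Longrightarrow> f = g"
proof -
  note C = frame_congruence_frame[OF frame_main[OF assms]]
  show "f = g" if "frame_map (assembly_pos L) M f" "frame_map (assembly_pos L) M g"
      "\<And>x. x \<in> carrier (pos L) \<Longrightarrow> f (nabla_pos L x) = g (nabla_pos L x)"
      "\<And>y. y \<in> carrier (neg L) \<Longrightarrow> f (delta_neg L y) = g (delta_neg L y)" for f g
    by (rule frame_map_generated_eqI[OF C assembly_pos_generators[OF assms]])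
      (use that in \<open>auto simp: assembly_pos_def\<close>)
  show "f = g" if "frame_map (assembly_neg L) M f" "frame_map (assembly_neg L) M g"
      "\<And>y. y \<in> carrier (neg L) \<Longrightarrow> f (nabla_neg L y) = g (nabla_neg L y)"
      "\<And>x. x \<in> carrier (pos L) \<Longrightarrow> f (delta_pos L x) = g (delta_pos L x)" for f g
    by (rule frame_map_generated_eqI[OF C assembly_neg_generators[OF assms]])
      (use that in \<open>auto simp: assembly_neg_def\<close>)
qed

text \<open>Density is surjectivity of the canonical map from the coproduct of the components: its
  image is a subframe and contains the four families of generators. If a = ?q D, then the C-ideal
  \<open>D\<close> itself is the required set of pairs.\<close>

lemma biframe_assembly:
  assumes "biframe L"
  shows "biframe (assembly L)"
  unfolding biframe_def assembly_sel
proof (intro conjI ballI)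
  let ?P = "assembly_pos L" and ?N = "assembly_neg L" and ?A = "assembly_main L"
    and ?C = "congruence_frame (main L)"
  note F = frame_assembly[OF assms] and I = frame_map_assembly_inclusions[OF assms]
  note C = frame_congruence_frame[OF frame_main[OF assms]]
  interpret A: frame ?A by (rule F)
  show "frame ?P" "frame ?N" "frame ?A" by fact+
  show "frame_map ?P ?A (\<lambda>\<theta>\<in>carrier ?P. \<theta>)" "frame_map ?N ?A (\<lambda>\<theta>\<in>carrier ?N. \<theta>)" by fact+
  show "inj_on (\<lambda>\<theta>\<in>carrier ?P. \<theta>) (carrier ?P)" "inj_on (\<lambda>\<theta>\<in>carrier ?N. \<theta>) (carrier ?N)"
    by (auto simp: inj_on_def)
  let ?q = "copairing ?P ?N ?A (\<lambda>\<theta>\<in>carrier ?P. \<theta>) (\<lambda>\<theta>\<in>carrier ?N. \<theta>)"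
  let ?K = "frame_coproduct ?P ?N"
  note K = frame_frame_coproduct[OF F(1,2)]
  note q = copairing[OF F I]
  have inl: "\<theta> \<in> ?q ` carrier ?K" if "\<theta> \<in> carrier ?P" for \<theta>
    using q(2)[OF that] that frame_map_closed[OF frame_map_inl[OF F(1,2)] that] by (force intro: rev_image_eqI)
  have inr: "\<theta> \<in> ?q ` carrier ?K" if "\<theta> \<in> carrier ?N" for \<theta>
    using q(3)[OF that] that frame_map_closed[OF frame_map_inr[OF F(1,2)] that] by (force intro: rev_image_eqI)
  \<comment> \<open>The image has to be seen as a subframe of the whole congruence frame, since
    \<open>assembly_main_least\<close> speaks about those; hence the composition with the inclusion,
    which leaves the image unchanged.\<close>
  have "frame_map ?A ?C (\<lambda>\<theta>\<in>carrier ?A. \<theta>)"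
    using frame_map_inclusion[OF C subframe_assembly_main[OF assms] subframe_total[OF C]
        subframe_subset[OF subframe_assembly_main[OF assms]]]
    by (simp flip: assembly_eq[OF assms])
  from subframe_image[OF K frame_map_comp[OF K q(1) this]]
  have "subframe (compose (carrier ?K) (\<lambda>\<theta>\<in>carrier ?A. \<theta>) ?q ` carrier ?K) ?C" .
  moreover have "compose (carrier ?K) (\<lambda>\<theta>\<in>carrier ?A. \<theta>) ?q ` carrier ?K = ?q ` carrier ?K"
    using frame_map_closed[OF q(1)] by (intro image_cong) (auto simp: compose_def)
  ultimately have "subframe (?q ` carrier ?K) ?C" by simp
  then have sub: "carrier ?A \<subseteq> ?q ` carrier ?K"
  proof (rule assembly_main_least[OF assms])
    show "nabla_pos L x \<in> ?q ` carrier ?K" if "x \<in> carrier (pos L)" for x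
      by (rule inl[OF nabla_pos_mem[OF assms that]])
    show "delta_neg L y \<in> ?q ` carrier ?K" if "y \<in> carrier (neg L)" for y
      by (rule inl[OF delta_neg_mem[OF assms that]])
    show "nabla_neg L y \<in> ?q ` carrier ?K" if "y \<in> carrier (neg L)" for y
      by (rule inr[OF nabla_neg_mem[OF assms that]])
    show "delta_pos L x \<in> ?q ` carrier ?K" if "x \<in> carrier (pos L)" for x
      by (rule inr[OF delta_pos_mem[OF assms that]])
  qed
  fix a assume "a \<in> carrier ?A"
  then obtain D where D: "D \<in> carrier ?K" "a = ?q D" using sub by blast
  then have "D \<subseteq> carrier ?P \<times> carrier ?N"
    by (simp add: frame_coproduct_carrier c_ideal_subset)
  moreover have "a = \<Squnion>\<^bsub>?A\<^esub> (meet_pn (assembly L) ` D)"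
    using D by (simp add: copairing_def meet_pn_def)
  ultimately show "\<exists>P\<subseteq>carrier ?P \<times> carrier ?N. a = \<Squnion>\<^bsub>?A\<^esub> (meet_pn (assembly L) ` P)" by blast
qed

section \<open>The assembly of a finitary biframe is finitary\<close>

lemma canonical_map:
  assumes "biframe L"
  defines "K \<equiv> frame_coproduct (pos L) (neg L)"
    and "q \<equiv> copairing (pos L) (neg L) (main L) (epos L) (eneg L)"
  shows frame_canonical_coproduct: "frame K"
    and frame_map_canonical: "frame_map K (main L) q"
    and canonical_inl: "\<And>x. x \<in> carrier (pos L) \<Longrightarrow> q (coproduct_inl (pos L) (neg L) x) = epos L x"
    and canonical_inr: "\<And>y. y \<in> carrier (neg L) \<Longrightarrow> q (coproduct_inr (pos L) (neg L) y) = eneg L y"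
    and canonical_surj: "q ` carrier K = carrier (main L)"
proof -
  note p = frame_pos[OF assms(1)] and n = frame_neg[OF assms(1)] and m = frame_main[OF assms(1)]
  show K: "frame K" unfolding K_def by (rule frame_frame_coproduct[OF p n])
  note c = copairing[OF p n m frame_map_epos[OF assms(1)] frame_map_eneg[OF assms(1)], folded K_def q_def]
  show q: "frame_map K (main L) q" by (rule c(1))
  show inl: "q (coproduct_inl (pos L) (neg L) x) = epos L x" if "x \<in> carrier (pos L)" for x
    by (rule c(2)[OF that])
  show inr: "q (coproduct_inr (pos L) (neg L) y) = eneg L y" if "y \<in> carrier (neg L)" for y
    by (rule c(3)[OF that])
  interpret K: frame K by (rule K)
  have il: "coproduct_inl (pos L) (neg L) x \<in> carrier K" if "x \<in> carrier (pos L)" for x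
    unfolding K_def by (rule frame_map_closed[OF frame_map_inl[OF p n] that])
  have ir: "coproduct_inr (pos L) (neg L) y \<in> carrier K" if "y \<in> carrier (neg L)" for y
    unfolding K_def by (rule frame_map_closed[OF frame_map_inr[OF p n] that])
  show "q ` carrier K = carrier (main L)"
  proof
    show "q ` carrier K \<subseteq> carrier (main L)" using frame_map_closed[OF q] by blast
    show "carrier (main L) \<subseteq> q ` carrier K"
    proof
      fix a assume a: "a \<in> carrier (main L)"
      obtain P where P: "P \<subseteq> carrier (pos L) \<times> carrier (neg L)" "a = \<Squnion>\<^bsub>main L\<^esub> (meet_pn L ` P)"
        using biframe_dense[OF assms(1) a] by blast
      let ?i = "\<lambda>(x, y). coproduct_inl (pos L) (neg L) x \<sqinter>\<^bsub>K\<^esub> coproduct_inr (pos L) (neg L) y"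
      have sub: "?i ` P \<subseteq> carrier K" using P(1) il ir by auto
      have "q ` ?i ` P = meet_pn L ` P"
        unfolding image_image using P(1) il ir
        by (intro image_cong) (auto simp: frame_map_meet[OF q] inl inr meet_pn_def)
      then have "a = q (\<Squnion>\<^bsub>K\<^esub> (?i ` P))" using P(2) frame_map_sup[OF q sub] by simp
      then show "a \<in> q ` carrier K" using K.sup_closed[OF sub] by blast
    qed
  qed
qed

text \<open>Supplies the finite elements that occur in the two laws of complementation. The join of
  two injected elements is finite because it is the join of the basic elements of (a, \<top>) and
  (\<top>, b).\<close>

lemma fin_part_coproduct:
  fixes A :: "'a gorder" and B :: "'b gorder"
  assumes "frame A" "frame B"
  shows meet_pn_coproduct: "\<And>x y. meet_pn (coproduct_biframe A B) (x, y)
      = coproduct_inl A B x \<sqinter>\<^bsub>frame_coproduct A B\<^esub> coproduct_inr A B y"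
    and fin_part_coproduct_subset: "fin_part (coproduct_biframe A B) \<subseteq> carrier (frame_coproduct A B)"
    and fin_part_bottom: "\<bottom>\<^bsub>frame_coproduct A B\<^esub> \<in> fin_part (coproduct_biframe A B)"
    and fin_part_top: "\<top>\<^bsub>frame_coproduct A B\<^esub> \<in> fin_part (coproduct_biframe A B)"
    and fin_part_inl_meet_inr: "\<And>a b. \<lbrakk>a \<in> carrier A; b \<in> carrier B\<rbrakk> \<Longrightarrow>
      coproduct_inl A B a \<sqinter>\<^bsub>frame_coproduct A B\<^esub> coproduct_inr A B b \<in> fin_part (coproduct_biframe A B)"
    and fin_part_inl_join_inr: "\<And>a b. \<lbrakk>a \<in> carrier A; b \<in> carrier B\<rbrakk> \<Longrightarrow>
      coproduct_inl A B a \<squnion>\<^bsub>frame_coproduct A B\<^esub> coproduct_inr A B b \<in> fin_part (coproduct_biframe A B)"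
proof -
  let ?K = "frame_coproduct A B"
  interpret A: frame A by fact
  interpret B: frame B by fact
  interpret K: frame ?K by (rule frame_frame_coproduct[OF assms])
  note inl = frame_mapD[OF frame_map_inl[OF assms]] and inr = frame_mapD[OF frame_map_inr[OF assms]]
  show mp: "meet_pn (coproduct_biframe A B) (x, y)
      = coproduct_inl A B x \<sqinter>\<^bsub>frame_coproduct A B\<^esub> coproduct_inr A B y" for x y
    by (simp add: meet_pn_def coproduct_biframe_def)
  have fin: "\<Squnion>\<^bsub>?K\<^esub> (meet_pn (coproduct_biframe A B) ` F) \<in> fin_part (coproduct_biframe A B)"
    if "finite F" "F \<subseteq> carrier A \<times> carrier B" for F
    using that unfolding fin_part_def by (auto simp: coproduct_biframe_def)
  have closed: "meet_pn (coproduct_biframe A B) z \<in> carrier ?K" if "z \<in> carrier A \<times> carrier B" for z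
    using that inl(1) inr(1) by (auto simp: mp)
  show "fin_part (coproduct_biframe A B) \<subseteq> carrier ?K"
  proof
    fix s assume "s \<in> fin_part (coproduct_biframe A B)"
    then obtain F where "F \<subseteq> carrier A \<times> carrier B" "s = \<Squnion>\<^bsub>?K\<^esub> (meet_pn (coproduct_biframe A B) ` F)"
      by (auto simp: fin_part_def coproduct_biframe_def)
    then show "s \<in> carrier ?K" using closed by (auto intro!: K.sup_closed)
  qed
  show "\<bottom>\<^bsub>?K\<^esub> \<in> fin_part (coproduct_biframe A B)"
    using fin[of "{}"] by (simp add: K.sup_empty_eq)
  show meet: "coproduct_inl A B a \<sqinter>\<^bsub>?K\<^esub> coproduct_inr A B b \<in> fin_part (coproduct_biframe A B)"
    if "a \<in> carrier A" "b \<in> carrier B" for a b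
    using fin[of "{(a, b)}"] closed[of "(a, b)"] that by (simp add: mp)
  show "\<top>\<^bsub>?K\<^esub> \<in> fin_part (coproduct_biframe A B)"
    using meet[OF A.top_closed B.top_closed] by (simp add: inl(2) inr(2) K.meet_top_left)
  show "coproduct_inl A B a \<squnion>\<^bsub>?K\<^esub> coproduct_inr A B b \<in> fin_part (coproduct_biframe A B)"
    if "a \<in> carrier A" "b \<in> carrier B" for a b
    using fin[of "{(a, \<top>\<^bsub>B\<^esub>), (\<top>\<^bsub>A\<^esub>, b)}"] that inl(1)[OF that(1)] inr(1)[OF that(2)]
    by (simp add: mp inl(2) inr(2) K.meet_top_left K.meet_top_right join_def)
qed

lemma finitary_assembly:
  assumes "finitary_biframe L"
  shows "finitary_biframe (assembly L)"
proof -
  have L: "biframe L" using assms by (simp add: finitary_biframe_def)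
  let ?P = "assembly_pos L" and ?N = "assembly_neg L" and ?A = "assembly_main L"
  let ?inl = "coproduct_inl ?P ?N" and ?inr = "coproduct_inr ?P ?N"
  define K where "K = frame_coproduct ?P ?N"
  define Kb where "Kb = coproduct_biframe ?P ?N"
  define q where "q = copairing ?P ?N ?A (epos (assembly L)) (eneg (assembly L))"
  define K\<^sub>0 where "K\<^sub>0 = frame_coproduct (pos L) (neg L)"
  define q\<^sub>0 where "q\<^sub>0 = copairing (pos L) (neg L) (main L) (epos L) (eneg L)"
  note P = frame_assembly_pos[OF L] and N = frame_assembly_neg[OF L] and A = frame_assembly_main[OF L]
  note can = canonical_map[OF biframe_assembly[OF L], unfolded assembly_sel(1-3), folded K_def q_def]
  note can\<^sub>0 = canonical_map[OF L, folded K\<^sub>0_def q\<^sub>0_def]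
  note fin = fin_part_coproduct[OF P N, folded K_def Kb_def]
  note inl = frame_map_inl[OF P N, folded K_def] and inr = frame_map_inr[OF P N, folded K_def]
  note inlD = frame_mapD[OF inl] and inrD = frame_mapD[OF inr]
  interpret K: frame K by (rule can)
  interpret A: frame ?A by (rule A)
  note qD = frame_mapD[OF can(2)]

  \<comment> \<open>Taking every valid inequality makes \<open>C\<close> the largest finitary
    congruence inside the kernel of \<open>q\<close>. What has to be shown is that the kernel is no
    larger, that is, that \<open>j\<close> factors through \<open>q\<close>.\<close>
  define R where "R = {(s, t). s \<in> fin_part Kb \<and> t \<in> fin_part Kb \<and> q s \<sqsubseteq>\<^bsub>?A\<^esub> q t}"
  define C where "C = generated_congruence K R"
  have RK: "R \<subseteq> carrier K \<times> carrier K" using fin(2) by (auto simp: R_def)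
  have C: "frame_congruence K C" unfolding C_def by (rule congruence_generated[OF can(1) RK])
  let ?Q = "quotient_frame K C"
  define j where "j = quotient_map K C"
  have Q: "frame ?Q" and j: "frame_map K ?Q j"
    and j_iff: "\<And>a b. \<lbrakk>a \<in> carrier K; b \<in> carrier K\<rbrakk> \<Longrightarrow> j a = j b \<longleftrightarrow> (a, b) \<in> C"
    unfolding j_def using quotient[OF can(1) C] by auto
  note jD = frame_mapD[OF j]
  interpret Q: frame ?Q by (rule Q)
  have j_le: "j s \<sqsubseteq>\<^bsub>?Q\<^esub> j t" if "s \<in> fin_part Kb" "t \<in> fin_part Kb" "q s \<sqsubseteq>\<^bsub>?A\<^esub> q t" for s t
  proof -
    have "(s \<sqinter>\<^bsub>K\<^esub> t, s) \<in> C"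
      unfolding C_def by (rule generated_congruence_base) (use that in \<open>simp add: R_def\<close>)
    moreover have st: "s \<in> carrier K" "t \<in> carrier K" using that fin(2) by auto
    ultimately have "j (s \<sqinter>\<^bsub>K\<^esub> t) = j s" by (simp add: j_iff)
    then show ?thesis using st jD(1) by (simp add: jD(3) Q.meet_absorb)
  qed
  have j_eq: "j s = j t" if "s \<in> fin_part Kb" "t \<in> fin_part Kb" "q s = q t" for s t
  proof (rule Q.le_antisym)
    have st: "s \<in> carrier K" "t \<in> carrier K" using that fin(2) by auto
    then show "j s \<sqsubseteq>\<^bsub>?Q\<^esub> j t" "j t \<sqsubseteq>\<^bsub>?Q\<^esub> j s" "j s \<in> carrier ?Q" "j t \<in> carrier ?Q"
      using that qD(1) jD(1) by (auto intro: j_le)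
  qed
  \<comment> \<open>As \<open>a\<close> and \<open>b\<close> come from opposite components, the meet
    and join of their injections are finite elements of the coproduct. Complementation says that
    they have the same image under \<open>q\<close> as \<bottom> and \<top>, so \<open>j\<close>
    identifies them too.\<close>
  have compl: "j (?inl a) \<sqinter>\<^bsub>?Q\<^esub> j (?inr b) = \<bottom>\<^bsub>?Q\<^esub> \<and> j (?inl a) \<squnion>\<^bsub>?Q\<^esub> j (?inr b) = \<top>\<^bsub>?Q\<^esub>"
    if ab: "a \<in> carrier ?P" "b \<in> carrier ?N" and c: "a \<sqinter>\<^bsub>?A\<^esub> b = \<bottom>\<^bsub>?A\<^esub>" "a \<squnion>\<^bsub>?A\<^esub> b = \<top>\<^bsub>?A\<^esub>" for a b
  proof -
    note i = inlD(1)[OF ab(1)] inrD(1)[OF ab(2)]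
    have "j (?inl a \<sqinter>\<^bsub>K\<^esub> ?inr b) = j \<bottom>\<^bsub>K\<^esub>"
      using c ab i by (intro j_eq fin(3,5))
        (simp_all add: qD(3) can(3,4) frame_map_bottom[OF can(1) A can(2)])
    moreover have "j (?inl a \<squnion>\<^bsub>K\<^esub> ?inr b) = j \<top>\<^bsub>K\<^esub>"
      using c ab i by (intro j_eq fin(4,6)) (simp_all add: qD(2) can(3,4) frame_map_join[OF can(2)])
    ultimately show ?thesis
      using i by (simp add: jD(2,3) frame_map_join[OF j] frame_map_bottom[OF can(1) Q j])
  qed

  define np where "np = restrict (nabla_pos L) (carrier (pos L))"
  define nn where "nn = restrict (nabla_neg L) (carrier (neg L))"
  have np: "frame_map (pos L) ?P np" and nn: "frame_map (neg L) ?N nn"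
    unfolding np_def nn_def by (rule frame_map_nabla_assembly[OF L])+
  \<comment> \<open>The map of coproducts induced by the two restrictions of \<nabla>. It lifts
    \<nabla> from the main components to the coproducts of the components.\<close>
  define h where "h = copairing (pos L) (neg L) K
    (compose (carrier (pos L)) ?inl np) (compose (carrier (neg L)) ?inr nn)"
  note p = frame_pos[OF L] and n = frame_neg[OF L] and m = frame_main[OF L]
  note hc = copairing[OF p n can(1) frame_map_comp[OF p np inl] frame_map_comp[OF n nn inr],
      folded K\<^sub>0_def h_def]
  have h: "frame_map K\<^sub>0 K h" by (rule hc)
  have h_inl: "h (coproduct_inl (pos L) (neg L) x) = ?inl (nabla_pos L x)" if "x \<in> carrier (pos L)" for x
    using hc(2)[OF that] that by (simp add: compose_def np_def)
  have h_inr: "h (coproduct_inr (pos L) (neg L) y) = ?inr (nabla_neg L y)" if "y \<in> carrier (neg L)" for y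
    using hc(3)[OF that] that by (simp add: compose_def nn_def)
  let ?nab = "restrict (nabla (main L)) (carrier (main L))"
  note nab = frame_map_nabla_main[OF L]
  note h0 = frame_map_inl[OF p n, folded K\<^sub>0_def] frame_map_inr[OF p n, folded K\<^sub>0_def]
  \<comment> \<open>The square formed by \<open>h\<close>, \<nabla> and the two canonical
    surjections commutes, as can be checked on the injections.\<close>
  have "compose (carrier K\<^sub>0) q h = compose (carrier K\<^sub>0) ?nab q\<^sub>0"
  proof (rule frame_map_coproduct_eqI[OF p n, folded K\<^sub>0_def])
    show "frame_map K\<^sub>0 ?A (compose (carrier K\<^sub>0) q h)" by (rule frame_map_comp[OF can\<^sub>0(1) h can(2)])
    show "frame_map K\<^sub>0 ?A (compose (carrier K\<^sub>0) ?nab q\<^sub>0)"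
      by (rule frame_map_comp[OF can\<^sub>0(1) can\<^sub>0(2) nab])
    show "compose (carrier K\<^sub>0) q h (coproduct_inl (pos L) (neg L) x)
        = compose (carrier K\<^sub>0) ?nab q\<^sub>0 (coproduct_inl (pos L) (neg L) x)" if "x \<in> carrier (pos L)" for x
      using that can(3)[OF nabla_pos_mem[OF L that]] frame_map_closed[OF h0(1) that]
        epos_closed[OF L that] nabla_pos_mem[OF L that]
      by (simp add: compose_def h_inl can\<^sub>0(3) nabla_pos_def)
    show "compose (carrier K\<^sub>0) q h (coproduct_inr (pos L) (neg L) y)
        = compose (carrier K\<^sub>0) ?nab q\<^sub>0 (coproduct_inr (pos L) (neg L) y)" if "y \<in> carrier (neg L)" for y
      using that can(4)[OF nabla_neg_mem[OF L that]] frame_map_closed[OF h0(2) that]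
        eneg_closed[OF L that] nabla_neg_mem[OF L that]
      by (simp add: compose_def h_inr can\<^sub>0(4) nabla_neg_def)
  qed
  from fun_cong[OF this] have qh: "q (h D) = nabla (main L) (q\<^sub>0 D)" if "D \<in> carrier K\<^sub>0" for D
    using that frame_map_closed[OF can\<^sub>0(2) that] by (simp add: compose_def) metis
  \<comment> \<open>\<open>h\<close> acts on each component separately, so it maps a finite join of
    basic elements to a finite join of basic elements.\<close>
  have h_fin: "h s \<in> fin_part Kb" if s: "s \<in> fin_part (coproduct_biframe (pos L) (neg L))" for s
  proof -
    let ?b = "coproduct_biframe (pos L) (neg L)"
    obtain F where F: "finite F" "F \<subseteq> carrier (pos L) \<times> carrier (neg L)" "s = \<Squnion>\<^bsub>K\<^sub>0\<^esub> (meet_pn ?b ` F)"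
      using s by (auto simp: fin_part_def coproduct_biframe_def K\<^sub>0_def)
    note mp = fin_part_coproduct(1)[OF p n, folded K\<^sub>0_def]
    let ?F = "map_prod (nabla_pos L) (nabla_neg L) ` F"
    interpret K0: frame K\<^sub>0 by (rule can\<^sub>0)
    have i: "coproduct_inl (pos L) (neg L) x \<in> carrier K\<^sub>0" "coproduct_inr (pos L) (neg L) y \<in> carrier K\<^sub>0"
      if "(x, y) \<in> F" for x y
      using that F(2) frame_map_closed[OF h0(1)] frame_map_closed[OF h0(2)] by auto
    have "meet_pn ?b ` F \<subseteq> carrier K\<^sub>0" using i by (auto simp: mp)
    then have "h s = \<Squnion>\<^bsub>K\<^esub> (h ` meet_pn ?b ` F)" unfolding F(3) by (rule frame_map_sup[OF h])
    also have "h ` meet_pn ?b ` F = meet_pn Kb ` ?F"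
      unfolding image_image using F(2) i
      by (intro image_cong) (auto simp: mp fin(1) frame_map_meet[OF h] h_inl h_inr)
    finally have "h s = \<Squnion>\<^bsub>K\<^esub> (meet_pn Kb ` ?F)" .
    moreover have "?F \<subseteq> carrier ?P \<times> carrier ?N"
      using F(2) nabla_pos_mem[OF L] nabla_neg_mem[OF L] by auto
    ultimately show ?thesis
      using F(1) unfolding fin_part_def
      by (intro CollectI exI[of _ ?F]) (simp add: Kb_def coproduct_biframe_def K_def)
  qed

  let ?\<phi> = "compose (carrier K\<^sub>0) j h"
  have \<phi>: "frame_map K\<^sub>0 ?Q ?\<phi>" by (rule frame_map_comp[OF can\<^sub>0(1) h j])
  have ker0: "canonical_kernel L = {(D, D'). D \<in> carrier K\<^sub>0 \<and> D' \<in> carrier K\<^sub>0 \<and> q\<^sub>0 D = q\<^sub>0 D'}"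
    by (simp add: canonical_kernel_def K\<^sub>0_def q\<^sub>0_def Let_def)
  have "finitary_congruence (coproduct_biframe (pos L) (neg L)) (canonical_kernel L)"
    using assms by (simp add: finitary_biframe_def)
  then obtain R\<^sub>0 where R0: "R\<^sub>0 \<subseteq> fin_part (coproduct_biframe (pos L) (neg L)) \<times> fin_part (coproduct_biframe (pos L) (neg L))"
    "canonical_kernel L = generated_congruence K\<^sub>0 R\<^sub>0"
    by (auto simp: finitary_congruence_def coproduct_biframe_def K\<^sub>0_def)
  \<comment> \<open>Finitariness of \<open>L\<close> enters here: the kernel is generated by
    inequalities between finite elements, \<open>h\<close> sends these to inequalities between
    finite elements that hold in the assembly, and \<open>j\<close> forces all such inequalities. An
    arbitrary inequality in the kernel would not have to be among those in \<open>R\<close>.\<close>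
  have "canonical_kernel L \<subseteq> {(u, v). u \<in> carrier K\<^sub>0 \<and> v \<in> carrier K\<^sub>0 \<and> ?\<phi> u = ?\<phi> v}"
    unfolding R0(2)
  proof (rule generated_congruence_least[OF congruence_kernel[OF can\<^sub>0(1) Q \<phi>]])
    fix s t assume st: "(s, t) \<in> R\<^sub>0"
    interpret K0: frame K\<^sub>0 by (rule can\<^sub>0)
    interpret M: frame "main L" by (rule m)
    have f: "s \<in> fin_part (coproduct_biframe (pos L) (neg L))" "t \<in> fin_part (coproduct_biframe (pos L) (neg L))"
      using st R0(1) by auto
    then have c: "s \<in> carrier K\<^sub>0" "t \<in> carrier K\<^sub>0"
      using fin_part_coproduct(2)[OF p n] by (auto simp: K\<^sub>0_def)
    have "(s \<sqinter>\<^bsub>K\<^sub>0\<^esub> t, s) \<in> canonical_kernel L"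
      unfolding R0(2) by (rule generated_congruence_base[OF st])
    then have "q\<^sub>0 s \<sqinter>\<^bsub>main L\<^esub> q\<^sub>0 t = q\<^sub>0 s"
      using c by (simp add: ker0 frame_map_meet[OF can\<^sub>0(2)])
    then have "nabla (main L) (q\<^sub>0 s) \<sqinter>\<^bsub>?A\<^esub> nabla (main L) (q\<^sub>0 t) = nabla (main L) (q\<^sub>0 s)"
      using c frame_map_meet[OF nab, of "q\<^sub>0 s" "q\<^sub>0 t"] frame_map_closed[OF can\<^sub>0(2)] by simp
    then have "q (h s) \<sqsubseteq>\<^bsub>?A\<^esub> q (h t)"
      using c nabla_mem[OF L] frame_map_closed[OF can\<^sub>0(2)] by (simp add: qh A.meet_absorb)
    then have "j (h s) \<sqsubseteq>\<^bsub>?Q\<^esub> j (h t)" by (intro j_le h_fin f)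
    then have "?\<phi> (s \<sqinter>\<^bsub>K\<^sub>0\<^esub> t) = ?\<phi> s"
      using c frame_map_closed[OF h] jD(1)
      by (simp add: frame_map_meet[OF \<phi>]) (simp add: compose_def Q.meet_absorb)
    then show "(s \<sqinter>\<^bsub>K\<^sub>0\<^esub> t, s) \<in> {(u, v). u \<in> carrier K\<^sub>0 \<and> v \<in> carrier K\<^sub>0 \<and> ?\<phi> u = ?\<phi> v}"
      using c by simp
  qed
  then have "?\<phi> D = ?\<phi> D'" if "D \<in> carrier K\<^sub>0" "D' \<in> carrier K\<^sub>0" "q\<^sub>0 D = q\<^sub>0 D'" for D D'
    using that unfolding ker0 by blast
  from frame_map_factor[OF can\<^sub>0(1) m Q can\<^sub>0(2,5) \<phi> this]
  obtain g where g: "frame_map (main L) ?Q g" "\<And>D. D \<in> carrier K\<^sub>0 \<Longrightarrow> g (q\<^sub>0 D) = ?\<phi> D"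
    by blast
  have g_epos: "g (epos L x) = j (?inl (nabla_pos L x))" if x: "x \<in> carrier (pos L)" for x
    using g(2)[OF frame_map_closed[OF h0(1) x]] frame_map_closed[OF h0(1) x] x
    by (simp add: can\<^sub>0(3) compose_def h_inl)
  have g_eneg: "g (eneg L y) = j (?inr (nabla_neg L y))" if y: "y \<in> carrier (neg L)" for y
    using g(2)[OF frame_map_closed[OF h0(2) y]] frame_map_closed[OF h0(2) y] y
    by (simp add: can\<^sub>0(4) compose_def h_inr)
  note nd = assembly_nabla_delta[OF L]
  \<comment> \<open>The complement of the image of x+ is taken through \<open>?inr\<close>, since
    \<Delta>(x+) belongs to the negative component; dually, \<Delta>(x-) goes through
    \<open>?inl\<close>.\<close>
  obtain G where G: "frame_map ?A ?Q G"
    "\<And>a. a \<in> carrier (main L) \<Longrightarrow> G (nabla (main L) a) = g a"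
    "\<And>x. x \<in> carrier (pos L) \<Longrightarrow> G (delta_pos L x) = j (?inr (delta_pos L x))"
    "\<And>y. y \<in> carrier (neg L) \<Longrightarrow> G (delta_neg L y) = j (?inl (delta_neg L y))"
  proof (rule assembly_main_extension[OF L Q g(1)])
    show "j (?inr (delta_pos L x)) \<in> carrier ?Q \<and>
        g (epos L x) \<sqinter>\<^bsub>?Q\<^esub> j (?inr (delta_pos L x)) = \<bottom>\<^bsub>?Q\<^esub> \<and>
        g (epos L x) \<squnion>\<^bsub>?Q\<^esub> j (?inr (delta_pos L x)) = \<top>\<^bsub>?Q\<^esub>" if x: "x \<in> carrier (pos L)" for x
      using compl[OF nabla_pos_mem[OF L x] delta_pos_mem[OF L x] nd(1,2)[OF x]]
        jD(1)[OF inrD(1)[OF delta_pos_mem[OF L x]]] by (simp add: g_epos[OF x])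
    show "j (?inl (delta_neg L y)) \<in> carrier ?Q \<and>
        g (eneg L y) \<sqinter>\<^bsub>?Q\<^esub> j (?inl (delta_neg L y)) = \<bottom>\<^bsub>?Q\<^esub> \<and>
        g (eneg L y) \<squnion>\<^bsub>?Q\<^esub> j (?inl (delta_neg L y)) = \<top>\<^bsub>?Q\<^esub>" if y: "y \<in> carrier (neg L)" for y
      using compl[OF delta_neg_mem[OF L y] nabla_neg_mem[OF L y]] nd(3,4)[OF y]
        jD(1)[OF inlD(1)[OF delta_neg_mem[OF L y]]]
      \<comment> \<open>\<open>compl\<close> expects the element of the positive component on the
        left, which here is \<Delta>(y), so both operations are commuted.\<close>
      by (simp add: g_eneg[OF y] meet_comm[of _ "nabla_neg L y"] join_comm[of _ "nabla_neg L y"]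
          meet_comm[of _ "j (?inr (nabla_neg L y))"] join_comm[of _ "j (?inr (nabla_neg L y))"])
  qed blast
  \<comment> \<open>This is the factorization of \<open>j\<close> through \<open>q\<close>. Both
    sides are compared on the two injections and, within a component, on its generators \<nabla> and
    \<Delta>. Elements with equal image under \<open>q\<close> then have equal image under
    \<open>j\<close>, so the kernel of \<open>q\<close> lies in \<open>C\<close>.\<close>
  have Gq: "compose (carrier K) G q = j"
  proof (rule frame_map_coproduct_eqI[OF P N, folded K_def])
    show "frame_map K ?Q (compose (carrier K) G q)" by (rule frame_map_comp[OF can(1,2) G(1)])
    have "compose (carrier ?P) G (epos (assembly L)) = compose (carrier ?P) j ?inl"
    proof (rule frame_map_assembly_pos_eqI[OF L])
      show "frame_map ?P ?Q (compose (carrier ?P) G (epos (assembly L)))"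
        using frame_map_comp[OF P frame_map_assembly_inclusions(1)[OF L] G(1)] by simp
      show "frame_map ?P ?Q (compose (carrier ?P) j ?inl)" by (rule frame_map_comp[OF P inl j])
      show "compose (carrier ?P) G (epos (assembly L)) (nabla_pos L x) = compose (carrier ?P) j ?inl (nabla_pos L x)"
        if "x \<in> carrier (pos L)" for x
        using G(2)[OF epos_closed[OF L that]] nabla_pos_mem[OF L that] g_epos[OF that]
        by (simp add: compose_def nabla_pos_def)
      show "compose (carrier ?P) G (epos (assembly L)) (delta_neg L y) = compose (carrier ?P) j ?inl (delta_neg L y)"
        if "y \<in> carrier (neg L)" for y
        using G(4)[OF that] delta_neg_mem[OF L that] by (simp add: compose_def)
    qed
    note eq = fun_cong[OF this]
    show "compose (carrier K) G q (?inl a) = j (?inl a)" if "a \<in> carrier ?P" for a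
      using eq[of a] that inlD(1)[OF that] can(3)[OF that] by (simp add: compose_def)
    have "compose (carrier ?N) G (eneg (assembly L)) = compose (carrier ?N) j ?inr"
    proof (rule frame_map_assembly_neg_eqI[OF L])
      show "frame_map ?N ?Q (compose (carrier ?N) G (eneg (assembly L)))"
        using frame_map_comp[OF N frame_map_assembly_inclusions(2)[OF L] G(1)] by simp
      show "frame_map ?N ?Q (compose (carrier ?N) j ?inr)" by (rule frame_map_comp[OF N inr j])
      show "compose (carrier ?N) G (eneg (assembly L)) (nabla_neg L y) = compose (carrier ?N) j ?inr (nabla_neg L y)"
        if "y \<in> carrier (neg L)" for y
        using G(2)[OF eneg_closed[OF L that]] nabla_neg_mem[OF L that] g_eneg[OF that]
        by (simp add: compose_def nabla_neg_def)
      show "compose (carrier ?N) G (eneg (assembly L)) (delta_pos L x) = compose (carrier ?N) j ?inr (delta_pos L x)"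
        if "x \<in> carrier (pos L)" for x
        using G(3)[OF that] delta_pos_mem[OF L that] by (simp add: compose_def)
    qed
    note eq = fun_cong[OF this]
    show "compose (carrier K) G q (?inr b) = j (?inr b)" if "b \<in> carrier ?N" for b
      using eq[of b] that inrD(1)[OF that] can(4)[OF that] by (simp add: compose_def)
  qed (rule j)
  have ker: "canonical_kernel (assembly L) = {(D, D'). D \<in> carrier K \<and> D' \<in> carrier K \<and> q D = q D'}"
    by (simp add: canonical_kernel_def K_def q_def Let_def)
  have "canonical_kernel (assembly L) = C"
  proof
    have "(D, D') \<in> C" if "D \<in> carrier K" "D' \<in> carrier K" "q D = q D'" for D D'
    proof -
      have "j D = j D'" using that by (simp add: Gq[symmetric] compose_def)
      then show ?thesis using that by (simp add: j_iff)
    qed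
    then show "canonical_kernel (assembly L) \<subseteq> C"
      unfolding ker by blast
    show "C \<subseteq> canonical_kernel (assembly L)"
      unfolding C_def ker
    proof (rule generated_congruence_least[OF congruence_kernel[OF can(1) A can(2)]])
      fix s t assume "(s, t) \<in> R"
      then have "s \<in> carrier K" "t \<in> carrier K" "q s \<sqsubseteq>\<^bsub>?A\<^esub> q t" using RK by (auto simp: R_def)
      then show "(s \<sqinter>\<^bsub>K\<^esub> t, s) \<in> {(u, v). u \<in> carrier K \<and> v \<in> carrier K \<and> q u = q v}"
        using qD(1) by (simp add: qD(3) A.meet_absorb)
    qed
  qed
  moreover have "R \<subseteq> fin_part Kb \<times> fin_part Kb" by (auto simp: R_def)
  ultimately have "finitary_congruence Kb (canonical_kernel (assembly L))"
    unfolding finitary_congruence_def C_def by (auto simp: Kb_def coproduct_biframe_def K_def)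
  then show ?thesis
    using biframe_assembly[OF L] by (simp add: finitary_biframe_def Kb_def)
qed

section \<open>Assemblies of biframe maps\<close>

text \<open>The components are defined inside the congruence frame. Seeing them inside the main
  component allows maps from or to the main component to be restricted.\<close>

lemma assembly_main_restrict:
  assumes "biframe L"
  shows subframe_pos_main: "subframe (carrier (assembly_pos L)) (assembly_main L)"
    and subframe_neg_main: "subframe (carrier (assembly_neg L)) (assembly_main L)"
    and assembly_main_pos: "assembly_main L\<lparr>carrier := carrier (assembly_pos L)\<rparr> = assembly_pos L"
    and assembly_main_neg: "assembly_main L\<lparr>carrier := carrier (assembly_neg L)\<rparr> = assembly_neg L"
proof -
  note C = frame_congruence_frame[OF frame_main[OF assms]] and S = subframe_assembly[OF assms]
    and eq = assembly_eq[OF assms]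
  show "subframe (carrier (assembly_pos L)) (assembly_main L)"
    using subframe_subframe[OF C S(3,1) assembly_pos_subset[OF assms]] eq(3) by simp
  show "subframe (carrier (assembly_neg L)) (assembly_main L)"
    using subframe_subframe[OF C S(3,2) assembly_neg_subset[OF assms]] eq(3) by simp
  show "assembly_main L\<lparr>carrier := carrier (assembly_pos L)\<rparr> = assembly_pos L"
    by (subst eq(3), subst (2) eq(1)) simp
  show "assembly_main L\<lparr>carrier := carrier (assembly_neg L)\<rparr> = assembly_neg L"
    by (subst eq(3), subst (2) eq(2)) simp
qed

text \<open>An induction principle for each component: a property that cuts out a subframe of the
  component and holds at its generators holds throughout.\<close>

lemma assembly_least:
  assumes "biframe L"
  shows assembly_pos_least: "\<And>S. \<lbrakk>subframe S (assembly_pos L);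
      \<And>x. x \<in> carrier (pos L) \<Longrightarrow> nabla_pos L x \<in> S;
      \<And>y. y \<in> carrier (neg L) \<Longrightarrow> delta_neg L y \<in> S\<rbrakk> \<Longrightarrow> carrier (assembly_pos L) \<subseteq> S"
    and assembly_neg_least: "\<And>S. \<lbrakk>subframe S (assembly_neg L);
      \<And>y. y \<in> carrier (neg L) \<Longrightarrow> nabla_neg L y \<in> S;
      \<And>x. x \<in> carrier (pos L) \<Longrightarrow> delta_pos L x \<in> S\<rbrakk> \<Longrightarrow> carrier (assembly_neg L) \<subseteq> S"
proof -
  note C = frame_congruence_frame[OF frame_main[OF assms]] and sub = subframe_assembly[OF assms]
  show "carrier (assembly_pos L) \<subseteq> S" if S: "subframe S (assembly_pos L)"
    and gen: "\<And>x. x \<in> carrier (pos L) \<Longrightarrow> nabla_pos L x \<in> S"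
      "\<And>y. y \<in> carrier (neg L) \<Longrightarrow> delta_neg L y \<in> S" for S
  proof -
    have "subframe S (congruence_frame (main L))"
      using subframe_trans[OF C sub(1)] S assembly_pos_eq[OF assms] by simp
    then show ?thesis
      unfolding assembly_pos_def
      by (rule generated_subframe_least[OF C assembly_pos_generators[OF assms]]) (use gen in auto)
  qed
  show "carrier (assembly_neg L) \<subseteq> S" if S: "subframe S (assembly_neg L)"
    and gen: "\<And>y. y \<in> carrier (neg L) \<Longrightarrow> nabla_neg L y \<in> S"
      "\<And>x. x \<in> carrier (pos L) \<Longrightarrow> delta_pos L x \<in> S" for S
  proof -
    have "subframe S (congruence_frame (main L))"
      using subframe_trans[OF C sub(2)] S assembly_neg_eq[OF assms] by simp
    then show ?thesis
      unfolding assembly_neg_def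
      by (rule generated_subframe_least[OF C assembly_neg_generators[OF assms]]) (use gen in auto)
  qed
qed

lemma frame_map_assembly_restrict:
  assumes "biframe L" "frame M" "frame_map (assembly_main L) M G"
  shows "frame_map (assembly_pos L) M (restrict G (carrier (assembly_pos L)))"
    and "frame_map (assembly_neg L) M (restrict G (carrier (assembly_neg L)))"
proof -
  note A = frame_assembly_main[OF assms(1)] and M = subframe_total[OF assms(2)]
  have G: "G ` S \<subseteq> carrier M" if "subframe S (assembly_main L)" for S
    using subframe_subset[OF that] frame_map_closed[OF assms(3)] by blast
  note r = frame_map_restrict[OF A assms(2,3) _ M G]
  show "frame_map (assembly_pos L) M (restrict G (carrier (assembly_pos L)))"
    using r[OF subframe_pos_main subframe_pos_main] assms(1) by (simp add: assembly_main_pos)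
  show "frame_map (assembly_neg L) M (restrict G (carrier (assembly_neg L)))"
    using r[OF subframe_neg_main subframe_neg_main] assms(1) by (simp add: assembly_main_neg)
qed

text \<open>The predicate under the definite description in \<open>assembly_map\<close>, named so
  that existence and uniqueness can be proved for it.\<close>

definition assembly_lift :: "('p, 'n, 'm) biframe \<Rightarrow> ('q, 'o, 'k) biframe \<Rightarrow> ('p \<Rightarrow> 'q) \<times> ('n \<Rightarrow> 'o) \<Rightarrow>
    (('m \<times> 'm) set \<Rightarrow> ('k \<times> 'k) set) \<times> (('m \<times> 'm) set \<Rightarrow> ('k \<times> 'k) set) \<Rightarrow> bool" where
  "assembly_lift L M f g \<longleftrightarrow> biframe_map (assembly L) (assembly M) g \<and>
     (\<forall>x\<in>carrier (pos L). fst g (nabla_pos L x) = nabla_pos M (fst f x)) \<and>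
     (\<forall>y\<in>carrier (neg L). snd g (nabla_neg L y) = nabla_neg M (snd f y)) \<and>
     (\<forall>x\<in>carrier (pos L). snd g (delta_pos L x) = delta_pos M (fst f x)) \<and>
     (\<forall>y\<in>carrier (neg L). fst g (delta_neg L y) = delta_neg M (snd f y))"

lemma assembly_lift_unique:
  assumes "biframe L" "assembly_lift L M f g" "assembly_lift L M f g'"
  shows "g = g'"
proof (rule prod_eqI)
  show "fst g = fst g'"
    by (rule frame_map_assembly_pos_eqI[OF assms(1), of "assembly_pos M"])
      (use assms(2,3) in \<open>simp_all add: assembly_lift_def biframe_map_def\<close>)
  show "snd g = snd g'"
    by (rule frame_map_assembly_neg_eqI[OF assms(1), of "assembly_neg M"])
      (use assms(2,3) in \<open>simp_all add: assembly_lift_def biframe_map_def\<close>)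
qed

text \<open>The universal property only gives a map between main components. That it sends
  components to components follows by induction over generators: the elements of a component that
  are sent into the corresponding component form a subframe containing \<nabla> and \<Delta> of the
  right kind.\<close>

lemma assembly_lift_exists:
  assumes L: "biframe L" and M: "biframe M" and f: "biframe_map L M f"
  shows "\<exists>g. assembly_lift L M f g"
proof -
  obtain h where fp: "frame_map (pos L) (pos M) (fst f)" and fn: "frame_map (neg L) (neg M) (snd f)"
    and h: "frame_map (main L) (main M) h"
      "\<And>x. x \<in> carrier (pos L) \<Longrightarrow> h (epos L x) = epos M (fst f x)"
      "\<And>y. y \<in> carrier (neg L) \<Longrightarrow> h (eneg L y) = eneg M (snd f y)"
    using f by (auto simp: biframe_map_def)
  note A = frame_assembly_main[OF M]
  let ?g = "compose (carrier (main L)) (restrict (nabla (main M)) (carrier (main M))) h"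
  have g: "frame_map (main L) (assembly_main M) ?g"
    by (rule frame_map_comp[OF frame_main[OF L] h(1) frame_map_nabla_main[OF M]])
  have fx: "fst f x \<in> carrier (pos M)" if "x \<in> carrier (pos L)" for x by (rule frame_map_closed[OF fp that])
  have fy: "snd f y \<in> carrier (neg M)" if "y \<in> carrier (neg L)" for y by (rule frame_map_closed[OF fn that])
  have gp: "?g (epos L x) = nabla_pos M (fst f x)" if "x \<in> carrier (pos L)" for x
    using epos_closed[OF L that] epos_closed[OF M fx[OF that]] that
    by (simp add: compose_def h(2) nabla_pos_def)
  have gn: "?g (eneg L y) = nabla_neg M (snd f y)" if "y \<in> carrier (neg L)" for y
    using eneg_closed[OF L that] eneg_closed[OF M fy[OF that]] that
    by (simp add: compose_def h(3) nabla_neg_def)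
  note nd = assembly_nabla_delta[OF M]
  obtain G where G: "frame_map (assembly_main L) (assembly_main M) G"
    "\<And>a. a \<in> carrier (main L) \<Longrightarrow> G (nabla (main L) a) = ?g a"
    "\<And>x. x \<in> carrier (pos L) \<Longrightarrow> G (delta_pos L x) = delta_pos M (fst f x)"
    "\<And>y. y \<in> carrier (neg L) \<Longrightarrow> G (delta_neg L y) = delta_neg M (snd f y)"
  proof (rule assembly_main_extension[OF L A g])
    show "delta_pos M (fst f x) \<in> carrier (assembly_main M) \<and>
        ?g (epos L x) \<sqinter>\<^bsub>assembly_main M\<^esub> delta_pos M (fst f x) = \<bottom>\<^bsub>assembly_main M\<^esub> \<and>
        ?g (epos L x) \<squnion>\<^bsub>assembly_main M\<^esub> delta_pos M (fst f x) = \<top>\<^bsub>assembly_main M\<^esub>"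
      if "x \<in> carrier (pos L)" for x
      using subsetD[OF assembly_neg_subset[OF M] delta_pos_mem[OF M fx[OF that]]] nd(1,2)[OF fx[OF that]]
      unfolding gp[OF that] by blast
    show "delta_neg M (snd f y) \<in> carrier (assembly_main M) \<and>
        ?g (eneg L y) \<sqinter>\<^bsub>assembly_main M\<^esub> delta_neg M (snd f y) = \<bottom>\<^bsub>assembly_main M\<^esub> \<and>
        ?g (eneg L y) \<squnion>\<^bsub>assembly_main M\<^esub> delta_neg M (snd f y) = \<top>\<^bsub>assembly_main M\<^esub>"
      if "y \<in> carrier (neg L)" for y
      using subsetD[OF assembly_pos_subset[OF M] delta_neg_mem[OF M fy[OF that]]] nd(3,4)[OF fy[OF that]]
      unfolding gn[OF that] by blast
  qed blast
  have Gp: "G (nabla_pos L x) = nabla_pos M (fst f x)" if "x \<in> carrier (pos L)" for x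
    using G(2)[OF epos_closed[OF L that]] gp[OF that] by (simp add: nabla_pos_def)
  have Gn: "G (nabla_neg L y) = nabla_neg M (snd f y)" if "y \<in> carrier (neg L)" for y
    using G(2)[OF eneg_closed[OF L that]] gn[OF that] by (simp add: nabla_neg_def)
  let ?p = "restrict G (carrier (assembly_pos L))" and ?n = "restrict G (carrier (assembly_neg L))"
  note r = frame_map_assembly_restrict[OF L A G(1)]
  have "subframe {\<theta> \<in> carrier (assembly_pos L). ?p \<theta> \<in> carrier (assembly_pos M)} (assembly_pos L)"
    by (rule subframe_vimage[OF frame_assembly_pos[OF L] r(1) subframe_pos_main[OF M]])
  then have "carrier (assembly_pos L) \<subseteq> {\<theta> \<in> carrier (assembly_pos L). ?p \<theta> \<in> carrier (assembly_pos M)}"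
    by (rule assembly_pos_least[OF L])
      (auto simp: assembly_mem[OF L] assembly_mem[OF M] Gp G(4) fx fy)
  then have "?p \<theta> \<in> carrier (assembly_pos M)" if "\<theta> \<in> carrier (assembly_pos L)" for \<theta>
    using that by blast
  then have p: "frame_map (assembly_pos L) (assembly_pos M) ?p"
    using frame_map_corestrict[OF frame_assembly_pos[OF L] A r(1) subframe_pos_main[OF M]]
    unfolding assembly_main_pos[OF M] by blast
  have "subframe {\<theta> \<in> carrier (assembly_neg L). ?n \<theta> \<in> carrier (assembly_neg M)} (assembly_neg L)"
    by (rule subframe_vimage[OF frame_assembly_neg[OF L] r(2) subframe_neg_main[OF M]])
  then have "carrier (assembly_neg L) \<subseteq> {\<theta> \<in> carrier (assembly_neg L). ?n \<theta> \<in> carrier (assembly_neg M)}"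
    by (rule assembly_neg_least[OF L])
      (auto simp: assembly_mem[OF L] assembly_mem[OF M] Gn G(3) fx fy)
  then have "?n \<theta> \<in> carrier (assembly_neg M)" if "\<theta> \<in> carrier (assembly_neg L)" for \<theta>
    using that by blast
  then have n: "frame_map (assembly_neg L) (assembly_neg M) ?n"
    using frame_map_corestrict[OF frame_assembly_neg[OF L] A r(2) subframe_neg_main[OF M]]
    unfolding assembly_main_neg[OF M] by blast
  have "biframe_map (assembly L) (assembly M) (?p, ?n)"
    unfolding biframe_map_def using p n G(1) frame_map_closed[OF p] frame_map_closed[OF n]
    by (auto intro!: exI[of _ G])
  then have "assembly_lift L M f (?p, ?n)"
    by (simp add: assembly_lift_def assembly_mem[OF L] Gp Gn G(3,4))
  then show ?thesis by blast
qed

lemma assembly_lift_assembly_map: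
  assumes "biframe L" "biframe M" "biframe_map L M f"
  shows "assembly_lift L M f (assembly_map L M f)"
proof -
  have "\<exists>!g. assembly_lift L M f g"
    using assembly_lift_exists[OF assms] assembly_lift_unique[OF assms(1)] by blast
  then show ?thesis
    unfolding assembly_map_def assembly_lift_def[symmetric] by (rule theI')
qed

lemma assembly_map_eqI:
  assumes "biframe L" "biframe M" "biframe_map L M f" "assembly_lift L M f g"
  shows "assembly_map L M f = g"
  by (rule assembly_lift_unique[OF assms(1) assembly_lift_assembly_map[OF assms(1-3)] assms(4)])

section \<open>The categories\<close>

lemma biframe_map_id:
  assumes "biframe L"
  shows "biframe_map L L (biframe_id L)"
  unfolding biframe_map_def biframe_id_def
  using frame_map_id[OF frame_pos[OF assms]] frame_map_id[OF frame_neg[OF assms]]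
    frame_map_id[OF frame_main[OF assms]] epos_closed[OF assms] eneg_closed[OF assms]
  by (auto intro!: exI[of _ "\<lambda>x\<in>carrier (main L). x"])

lemma biframe_map_comp:
  assumes "biframe L" "biframe_map L M f" "biframe_map M N g"
  shows "biframe_map L N (biframe_comp L g f)"
proof -
  obtain h where fp: "frame_map (pos L) (pos M) (fst f)" and fn: "frame_map (neg L) (neg M) (snd f)"
    and h: "frame_map (main L) (main M) h"
      "\<And>x. x \<in> carrier (pos L) \<Longrightarrow> h (epos L x) = epos M (fst f x)"
      "\<And>y. y \<in> carrier (neg L) \<Longrightarrow> h (eneg L y) = eneg M (snd f y)"
    using assms(2) by (auto simp: biframe_map_def)
  obtain k where gp: "frame_map (pos M) (pos N) (fst g)" and gn: "frame_map (neg M) (neg N) (snd g)"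
    and k: "frame_map (main M) (main N) k"
      "\<And>x. x \<in> carrier (pos M) \<Longrightarrow> k (epos M x) = epos N (fst g x)"
      "\<And>y. y \<in> carrier (neg M) \<Longrightarrow> k (eneg M y) = eneg N (snd g y)"
    using assms(3) by (auto simp: biframe_map_def)
  show ?thesis
    unfolding biframe_map_def
  proof (intro conjI exI[of _ "compose (carrier (main L)) k h"] ballI)
    show "frame_map (pos L) (pos N) (fst (biframe_comp L g f))"
      using frame_map_comp[OF frame_pos[OF assms(1)] fp gp] by (simp add: biframe_comp_def)
    show "frame_map (neg L) (neg N) (snd (biframe_comp L g f))"
      using frame_map_comp[OF frame_neg[OF assms(1)] fn gn] by (simp add: biframe_comp_def)
    show "frame_map (main L) (main N) (compose (carrier (main L)) k h)"
      by (rule frame_map_comp[OF frame_main[OF assms(1)] h(1) k(1)])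
    show "compose (carrier (main L)) k h (epos L x) = epos N (fst (biframe_comp L g f) x)"
      if "x \<in> carrier (pos L)" for x
      using that epos_closed[OF assms(1) that] frame_map_closed[OF fp that]
      by (simp add: biframe_comp_def compose_def h k)
    show "compose (carrier (main L)) k h (eneg L y) = eneg N (snd (biframe_comp L g f) y)"
      if "y \<in> carrier (neg L)" for y
      using that eneg_closed[OF assms(1) that] frame_map_closed[OF fn that]
      by (simp add: biframe_comp_def compose_def h k)
  qed
qed

lemma biframe_mapD:
  assumes "biframe_map L M f"
  shows biframe_map_pos: "frame_map (pos L) (pos M) (fst f)"
    and biframe_map_neg: "frame_map (neg L) (neg M) (snd f)"
  using assms by (auto simp: biframe_map_def)

lemma biframe_map_arr:
  assumes "biframe_map L M f"
  shows "fst f \<in> carrier (pos L) \<rightarrow> carrier (pos M)" "fst f \<in> extensional (carrier (pos L))"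
    "snd f \<in> carrier (neg L) \<rightarrow> carrier (neg M)" "snd f \<in> extensional (carrier (neg L))"
  using biframe_mapD[OF assms] by (auto simp: frame_map_def PiE_def)

lemma category_BiFrm_fin: "category BiFrm_fin"
proof
  show "Ident BiFrm_fin X \<in> Hom BiFrm_fin X X" if "X \<in> Obj BiFrm_fin" for X :: "('a, 'b, 'c) biframe"
    using that biframe_map_id by (auto simp: BiFrm_fin_def finitary_biframe_def)
  show "Comp BiFrm_fin X Y Z g f \<in> Hom BiFrm_fin X Z"
    if "X \<in> Obj BiFrm_fin" "f \<in> Hom BiFrm_fin X Y" "g \<in> Hom BiFrm_fin Y Z" for X Y Z :: "('a, 'b, 'c) biframe" and f g
    using that biframe_map_comp[of X Y f Z g] by (simp add: BiFrm_fin_def finitary_biframe_def)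
  show "Comp BiFrm_fin X Y Y (Ident BiFrm_fin Y) f = f"
    if "f \<in> Hom BiFrm_fin X Y" for X Y :: "('a, 'b, 'c) biframe" and f
    using that biframe_map_arr[of X Y f]
    by (simp add: BiFrm_fin_def biframe_comp_def biframe_id_def Id_compose)
  show "Comp BiFrm_fin X X Y f (Ident BiFrm_fin X) = f"
    if "f \<in> Hom BiFrm_fin X Y" for X Y :: "('a, 'b, 'c) biframe" and f
    using that biframe_map_arr[of X Y f]
    by (simp add: BiFrm_fin_def biframe_comp_def biframe_id_def compose_Id)
  show "Comp BiFrm_fin W X Z (Comp BiFrm_fin X Y Z h g) f = Comp BiFrm_fin W Y Z h (Comp BiFrm_fin W X Y g f)"
    if "f \<in> Hom BiFrm_fin W X" for W X Y Z :: "('a, 'b, 'c) biframe" and f g h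
    using that biframe_map_arr[of W X f] by (simp add: BiFrm_fin_def biframe_comp_def compose_assoc)
qed

lemma category_op_cat: "category C \<Longrightarrow> category (op_cat C)"
  by (simp add: category_def op_cat_def)

lemma category_BiTop: "category BiTop"
proof
  show "Ident BiTop X \<in> Hom BiTop X X" if "X \<in> Obj BiTop" for X :: "'x bispace"
    using that
    by (auto simp: BiTop_def bicontinuous_map_def bispace_def points_def
        intro: continuous_map_eq[OF continuous_map_id])
  show "Comp BiTop X Y Z g f \<in> Hom BiTop X Z"
    if "X \<in> Obj BiTop" "f \<in> Hom BiTop X Y" "g \<in> Hom BiTop Y Z" for X Y Z :: "'x bispace" and f g
    using that
    by (auto simp: BiTop_def bicontinuous_map_def bispace_def points_def compose_def
        intro: continuous_map_eq[OF continuous_map_compose])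
  show "Comp BiTop X Y Y (Ident BiTop Y) f = f"
    if "f \<in> Hom BiTop X Y" for X Y :: "'x bispace" and f
    using that continuous_map_funspace[of "pos_top X" "pos_top Y" f]
    by (intro Id_compose[of f "points X" "points Y"] | simp add: BiTop_def bicontinuous_map_def points_def Id_compose)+
  show "Comp BiTop X X Y f (Ident BiTop X) = f"
    if "f \<in> Hom BiTop X Y" for X Y :: "'x bispace" and f
    using that continuous_map_funspace[of "pos_top X" "pos_top Y" f]
    by (simp add: BiTop_def bicontinuous_map_def points_def compose_Id)
  show "Comp BiTop W X Z (Comp BiTop X Y Z h g) f = Comp BiTop W Y Z h (Comp BiTop W X Y g f)"
    if "f \<in> Hom BiTop W X" for W X Y Z :: "'x bispace" and f g h
    using that continuous_map_funspace[of "pos_top W" "pos_top X" f]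
    by (simp add: BiTop_def bicontinuous_map_def points_def compose_assoc)
qed

lemma is_functor_comp:
  assumes "is_functor C D F" "is_functor D E G"
  shows "is_functor C E (G \<circ>\<^sub>F F)"
proof -
  interpret F: is_functor C D F by fact
  interpret G: is_functor D E G by fact
  show ?thesis
    by unfold_locales
      (simp_all add: comp_functor_def F.on_obj_in_Obj G.on_obj_in_Obj F.on_arr_in_Hom G.on_arr_in_Hom
        F.on_arr_ident G.on_arr_ident F.on_arr_comp G.on_arr_comp)
qed

lemma is_functor_op:
  assumes "is_functor C D F"
  shows "is_functor (op_cat C) (op_cat D) (op_functor F)"
proof -
  interpret F: is_functor C D F by fact
  interpret C: category "op_cat C" by (rule category_op_cat) unfold_locales
  interpret D: category "op_cat D" by (rule category_op_cat) unfold_locales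
  show ?thesis
    by unfold_locales
      (simp_all add: op_functor_def op_cat_def F.on_obj_in_Obj F.on_arr_in_Hom F.on_arr_ident F.on_arr_comp)
qed

section \<open>The functors\<close>

text \<open>Both functor laws come from uniqueness: the identity and the composite have the values
  at \<nabla> and \<Delta> that determine \<open>assembly_map\<close>.\<close>

lemma is_functor_assembly: "is_functor BiFrm_fin BiFrm_fin assembly_functor"
proof (intro is_functor.intro category_BiFrm_fin is_functor_axioms.intro)
  fix X Y Z :: "('p, 'n, 'm) biframe" and f g
  assume X: "X \<in> Obj BiFrm_fin"
  then have bX: "biframe X" and bA: "biframe (assembly X)"
    by (auto simp: BiFrm_fin_def finitary_biframe_def intro: biframe_assembly)
  show "on_obj assembly_functor X \<in> Obj BiFrm_fin"
    using X by (simp add: BiFrm_fin_def assembly_functor_def finitary_assembly)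
  have "assembly_lift X X (biframe_id X) (biframe_id (assembly X))"
    using biframe_map_id[OF bA] assembly_mem[OF bX]
    by (simp add: assembly_lift_def) (simp add: biframe_id_def)
  then show "on_arr assembly_functor X X (Ident BiFrm_fin X) = Ident BiFrm_fin (on_obj assembly_functor X)"
    using assembly_map_eqI[OF bX bX biframe_map_id[OF bX]]
    by (simp add: BiFrm_fin_def assembly_functor_def)
  assume Y: "Y \<in> Obj BiFrm_fin" and f: "f \<in> Hom BiFrm_fin X Y"
  then have bY: "biframe Y" and f': "biframe_map X Y f"
    by (auto simp: BiFrm_fin_def finitary_biframe_def)
  note Af = assembly_lift_assembly_map[OF bX bY f']
  show "on_arr assembly_functor X Y f \<in> Hom BiFrm_fin (on_obj assembly_functor X) (on_obj assembly_functor Y)"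
    using Af by (simp add: BiFrm_fin_def assembly_functor_def assembly_lift_def)
  assume Z: "Z \<in> Obj BiFrm_fin" and g: "g \<in> Hom BiFrm_fin Y Z"
  then have bZ: "biframe Z" and g': "biframe_map Y Z g"
    by (auto simp: BiFrm_fin_def finitary_biframe_def)
  note Ag = assembly_lift_assembly_map[OF bY bZ g']
  have "assembly_lift X Z (biframe_comp X g f)
      (biframe_comp (assembly X) (assembly_map Y Z g) (assembly_map X Y f))"
    unfolding assembly_lift_def
  proof (intro conjI ballI)
    show "biframe_map (assembly X) (assembly Z)
        (biframe_comp (assembly X) (assembly_map Y Z g) (assembly_map X Y f))"
      using Af Ag by (intro biframe_map_comp[OF bA]) (auto simp: assembly_lift_def)
  qed (use Af Ag frame_map_closed[OF biframe_map_pos[OF f']] frame_map_closed[OF biframe_map_neg[OF f']]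
      assembly_mem[OF bX] in \<open>simp_all add: assembly_lift_def biframe_comp_def compose_def\<close>)
  then show "on_arr assembly_functor X Z (Comp BiFrm_fin X Y Z g f)
      = Comp BiFrm_fin (on_obj assembly_functor X) (on_obj assembly_functor Y) (on_obj assembly_functor Z)
          (on_arr assembly_functor Y Z g) (on_arr assembly_functor X Y f)"
    using assembly_map_eqI[OF bX bZ biframe_map_comp[OF bX f' g']]
    by (simp add: BiFrm_fin_def assembly_functor_def)
qed

section \<open>The Skula functor\<close>

lemma points_skula:
  assumes "bispace X"
  shows "topspace (pos_top (skula X)) = points X" "topspace (neg_top (skula X)) = points X"
proof -
  have t: "topspace (neg_top X) = topspace (pos_top X)"
    using assms by (simp add: bispace_def)
  have "\<Union>({U. openin (pos_top X) U} \<union> {C. closedin (neg_top X) C}) = topspace (pos_top X)"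
    using openin_subset[of "pos_top X"] closedin_subset[of "neg_top X"] t by blast
  then show "topspace (pos_top (skula X)) = points X" by (simp add: skula_def points_def)
  have "\<Union>({U. openin (neg_top X) U} \<union> {C. closedin (pos_top X) C}) = topspace (pos_top X)"
    using openin_subset[of "neg_top X"] closedin_subset[of "pos_top X"] t by blast
  then show "topspace (neg_top (skula X)) = points X" by (simp add: skula_def points_def)
qed

text \<open>The Skula topologies are given by subbases, so continuity is tested on the open sets of
  one topology and the closed sets of the other.\<close>

lemma continuous_map_into_skula:
  assumes "bispace X" "f ` topspace T \<subseteq> points X"
  shows "\<lbrakk>\<And>U. openin (pos_top X) U \<Longrightarrow> openin T {x \<in> topspace T. f x \<in> U};
      \<And>C. closedin (neg_top X) C \<Longrightarrow> openin T {x \<in> topspace T. f x \<in> C}\<rbrakk>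
      \<Longrightarrow> continuous_map T (pos_top (skula X)) f"
    and "\<lbrakk>\<And>U. openin (neg_top X) U \<Longrightarrow> openin T {x \<in> topspace T. f x \<in> U};
      \<And>C. closedin (pos_top X) C \<Longrightarrow> openin T {x \<in> topspace T. f x \<in> C}\<rbrakk>
      \<Longrightarrow> continuous_map T (neg_top (skula X)) f"
proof -
  have eq: "f -` U \<inter> topspace T = {x \<in> topspace T. f x \<in> U}" for U by auto
  show "continuous_map T (pos_top (skula X)) f"
    if "\<And>U. openin (pos_top X) U \<Longrightarrow> openin T {x \<in> topspace T. f x \<in> U}"
      "\<And>C. closedin (neg_top X) C \<Longrightarrow> openin T {x \<in> topspace T. f x \<in> C}"
    using points_skula(1)[OF assms(1)] assms(2) that unfolding skula_def bispace.simps
    by (intro continuous_on_generated_topo) (auto simp: eq)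
  show "continuous_map T (neg_top (skula X)) f"
    if "\<And>U. openin (neg_top X) U \<Longrightarrow> openin T {x \<in> topspace T. f x \<in> U}"
      "\<And>C. closedin (pos_top X) C \<Longrightarrow> openin T {x \<in> topspace T. f x \<in> C}"
    using points_skula(2)[OF assms(1)] assms(2) that unfolding skula_def bispace.simps
    by (intro continuous_on_generated_topo) (auto simp: eq)
qed

lemma openin_skula:
  shows "openin (pos_top X) U \<Longrightarrow> openin (pos_top (skula X)) U"
    and "closedin (neg_top X) U \<Longrightarrow> openin (pos_top (skula X)) U"
    and "openin (neg_top X) U \<Longrightarrow> openin (neg_top (skula X)) U"
    and "closedin (pos_top X) U \<Longrightarrow> openin (neg_top (skula X)) U"
  by (simp_all add: skula_def topology_generated_by_Basis)

text \<open>A bicontinuous map pulls open sets back to open sets and closed sets to closed sets, in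
  each topology; so preimages of subbasic sets are subbasic.\<close>

lemma bicontinuous_map_skula:
  assumes "bispace X" "bispace Y" "bicontinuous_map X Y f"
  shows "bicontinuous_map (skula X) (skula Y) f"
proof -
  have X: "topspace (pos_top X) = points X" "topspace (neg_top X) = points X"
    using assms(1) by (auto simp: bispace_def points_def)
  have f: "continuous_map (pos_top X) (pos_top Y) f" "continuous_map (neg_top X) (neg_top Y) f"
    using assms(3) by (auto simp: bicontinuous_map_def)
  have im: "f ` points X \<subseteq> points Y"
    using continuous_map_funspace[OF f(1)] by (auto simp: points_def)
  note op = openin_continuous_map_preimage[OF f(1), unfolded X]
    openin_continuous_map_preimage[OF f(2), unfolded X]
    and cl = closedin_continuous_map_preimage[OF f(1), unfolded X]
    closedin_continuous_map_preimage[OF f(2), unfolded X]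
  show ?thesis
    unfolding bicontinuous_map_def using im
    by (auto intro!: continuous_map_into_skula[OF assms(2)]
        simp: points_skula[OF assms(1)] openin_skula op cl)
qed

lemma bispace_skula:
  assumes "bispace X"
  shows "bispace (skula X)"
  using points_skula[OF assms] by (simp add: bispace_def)

lemma is_functor_skula: "is_functor BiTop BiTop skula_functor"
proof (intro is_functor.intro category_BiTop is_functor_axioms.intro)
  have p: "points (skula X) = points X" if "bispace X" for X :: "'x bispace"
    using points_skula(1)[OF that] by (simp add: points_def)
  show "on_obj skula_functor X \<in> Obj BiTop" if "X \<in> Obj BiTop" for X :: "'x bispace"
    using that by (simp add: BiTop_def skula_functor_def bispace_skula)
  show "on_arr skula_functor X Y f \<in> Hom BiTop (on_obj skula_functor X) (on_obj skula_functor Y)"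
    if "X \<in> Obj BiTop" "Y \<in> Obj BiTop" "f \<in> Hom BiTop X Y" for X Y :: "'x bispace" and f
    using that by (simp add: BiTop_def skula_functor_def bicontinuous_map_skula p)
  show "on_arr skula_functor X X (Ident BiTop X) = Ident BiTop (on_obj skula_functor X)"
    if "X \<in> Obj BiTop" for X :: "'x bispace"
    using that by (simp add: BiTop_def skula_functor_def p)
  show "on_arr skula_functor X Z (Comp BiTop X Y Z g f)
      = Comp BiTop (on_obj skula_functor X) (on_obj skula_functor Y) (on_obj skula_functor Z)
          (on_arr skula_functor Y Z g) (on_arr skula_functor X Y f)"
    if "X \<in> Obj BiTop" for X Y Z :: "'x bispace" and f g
    using that by (simp add: BiTop_def skula_functor_def p)
qed

section \<open>The functor of points\<close>

lemma topspace_bpt: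
  assumes "biframe L"
  shows "topspace (pos_top (bpt L)) = bpoints L" "topspace (neg_top (bpt L)) = bpoints L"
    and "points (bpt L) = bpoints L" and "bispace (bpt L)"
proof -
  interpret P: frame "pos L" using assms by (rule frame_pos)
  interpret N: frame "neg L" using assms by (rule frame_neg)
  have top: "fst f \<top>\<^bsub>pos L\<^esub>" "snd f \<top>\<^bsub>neg L\<^esub>" if "f \<in> bpoints L" for f
    using that frame_map_top[of "pos L" two_frame "fst f"] frame_map_top[of "neg L" two_frame "snd f"]
    by (auto simp: bpoints_def biframe_map_def two_biframe_def two_top)
  \<comment> \<open>Frame maps preserve \<top>, so the open set given by \<top> consists of all
    points.\<close>
  have "openin (pos_top (bpt L)) (bpoints L)"
    unfolding openin_pos_top_bpt[OF assms] using top(1) by (intro bexI[of _ "\<top>\<^bsub>pos L\<^esub>"]) auto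
  moreover have "U \<subseteq> bpoints L" if "openin (pos_top (bpt L)) U" for U
    using that unfolding openin_pos_top_bpt[OF assms] by auto
  ultimately show t: "topspace (pos_top (bpt L)) = bpoints L"
    by (meson openin_subset openin_topspace subset_antisym)
  have "openin (neg_top (bpt L)) (bpoints L)"
    unfolding openin_neg_top_bpt[OF assms] using top(2) by (intro bexI[of _ "\<top>\<^bsub>neg L\<^esub>"]) auto
  moreover have "U \<subseteq> bpoints L" if "openin (neg_top (bpt L)) U" for U
    using that unfolding openin_neg_top_bpt[OF assms] by auto
  ultimately show n: "topspace (neg_top (bpt L)) = bpoints L"
    by (meson openin_subset openin_topspace subset_antisym)
  show "points (bpt L) = bpoints L" "bispace (bpt L)"
    using t n by (simp_all add: points_def bispace_def)
qed

lemma bpoints_comp: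
  assumes "biframe M" "biframe_map M L h" "f \<in> bpoints L"
  shows "biframe_comp M f h \<in> bpoints M"
  using biframe_map_comp[OF assms(1,2)] assms(3) by (simp add: bpoints_def)

lemma bicontinuous_map_bpt:
  assumes L: "biframe L" and M: "biframe M" and h: "biframe_map M L h"
  shows "bicontinuous_map (bpt L) (bpt M) (\<lambda>f\<in>bpoints L. biframe_comp M f h)"
proof -
  let ?c = "\<lambda>f\<in>bpoints L. biframe_comp M f h"
  note c = bpoints_comp[OF M h]
  have "continuous_map (pos_top (bpt L)) (pos_top (bpt M)) ?c"
    unfolding continuous_map topspace_bpt[OF L] topspace_bpt[OF M]
  proof (intro conjI allI impI)
    fix U assume "openin (pos_top (bpt M)) U"
    then obtain a where a: "a \<in> carrier (pos M)" "U = {f \<in> bpoints M. fst f a = True}"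
      unfolding openin_pos_top_bpt[OF M] by blast
    then have "{f \<in> bpoints L. ?c f \<in> U} = {f \<in> bpoints L. fst f (fst h a) = True}"
      using c by (auto simp: biframe_comp_def compose_def)
    then show "openin (pos_top (bpt L)) {f \<in> bpoints L. ?c f \<in> U}"
      unfolding openin_pos_top_bpt[OF L] using frame_map_closed[OF biframe_map_pos[OF h] a(1)] by blast
  qed (use c in auto)
  moreover have "continuous_map (neg_top (bpt L)) (neg_top (bpt M)) ?c"
    unfolding continuous_map topspace_bpt[OF L] topspace_bpt[OF M]
  proof (intro conjI allI impI)
    fix U assume "openin (neg_top (bpt M)) U"
    then obtain a where a: "a \<in> carrier (neg M)" "U = {f \<in> bpoints M. snd f a = True}"
      unfolding openin_neg_top_bpt[OF M] by blast
    then have "{f \<in> bpoints L. ?c f \<in> U} = {f \<in> bpoints L. snd f (snd h a) = True}"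
      using c by (auto simp: biframe_comp_def compose_def)
    then show "openin (neg_top (bpt L)) {f \<in> bpoints L. ?c f \<in> U}"
      unfolding openin_neg_top_bpt[OF L] using frame_map_closed[OF biframe_map_neg[OF h] a(1)] by blast
  qed (use c in auto)
  ultimately show ?thesis by (simp add: bicontinuous_map_def)
qed

lemma is_functor_bpt: "is_functor (op_cat BiFrm_fin) BiTop bpt_functor"
proof (intro is_functor.intro category_op_cat category_BiFrm_fin category_BiTop is_functor_axioms.intro)
  have b: "biframe X" if "X \<in> Obj (op_cat BiFrm_fin)" for X :: "('p, 'n, 'm) biframe"
    using that by (simp add: op_cat_def BiFrm_fin_def finitary_biframe_def)
  show "on_obj bpt_functor X \<in> Obj BiTop" if "X \<in> Obj (op_cat BiFrm_fin)" for X :: "('p, 'n, 'm) biframe"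
    using topspace_bpt[OF b[OF that]] by (simp add: BiTop_def bpt_functor_def)
  show "on_arr bpt_functor X Y f \<in> Hom BiTop (on_obj bpt_functor X) (on_obj bpt_functor Y)"
    if "X \<in> Obj (op_cat BiFrm_fin)" "Y \<in> Obj (op_cat BiFrm_fin)" "f \<in> Hom (op_cat BiFrm_fin) X Y"
    for X Y :: "('p, 'n, 'm) biframe" and f
    using bicontinuous_map_bpt[OF b[OF that(1)] b[OF that(2)]] that(3) topspace_bpt[OF b[OF that(1)]]
    by (simp add: BiTop_def bpt_functor_def op_cat_def BiFrm_fin_def)
  show "on_arr bpt_functor X X (Ident (op_cat BiFrm_fin) X) = Ident BiTop (on_obj bpt_functor X)"
    if "X \<in> Obj (op_cat BiFrm_fin)" for X :: "('p, 'n, 'm) biframe"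
  proof -
    have "biframe_comp X f (biframe_id X) = f" if "f \<in> bpoints X" for f
      using that biframe_map_arr[of X two_biframe f]
      by (simp add: bpoints_def biframe_comp_def biframe_id_def compose_Id)
    then show ?thesis
      using topspace_bpt[OF b[OF that]]
      by (auto simp: BiTop_def bpt_functor_def op_cat_def BiFrm_fin_def intro: restrict_ext)
  qed
  show "on_arr bpt_functor X Z (Comp (op_cat BiFrm_fin) X Y Z g f)
      = Comp BiTop (on_obj bpt_functor X) (on_obj bpt_functor Y) (on_obj bpt_functor Z)
          (on_arr bpt_functor Y Z g) (on_arr bpt_functor X Y f)"
    if "X \<in> Obj (op_cat BiFrm_fin)" "Y \<in> Obj (op_cat BiFrm_fin)" "Z \<in> Obj (op_cat BiFrm_fin)"
      "f \<in> Hom (op_cat BiFrm_fin) X Y" "g \<in> Hom (op_cat BiFrm_fin) Y Z"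
    for X Y Z :: "('p, 'n, 'm) biframe" and f g
  proof -
    have f: "biframe_map Y X f" and g: "biframe_map Z Y g"
      using that by (auto simp: op_cat_def BiFrm_fin_def)
    have "biframe_comp Z p (biframe_comp Z f g) = biframe_comp Z (biframe_comp Y p f) g"
      if "p \<in> bpoints X" for p
      using biframe_map_arr[OF g] by (simp add: biframe_comp_def compose_assoc)
    then show ?thesis
      using bpoints_comp[OF b[OF that(2)] f] topspace_bpt[OF b[OF that(1)]]
      by (auto simp: BiTop_def bpt_functor_def op_cat_def BiFrm_fin_def compose_def)
  qed
qed

section \<open>Points of the assembly\<close>

text \<open>Precomposition with \<nabla>, cut down to the carriers so that the result is
  extensional. Unlike the extension of points, this direction has an explicit formula.\<close>

definition restrict_point :: "('p, 'n, 'm) biframe \<Rightarrow>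
    (('m \<times> 'm) set \<Rightarrow> bool) \<times> (('m \<times> 'm) set \<Rightarrow> bool) \<Rightarrow> ('p \<Rightarrow> bool) \<times> ('n \<Rightarrow> bool)" where
  "restrict_point L p = ((\<lambda>x\<in>carrier (pos L). fst p (nabla_pos L x)),
     (\<lambda>y\<in>carrier (neg L). snd p (nabla_neg L y)))"

lemma restrict_point_apply:
  "x \<in> carrier (pos L) \<Longrightarrow> fst (restrict_point L p) x = fst p (nabla_pos L x)"
  "y \<in> carrier (neg L) \<Longrightarrow> snd (restrict_point L p) y = snd p (nabla_neg L y)"
  by (simp_all add: restrict_point_def)

lemma bpoint_maps:
  assumes "f \<in> bpoints L"
  shows "frame_map (pos L) two_frame (fst f)" "frame_map (neg L) two_frame (snd f)"
    and "\<exists>h. frame_map (main L) two_frame h \<and> (\<forall>x\<in>carrier (pos L). h (epos L x) = fst f x) \<and>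
      (\<forall>y\<in>carrier (neg L). h (eneg L y) = snd f y)"
  using assms by (auto simp: bpoints_def biframe_map_def two_biframe_def)

lemma bpointsI:
  assumes "frame_map (pos L) two_frame (fst f)" "frame_map (neg L) two_frame (snd f)"
    "frame_map (main L) two_frame h" "\<And>x. x \<in> carrier (pos L) \<Longrightarrow> h (epos L x) = fst f x"
    "\<And>y. y \<in> carrier (neg L) \<Longrightarrow> h (eneg L y) = snd f y"
  shows "f \<in> bpoints L"
  using assms by (auto simp: bpoints_def biframe_map_def two_biframe_def)

lemma restrict_point_in_bpoints:
  assumes L: "biframe L" and p: "p \<in> bpoints (assembly L)"
  shows "restrict_point L p \<in> bpoints L"
proof -
  obtain k where k: "frame_map (assembly_main L) two_frame k"
    "\<And>\<theta>. \<theta> \<in> carrier (assembly_pos L) \<Longrightarrow> k \<theta> = fst p \<theta>"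
    "\<And>\<theta>. \<theta> \<in> carrier (assembly_neg L) \<Longrightarrow> k \<theta> = snd p \<theta>"
    using bpoint_maps(3)[OF p] by auto
  note m = bpoint_maps(1,2)[OF p, unfolded assembly_sel]
  show ?thesis
  proof (rule bpointsI)
    have "compose (carrier (pos L)) (fst p) (restrict (nabla_pos L) (carrier (pos L))) = fst (restrict_point L p)"
      by (auto simp: restrict_point_def compose_def intro!: restrict_ext)
    then show "frame_map (pos L) two_frame (fst (restrict_point L p))"
      using frame_map_comp[OF frame_pos[OF L] frame_map_nabla_pos[OF L] m(1)] by simp
    have "compose (carrier (neg L)) (snd p) (restrict (nabla_neg L) (carrier (neg L))) = snd (restrict_point L p)"
      by (auto simp: restrict_point_def compose_def intro!: restrict_ext)
    then show "frame_map (neg L) two_frame (snd (restrict_point L p))"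
      using frame_map_comp[OF frame_neg[OF L] frame_map_nabla_neg[OF L] m(2)] by simp
    let ?h = "compose (carrier (main L)) k (restrict (nabla (main L)) (carrier (main L)))"
    show "frame_map (main L) two_frame ?h"
      by (rule frame_map_comp[OF frame_main[OF L] frame_map_nabla_main[OF L] k(1)])
    show "?h (epos L x) = fst (restrict_point L p) x" if "x \<in> carrier (pos L)" for x
      using that epos_closed[OF L that] k(2)[OF nabla_pos_mem[OF L that]]
      by (simp add: compose_def restrict_point_def nabla_pos_def)
    show "?h (eneg L y) = snd (restrict_point L p) y" if "y \<in> carrier (neg L)" for y
      using that eneg_closed[OF L that] k(3)[OF nabla_neg_mem[OF L that]]
      by (simp add: compose_def restrict_point_def nabla_neg_def)
  qed
qed

text \<open>\<nabla> and \<Delta> of the same element lie in different components, so they are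
  evaluated by different halves of the point. The two halves are tied together by the map
  \<open>k\<close> on the main component, which sends complements to complementary truth
  values.\<close>

lemma point_delta:
  assumes L: "biframe L" and p: "p \<in> bpoints (assembly L)"
  shows point_delta_neg: "\<And>y. y \<in> carrier (neg L) \<Longrightarrow> fst p (delta_neg L y) \<longleftrightarrow> \<not> snd p (nabla_neg L y)"
    and point_delta_pos: "\<And>x. x \<in> carrier (pos L) \<Longrightarrow> snd p (delta_pos L x) \<longleftrightarrow> \<not> fst p (nabla_pos L x)"
proof -
  obtain k where k: "frame_map (assembly_main L) two_frame k"
    "\<And>\<theta>. \<theta> \<in> carrier (assembly_pos L) \<Longrightarrow> k \<theta> = fst p \<theta>"
    "\<And>\<theta>. \<theta> \<in> carrier (assembly_neg L) \<Longrightarrow> k \<theta> = snd p \<theta>"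
    using bpoint_maps(3)[OF p] by auto
  have k': "k d \<longleftrightarrow> \<not> k n" if "n \<in> carrier (assembly_main L)" "d \<in> carrier (assembly_main L)"
    "n \<sqinter>\<^bsub>assembly_main L\<^esub> d = \<bottom>\<^bsub>assembly_main L\<^esub>" "n \<squnion>\<^bsub>assembly_main L\<^esub> d = \<top>\<^bsub>assembly_main L\<^esub>" for n d
    using frame_map_meet[OF k(1) that(1,2)] frame_map_join[OF k(1) that(1,2)] that(3,4)
      frame_map_top[OF k(1)] frame_map_bottom[OF frame_assembly_main[OF L] frame_two k(1)]
    by (auto simp: two_meet two_join two_top two_bottom)
  note nd = assembly_nabla_delta[OF L] and mem = assembly_mem[OF L]
  note P = subsetD[OF assembly_pos_subset[OF L]] and N = subsetD[OF assembly_neg_subset[OF L]]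
  show "fst p (delta_neg L y) \<longleftrightarrow> \<not> snd p (nabla_neg L y)" if "y \<in> carrier (neg L)" for y
    using k'[OF N[OF mem(3)[OF that]] P[OF mem(2)[OF that]] nd(3,4)[OF that]]
      k(2)[OF mem(2)[OF that]] k(3)[OF mem(3)[OF that]] by simp
  show "snd p (delta_pos L x) \<longleftrightarrow> \<not> fst p (nabla_pos L x)" if "x \<in> carrier (pos L)" for x
    using k'[OF P[OF mem(1)[OF that]] N[OF mem(4)[OF that]] nd(1,2)[OF that]]
      k(2)[OF mem(1)[OF that]] k(3)[OF mem(4)[OF that]] by simp
qed

text \<open>Each half of a point is determined by its values at generators, and
  \<open>point_delta\<close> recovers those at \<Delta> from the values of the other half at
  \<nabla>.\<close>

lemma inj_on_restrict_point:
  assumes L: "biframe L"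
  shows "inj_on (restrict_point L) (bpoints (assembly L))"
proof (rule inj_onI)
  fix p q assume p: "p \<in> bpoints (assembly L)" and q: "q \<in> bpoints (assembly L)"
    and eq: "restrict_point L p = restrict_point L q"
  have f: "fst p (nabla_pos L x) = fst q (nabla_pos L x)" if "x \<in> carrier (pos L)" for x
    using fun_cong[OF arg_cong[OF eq, of fst], of x] that by (simp add: restrict_point_def)
  have s: "snd p (nabla_neg L y) = snd q (nabla_neg L y)" if "y \<in> carrier (neg L)" for y
    using fun_cong[OF arg_cong[OF eq, of snd], of y] that by (simp add: restrict_point_def)
  note mp = bpoint_maps(1,2)[OF p, unfolded assembly_sel] and mq = bpoint_maps(1,2)[OF q, unfolded assembly_sel]
  show "p = q"
  proof (rule prod_eqI)
    show "fst p = fst q"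
      by (rule frame_map_assembly_pos_eqI[OF L mp(1) mq(1)])
        (simp_all add: f s point_delta_neg[OF L p] point_delta_neg[OF L q])
    show "snd p = snd q"
      by (rule frame_map_assembly_neg_eqI[OF L mp(2) mq(2)])
        (simp_all add: f s point_delta_pos[OF L p] point_delta_pos[OF L q])
  qed
qed

lemma restrict_point_surj:
  assumes L: "biframe L" and f: "f \<in> bpoints L"
  shows "f \<in> restrict_point L ` bpoints (assembly L)"
proof -
  obtain h where h: "frame_map (main L) two_frame h"
    "\<And>x. x \<in> carrier (pos L) \<Longrightarrow> h (epos L x) = fst f x"
    "\<And>y. y \<in> carrier (neg L) \<Longrightarrow> h (eneg L y) = snd f y"
    using bpoint_maps(3)[OF f] by auto
  obtain G where G: "frame_map (assembly_main L) two_frame G"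
    "\<And>a. a \<in> carrier (main L) \<Longrightarrow> G (nabla (main L) a) = h a"
    by (rule assembly_main_extension[OF L frame_two h(1), of "\<lambda>x. \<not> h (epos L x)" "\<lambda>y. \<not> h (eneg L y)"])
      (auto simp: carrier_two two_meet two_join two_top two_bottom)
  let ?p = "(restrict G (carrier (assembly_pos L)), restrict G (carrier (assembly_neg L)))"
  have p: "?p \<in> bpoints (assembly L)"
    by (rule bpointsI[of _ _ G])
      (use frame_map_assembly_restrict[OF L frame_two G(1)] G(1) in auto)
  have "restrict_point L ?p = f"
  proof (rule prod_eqI)
    show "fst (restrict_point L ?p) = fst f"
    proof (rule extensionalityI)
      show "fst (restrict_point L ?p) x = fst f x" if "x \<in> carrier (pos L)" for x
        using that G(2)[OF epos_closed[OF L that]] nabla_pos_mem[OF L that]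
        by (simp add: restrict_point_def h(2) nabla_pos_def)
    qed (use frame_map_extensional[OF bpoint_maps(1)[OF f]] in \<open>auto simp: restrict_point_def\<close>)
    show "snd (restrict_point L ?p) = snd f"
    proof (rule extensionalityI)
      show "snd (restrict_point L ?p) y = snd f y" if "y \<in> carrier (neg L)" for y
        using that G(2)[OF eneg_closed[OF L that]] nabla_neg_mem[OF L that]
        by (simp add: restrict_point_def h(3) nabla_neg_def)
    qed (use frame_map_extensional[OF bpoint_maps(2)[OF f]] in \<open>auto simp: restrict_point_def\<close>)
  qed
  then show ?thesis using p by (metis imageI)
qed

text \<open>Extensions of points come from an existence argument without a formula, so the map is
  introduced as the inverse of the bijection \<open>restrict_point\<close>.\<close>

definition extend_point :: "('p, 'n, 'm) biframe \<Rightarrow>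
    ('p \<Rightarrow> bool) \<times> ('n \<Rightarrow> bool) \<Rightarrow> (('m \<times> 'm) set \<Rightarrow> bool) \<times> (('m \<times> 'm) set \<Rightarrow> bool)" where
  "extend_point L = inv_into (bpoints (assembly L)) (restrict_point L)"

lemma extend_point:
  assumes "biframe L"
  shows extend_point_in_bpoints: "\<And>f. f \<in> bpoints L \<Longrightarrow> extend_point L f \<in> bpoints (assembly L)"
    and restrict_extend_point: "\<And>f. f \<in> bpoints L \<Longrightarrow> restrict_point L (extend_point L f) = f"
    and extend_restrict_point: "\<And>p. p \<in> bpoints (assembly L) \<Longrightarrow> extend_point L (restrict_point L p) = p"
  unfolding extend_point_def
  using restrict_point_surj[OF assms] inj_on_restrict_point[OF assms]
  by (auto simp: inv_into_into f_inv_into_f inv_into_f_f)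

lemma extend_point_nabla:
  assumes "biframe L" "f \<in> bpoints L"
  shows "\<And>x. x \<in> carrier (pos L) \<Longrightarrow> fst (extend_point L f) (nabla_pos L x) = fst f x"
    and "\<And>y. y \<in> carrier (neg L) \<Longrightarrow> snd (extend_point L f) (nabla_neg L y) = snd f y"
  using fun_cong[OF arg_cong[OF restrict_extend_point[OF assms], of fst]]
    fun_cong[OF arg_cong[OF restrict_extend_point[OF assms], of snd]]
  by (auto simp: restrict_point_def restrict_def split: if_splits) metis+

text \<open>Points turn binary meets into intersections and joins into unions, and topologies are
  closed under both. Openness of all the sets given by elements of \<open>A\<close> can therefore be
  checked at generators of \<open>A\<close>.\<close>

lemma subframe_open_points:
  assumes "frame A" "openin T P" "\<And>f. f \<in> P \<Longrightarrow> frame_map A two_frame (\<pi> f)"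
  shows "subframe {a \<in> carrier A. openin T {f \<in> P. \<pi> f a}} A"
proof -
  interpret A: frame A by fact
  have "openin T {f \<in> P. \<pi> f \<top>\<^bsub>A\<^esub>}"
  proof -
    have "{f \<in> P. \<pi> f \<top>\<^bsub>A\<^esub>} = P" using frame_map_top[OF assms(3)] by (auto simp: two_top)
    then show ?thesis using assms(2) by simp
  qed
  moreover have "openin T {f \<in> P. \<pi> f (a \<sqinter>\<^bsub>A\<^esub> b)}"
    if "a \<in> carrier A" "b \<in> carrier A" "openin T {f \<in> P. \<pi> f a}" "openin T {f \<in> P. \<pi> f b}" for a b
  proof -
    have "{f \<in> P. \<pi> f (a \<sqinter>\<^bsub>A\<^esub> b)} = {f \<in> P. \<pi> f a} \<inter> {f \<in> P. \<pi> f b}"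
      using frame_map_meet[OF assms(3) that(1,2)] by (auto simp: two_meet)
    then show ?thesis using openin_Int[OF that(3,4)] by (simp only:)
  qed
  moreover have "openin T {f \<in> P. \<pi> f (\<Squnion>\<^bsub>A\<^esub> S)}"
    if S: "S \<subseteq> carrier A" "\<And>a. a \<in> S \<Longrightarrow> openin T {f \<in> P. \<pi> f a}" for S
  proof -
    have "{f \<in> P. \<pi> f (\<Squnion>\<^bsub>A\<^esub> S)} = (\<Union>a\<in>S. {f \<in> P. \<pi> f a})"
      using frame_map_sup[OF assms(3) S(1)] by (auto simp: two_sup)
    then show ?thesis using S(2) by auto
  qed
  moreover have "\<Squnion>\<^bsub>A\<^esub> S \<in> carrier A" if "S \<subseteq> {a \<in> carrier A. openin T {f \<in> P. \<pi> f a}}" for S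
    using that by (intro A.sup_closed) auto
  ultimately show ?thesis
    unfolding subframe_def by (auto simp: subset_iff)
qed

section \<open>Bicontinuity and naturality of the comparison of points\<close>

lemma closedin_bpt:
  assumes L: "biframe L"
  shows "\<And>C. closedin (pos_top (bpt L)) C \<longleftrightarrow> (\<exists>a\<in>carrier (pos L). C = {f \<in> bpoints L. \<not> fst f a})"
    and "\<And>C. closedin (neg_top (bpt L)) C \<longleftrightarrow> (\<exists>a\<in>carrier (neg L). C = {f \<in> bpoints L. \<not> snd f a})"
proof -
  have *: "C \<subseteq> P \<and> P - C = {f \<in> P. Q f} \<longleftrightarrow> C = {f \<in> P. \<not> Q f}" for C P :: "'x set" and Q by blast
  show "closedin (pos_top (bpt L)) C \<longleftrightarrow> (\<exists>a\<in>carrier (pos L). C = {f \<in> bpoints L. \<not> fst f a})" for C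
    using *[of C "bpoints L"]
    by (simp add: closedin_def topspace_bpt[OF L] openin_pos_top_bpt[OF L] flip: *)
  show "closedin (neg_top (bpt L)) C \<longleftrightarrow> (\<exists>a\<in>carrier (neg L). C = {f \<in> bpoints L. \<not> snd f a})" for C
    by (simp add: closedin_def topspace_bpt[OF L] openin_neg_top_bpt[OF L] flip: *)
qed

text \<open>Preimages of subbasic Skula opens are basic opens: an open set pulls back to the one
  given by \<nabla>(a), and a closed set, being defined by a negated value, to the one given by
  \<Delta>(a).\<close>

lemma bicontinuous_restrict_point:
  assumes L: "biframe L"
  shows "bicontinuous_map (bpt (assembly L)) (skula (bpt L)) (restrict_point L)"
proof -
  let ?A = "assembly L"
  note A = biframe_assembly[OF L]
  note tA = topspace_bpt[OF A] and tL = topspace_bpt[OF L]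
  note r = restrict_point_in_bpoints[OF L] and d = point_delta[OF L]
  note mem = assembly_mem[OF L]
  have im: "restrict_point L ` topspace (pos_top (bpt ?A)) \<subseteq> points (bpt L)"
    "restrict_point L ` topspace (neg_top (bpt ?A)) \<subseteq> points (bpt L)"
    using r by (auto simp: tA tL)
  have op: "openin (pos_top (bpt ?A)) {p \<in> bpoints ?A. fst p \<theta>}" if "\<theta> \<in> carrier (assembly_pos L)" for \<theta>
    using that unfolding openin_pos_top_bpt[OF A] by auto
  have on: "openin (neg_top (bpt ?A)) {p \<in> bpoints ?A. snd p \<theta>}" if "\<theta> \<in> carrier (assembly_neg L)" for \<theta>
    using that unfolding openin_neg_top_bpt[OF A] by auto
  have "continuous_map (pos_top (bpt ?A)) (pos_top (skula (bpt L))) (restrict_point L)"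
  proof (rule continuous_map_into_skula(1)[OF tL(4) im(1)], unfold tA)
    fix U assume "openin (pos_top (bpt L)) U"
    then obtain a where a: "a \<in> carrier (pos L)" "U = {f \<in> bpoints L. fst f a = True}"
      unfolding openin_pos_top_bpt[OF L] by blast
    then have "{p \<in> bpoints ?A. restrict_point L p \<in> U} = {p \<in> bpoints ?A. fst p (nabla_pos L a)}"
      by (intro Collect_cong conj_cong refl) (simp add: r restrict_point_apply)
    then show "openin (pos_top (bpt ?A)) {p \<in> bpoints ?A. restrict_point L p \<in> U}"
      using op[OF mem(1)[OF a(1)]] by simp
  next
    fix C assume "closedin (neg_top (bpt L)) C"
    then obtain a where a: "a \<in> carrier (neg L)" "C = {f \<in> bpoints L. \<not> snd f a}"
      unfolding closedin_bpt[OF L] by blast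
    then have "{p \<in> bpoints ?A. restrict_point L p \<in> C} = {p \<in> bpoints ?A. fst p (delta_neg L a)}"
      by (intro Collect_cong conj_cong refl) (simp add: r d(1) restrict_point_apply)
    then show "openin (pos_top (bpt ?A)) {p \<in> bpoints ?A. restrict_point L p \<in> C}"
      using op[OF mem(2)[OF a(1)]] by simp
  qed
  moreover have "continuous_map (neg_top (bpt ?A)) (neg_top (skula (bpt L))) (restrict_point L)"
  proof (rule continuous_map_into_skula(2)[OF tL(4) im(2)], unfold tA)
    fix U assume "openin (neg_top (bpt L)) U"
    then obtain a where a: "a \<in> carrier (neg L)" "U = {f \<in> bpoints L. snd f a = True}"
      unfolding openin_neg_top_bpt[OF L] by blast
    then have "{p \<in> bpoints ?A. restrict_point L p \<in> U} = {p \<in> bpoints ?A. snd p (nabla_neg L a)}"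
      by (intro Collect_cong conj_cong refl) (simp add: r restrict_point_apply)
    then show "openin (neg_top (bpt ?A)) {p \<in> bpoints ?A. restrict_point L p \<in> U}"
      using on[OF mem(3)[OF a(1)]] by simp
  next
    fix C assume "closedin (pos_top (bpt L)) C"
    then obtain a where a: "a \<in> carrier (pos L)" "C = {f \<in> bpoints L. \<not> fst f a}"
      unfolding closedin_bpt[OF L] by blast
    then have "{p \<in> bpoints ?A. restrict_point L p \<in> C} = {p \<in> bpoints ?A. snd p (delta_pos L a)}"
      by (intro Collect_cong conj_cong refl) (simp add: r d(2) restrict_point_apply)
    then show "openin (neg_top (bpt ?A)) {p \<in> bpoints ?A. restrict_point L p \<in> C}"
      using on[OF mem(4)[OF a(1)]] by simp
  qed
  ultimately show ?thesis by (simp add: bicontinuous_map_def)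
qed

text \<open>An element of a component may be far from a generator, so there is no direct formula for
  the preimages. The elements whose preimage is Skula-open form a subframe by
  \<open>subframe_open_points\<close>; at \<nabla> the preimage is open in the original topology, at
  \<Delta> it is closed in the other one.\<close>

lemma bicontinuous_extend_point:
  assumes L: "biframe L"
  shows "bicontinuous_map (skula (bpt L)) (bpt (assembly L)) (extend_point L)"
proof -
  let ?A = "assembly L" and ?S = "skula (bpt L)"
  note A = biframe_assembly[OF L]
  note tA = topspace_bpt[OF A] and tL = topspace_bpt[OF L]
  note tS = points_skula[OF tL(4), unfolded tL(3)]
  note e = extend_point_in_bpoints[OF L] and en = extend_point_nabla[OF L] and d = point_delta[OF L e]
  have P: "openin (pos_top ?S) (bpoints L)" "openin (neg_top ?S) (bpoints L)"
    using openin_topspace[of "pos_top ?S"] openin_topspace[of "neg_top ?S"] by (simp_all add: tS)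
  have "{\<theta> \<in> carrier (assembly_pos L). openin (pos_top ?S) {f \<in> bpoints L. fst (extend_point L f) \<theta>}} \<supseteq> carrier (assembly_pos L)"
  proof (rule assembly_pos_least[OF L])
    show "subframe {\<theta> \<in> carrier (assembly_pos L). openin (pos_top ?S) {f \<in> bpoints L. fst (extend_point L f) \<theta>}} (assembly_pos L)"
      by (rule subframe_open_points[OF frame_assembly_pos[OF L] P(1)])
        (use bpoint_maps(1)[OF e] in simp)
    show "nabla_pos L x \<in> {\<theta> \<in> carrier (assembly_pos L). openin (pos_top ?S) {f \<in> bpoints L. fst (extend_point L f) \<theta>}}"
      if "x \<in> carrier (pos L)" for x
    proof -
      have "{f \<in> bpoints L. fst (extend_point L f) (nabla_pos L x)} = {f \<in> bpoints L. fst f x = True}"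
        using en(1) that by auto
      moreover have "openin (pos_top (bpt L)) {f \<in> bpoints L. fst f x = True}"
        unfolding openin_pos_top_bpt[OF L] using that by blast
      ultimately show ?thesis using nabla_pos_mem[OF L that] openin_skula(1) by simp
    qed
    show "delta_neg L y \<in> {\<theta> \<in> carrier (assembly_pos L). openin (pos_top ?S) {f \<in> bpoints L. fst (extend_point L f) \<theta>}}"
      if "y \<in> carrier (neg L)" for y
    proof -
      have "{f \<in> bpoints L. fst (extend_point L f) (delta_neg L y)} = {f \<in> bpoints L. \<not> snd f y}"
        using en(2) d(1) that by auto
      moreover have "closedin (neg_top (bpt L)) {f \<in> bpoints L. \<not> snd f y}"
        unfolding closedin_bpt[OF L] using that by blast
      ultimately show ?thesis using delta_neg_mem[OF L that] openin_skula(2) by simp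
    qed
  qed
  then have op: "openin (pos_top ?S) {f \<in> bpoints L. fst (extend_point L f) \<theta>}"
    if "\<theta> \<in> carrier (assembly_pos L)" for \<theta>
    using that by blast
  have "continuous_map (pos_top ?S) (pos_top (bpt ?A)) (extend_point L)"
    unfolding continuous_map tA tS
  proof (intro conjI allI impI)
    fix U assume "openin (pos_top (bpt ?A)) U"
    then obtain \<theta> where \<theta>: "\<theta> \<in> carrier (assembly_pos L)" "U = {p \<in> bpoints ?A. fst p \<theta> = True}"
      unfolding openin_pos_top_bpt[OF A] by auto
    then have "{f \<in> bpoints L. extend_point L f \<in> U} = {f \<in> bpoints L. fst (extend_point L f) \<theta>}"
      by (intro Collect_cong conj_cong refl) (simp add: e)
    then show "openin (pos_top ?S) {f \<in> bpoints L. extend_point L f \<in> U}"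
      using op[OF \<theta>(1)] by simp
  qed (use e in blast)
  moreover have "{\<theta> \<in> carrier (assembly_neg L). openin (neg_top ?S) {f \<in> bpoints L. snd (extend_point L f) \<theta>}} \<supseteq> carrier (assembly_neg L)"
  proof (rule assembly_neg_least[OF L])
    show "subframe {\<theta> \<in> carrier (assembly_neg L). openin (neg_top ?S) {f \<in> bpoints L. snd (extend_point L f) \<theta>}} (assembly_neg L)"
      by (rule subframe_open_points[OF frame_assembly_neg[OF L] P(2)])
        (use bpoint_maps(2)[OF e] in simp)
    show "nabla_neg L y \<in> {\<theta> \<in> carrier (assembly_neg L). openin (neg_top ?S) {f \<in> bpoints L. snd (extend_point L f) \<theta>}}"
      if "y \<in> carrier (neg L)" for y
    proof -
      have "{f \<in> bpoints L. snd (extend_point L f) (nabla_neg L y)} = {f \<in> bpoints L. snd f y = True}"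
        using en(2) that by auto
      moreover have "openin (neg_top (bpt L)) {f \<in> bpoints L. snd f y = True}"
        unfolding openin_neg_top_bpt[OF L] using that by blast
      ultimately show ?thesis using nabla_neg_mem[OF L that] openin_skula(3) by simp
    qed
    show "delta_pos L x \<in> {\<theta> \<in> carrier (assembly_neg L). openin (neg_top ?S) {f \<in> bpoints L. snd (extend_point L f) \<theta>}}"
      if "x \<in> carrier (pos L)" for x
    proof -
      have "{f \<in> bpoints L. snd (extend_point L f) (delta_pos L x)} = {f \<in> bpoints L. \<not> fst f x}"
        using en(1) d(2) that by auto
      moreover have "closedin (pos_top (bpt L)) {f \<in> bpoints L. \<not> fst f x}"
        unfolding closedin_bpt[OF L] using that by blast
      ultimately show ?thesis using delta_pos_mem[OF L that] openin_skula(4) by simp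
    qed
  qed
  then have op: "openin (neg_top ?S) {f \<in> bpoints L. snd (extend_point L f) \<theta>}"
    if "\<theta> \<in> carrier (assembly_neg L)" for \<theta>
    using that by blast
  have "continuous_map (neg_top ?S) (neg_top (bpt ?A)) (extend_point L)"
    unfolding continuous_map tA tS
  proof (intro conjI allI impI)
    fix U assume "openin (neg_top (bpt ?A)) U"
    then obtain \<theta> where \<theta>: "\<theta> \<in> carrier (assembly_neg L)" "U = {p \<in> bpoints ?A. snd p \<theta> = True}"
      unfolding openin_neg_top_bpt[OF A] by auto
    then have "{f \<in> bpoints L. extend_point L f \<in> U} = {f \<in> bpoints L. snd (extend_point L f) \<theta>}"
      by (intro Collect_cong conj_cong refl) (simp add: e)
    then show "openin (neg_top ?S) {f \<in> bpoints L. extend_point L f \<in> U}"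
      using op[OF \<theta>(1)] by simp
  qed (use e in blast)
  ultimately show ?thesis by (simp add: bicontinuous_map_def)
qed

text \<open>Restriction of points is injective, so it suffices that both sides restrict to the same
  point of \<open>M\<close>; this holds because the assembly of \<open>h\<close> commutes with
  \<nabla>.\<close>

lemma extend_point_natural:
  assumes L: "biframe L" and M: "biframe M" and h: "biframe_map M L h" and f: "f \<in> bpoints L"
  shows "extend_point M (biframe_comp M f h) = biframe_comp (assembly M) (extend_point L f) (assembly_map M L h)"
proof -
  note lift = assembly_lift_assembly_map[OF M L h, unfolded assembly_lift_def]
  let ?q = "biframe_comp (assembly M) (extend_point L f) (assembly_map M L h)"
  have q: "?q \<in> bpoints (assembly M)"
    by (rule bpoints_comp[OF biframe_assembly[OF M] _ extend_point_in_bpoints[OF L f]]) (use lift in blast)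
  have "restrict_point M ?q = biframe_comp M f h"
  proof (rule prod_eqI)
    show "fst (restrict_point M ?q) = fst (biframe_comp M f h)"
      using lift nabla_pos_mem[OF M] extend_point_nabla(1)[OF L f] frame_map_closed[OF biframe_map_pos[OF h]]
      by (auto simp: restrict_point_def biframe_comp_def compose_def intro!: restrict_ext)
    show "snd (restrict_point M ?q) = snd (biframe_comp M f h)"
      using lift nabla_neg_mem[OF M] extend_point_nabla(2)[OF L f] frame_map_closed[OF biframe_map_neg[OF h]]
      by (auto simp: restrict_point_def biframe_comp_def compose_def intro!: restrict_ext)
  qed
  then show ?thesis using extend_restrict_point[OF M q] by simp
qed

theorem theorem4p23:
  shows
    "is_functor (op_cat (BiFrm_fin :: (('p, 'n, 'm) biframe, ('p, 'n) biframe_arrow) cat))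
       BiTop bpt_functor \<and>
     is_functor (BiTop :: ('x bispace, 'x \<Rightarrow> 'x) cat) BiTop skula_functor \<and>
     is_functor (op_cat (BiFrm_fin :: (('p, 'n, 'm) biframe, ('p, 'n) biframe_arrow) cat))
       (op_cat BiFrm_fin) (op_functor assembly_functor) \<and>
     (\<exists>\<eta>. BiTop_natural_iso
       (op_cat (BiFrm_fin :: (('p, 'n, 'm) biframe, ('p, 'n) biframe_arrow) cat))
       (skula_functor \<circ>\<^sub>F bpt_functor) (bpt_functor \<circ>\<^sub>F op_functor assembly_functor) \<eta>)"
proof (intro conjI exI)
  note A = is_functor_op[OF is_functor_assembly]
  show "is_functor (op_cat (BiFrm_fin :: (('p, 'n, 'm) biframe, ('p, 'n) biframe_arrow) cat)) BiTop bpt_functor"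
    by (rule is_functor_bpt)
  show "is_functor (BiTop :: ('x bispace, 'x \<Rightarrow> 'x) cat) BiTop skula_functor"
    by (rule is_functor_skula)
  show "is_functor (op_cat (BiFrm_fin :: (('p, 'n, 'm) biframe, ('p, 'n) biframe_arrow) cat))
       (op_cat BiFrm_fin) (op_functor assembly_functor)"
    by (rule A)
  \<comment> \<open>The component at a biframe extends its points along \<nabla>; the bicontinuous
    inverse is restriction along \<nabla>.\<close>
  show "BiTop_natural_iso
       (op_cat (BiFrm_fin :: (('p, 'n, 'm) biframe, ('p, 'n) biframe_arrow) cat))
       (skula_functor \<circ>\<^sub>F bpt_functor) (bpt_functor \<circ>\<^sub>F op_functor assembly_functor) extend_point"
    unfolding BiTop_natural_iso_def
  proof (intro conjI ballI)
    show "is_functor (op_cat BiFrm_fin) BiTop (skula_functor \<circ>\<^sub>F bpt_functor)"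
      by (rule is_functor_comp[OF is_functor_bpt is_functor_skula])
    show "is_functor (op_cat BiFrm_fin) BiTop (bpt_functor \<circ>\<^sub>F op_functor assembly_functor)"
      by (rule is_functor_comp[OF A is_functor_bpt])
    have b: "biframe X" if "X \<in> Obj (op_cat BiFrm_fin)" for X :: "('p, 'n, 'm) biframe"
      using that by (simp add: op_cat_def BiFrm_fin_def finitary_biframe_def)
    have pS: "points (skula (bpt X)) = bpoints X" if "biframe X" for X :: "('p, 'n, 'm) biframe"
      using points_skula(1)[OF topspace_bpt(4)[OF that]] topspace_bpt[OF that] by (simp add: points_def)
    show "bihomeomorphism (on_obj (skula_functor \<circ>\<^sub>F bpt_functor) X)
        (on_obj (bpt_functor \<circ>\<^sub>F op_functor assembly_functor) X) (extend_point X)"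
      if "X \<in> Obj (op_cat BiFrm_fin)" for X :: "('p, 'n, 'm) biframe"
    proof -
      note X = b[OF that]
      have "bihomeomorphism (skula (bpt X)) (bpt (assembly X)) (extend_point X)"
        unfolding bihomeomorphism_def
        using bicontinuous_extend_point[OF X] bicontinuous_restrict_point[OF X] extend_point(2,3)[OF X]
          topspace_bpt[OF biframe_assembly[OF X]] pS[OF X] by auto
      then show ?thesis
        by (simp add: comp_functor_def skula_functor_def bpt_functor_def op_functor_def assembly_functor_def)
    qed
    show "extend_point Y (on_arr (skula_functor \<circ>\<^sub>F bpt_functor) X Y f x)
        = on_arr (bpt_functor \<circ>\<^sub>F op_functor assembly_functor) X Y f (extend_point X x)"
      if "X \<in> Obj (op_cat BiFrm_fin)" "Y \<in> Obj (op_cat BiFrm_fin)" "f \<in> Hom (op_cat BiFrm_fin) X Y"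
        "x \<in> points (on_obj (skula_functor \<circ>\<^sub>F bpt_functor) X)"
      for X Y :: "('p, 'n, 'm) biframe" and f x
    proof -
      note X = b[OF that(1)] and Y = b[OF that(2)]
      have f: "biframe_map Y X f" using that(3) by (simp add: op_cat_def BiFrm_fin_def)
      have x: "x \<in> bpoints X"
        using that(4) pS[OF X] by (simp add: comp_functor_def skula_functor_def bpt_functor_def)
      show ?thesis
        using extend_point_natural[OF X Y f x] x extend_point(1)[OF X x]
        by (simp add: comp_functor_def skula_functor_def bpt_functor_def op_functor_def assembly_functor_def)
    qed
  qed
qed

end
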